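(* Let $\mathcal{R}$ be a set of graphs and let $\mathcal{C}$ be a class of finite simple undirected graphs such that no graph in $\mathcal{C}$ has a graph in $\mathcal{R}$ as a subgraph. If $\mathcal{R}$ contains a graph with constant size, then the algorithm $\mathrm{EIS}$ enumerates all independent sets of a given graph $G\in\mathcal{C}$ with $O(1)$ amortized time per independent set and $O(n+m)$ space, where $n$ and $m$ are the numbers of vertices and edges of $G$.
   Context: "Constant size" means that the number of vertices of the graph in $\mathcal{R}$ is a constant independent of the input $G$; the constant hidden in $O(1)$ may depend on it. Subgraphs are not required to be induced. The enumeration problem: given $G$, output all independent sets of $G$ (including the empty set) without duplication. An enumeration algorithm runs in $O(f)$ amortized time if its total running time is $O(f\cdot M)$, where $M$ is the number of solutions. Instead of each full solution, the algorithm outputs only the difference from the previously output solution. Algorithm $\mathrm{EIS}(G)$ calls $\mathrm{RecEIS}(G,\emptyset)$. The procedure $\mathrm{RecEIS}(G,S)$ outputs $S$; then, while $G$ has a vertex, it picks a vertex $v$ of minimum degree in the current graph $G$ (ties broken by a fixed deterministic rule), calls $\mathrm{RecEIS}(G\setminus N[v],\,S\cup\{v\})$, and then replaces $G$ by $G\setminus\{v\}$. Here $N[v]$ is the closed neighborhood of $v$ in the current graph, and $G\setminus U$ is the subgraph induced by $V(G)\setminus U$. The claim is that this algorithm can be implemented within the stated bounds. The model of computation is the standard random access machine; space is counted in words. *)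

theory Defs
  imports Main
begin

section \<open>Graphs\<close>

record 'a graph =
  verts :: "'a set"
  edges :: "'a set set"

definition simple_graph :: "'a graph \<Rightarrow> bool" where
  "simple_graph G \<longleftrightarrow> (\<forall>e\<in>edges G. e \<subseteq> verts G \<and> card e = 2)"

definition finite_simple_graph :: "'a graph \<Rightarrow> bool" where
  "finite_simple_graph G \<longleftrightarrow> finite (verts G) \<and> simple_graph G"

definition subgraph :: "'a graph \<Rightarrow> 'a graph \<Rightarrow> bool" where
  "subgraph H G \<longleftrightarrow> verts H \<subseteq> verts G \<and> edges H \<subseteq> edges G"

definition isomorphic :: "'b graph \<Rightarrow> 'a graph \<Rightarrow> bool" where
  "isomorphic H H' \<longleftrightarrow>
     (\<exists>f. bij_betw f (verts H) (verts H') \<and> edges H' = (\<lambda>e. f ` e) ` edges H)"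

text \<open>Containment of subgraphs is up to isomorphism and not necessarily induced.\<close>

definition has_subgraph :: "'a graph \<Rightarrow> 'b graph \<Rightarrow> bool" where
  "has_subgraph G H \<longleftrightarrow> (\<exists>H'. subgraph H' G \<and> isomorphic H H')"

definition delete_verts :: "'a graph \<Rightarrow> 'a set \<Rightarrow> 'a graph" where
  "delete_verts G U =
     \<lparr>verts = verts G - U, edges = {e \<in> edges G. e \<subseteq> verts G - U}\<rparr>"

definition nbrs :: "'a graph \<Rightarrow> 'a \<Rightarrow> 'a set" where
  "nbrs G v = {u. {u, v} \<in> edges G}"

definition closed_nbrs :: "'a graph \<Rightarrow> 'a \<Rightarrow> 'a set" where
  "closed_nbrs G v = insert v (nbrs G v)"

definition degree :: "'a graph \<Rightarrow> 'a \<Rightarrow> nat" where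
  "degree G v = card (nbrs G v)"

definition independent_sets :: "'a graph \<Rightarrow> 'a set set" where
  "independent_sets G = {S. S \<subseteq> verts G \<and> (\<forall>u\<in>S. \<forall>v\<in>S. {u, v} \<notin> edges G)}"


section \<open>The algorithm EIS\<close>

text \<open>
  A deterministic way to choose a vertex of minimum degree; the way ties are broken
  is part of the function.
\<close>

definition min_degree_rule :: "('a graph \<Rightarrow> 'a) \<Rightarrow> bool" where
  "min_degree_rule pick \<longleftrightarrow>
     (\<forall>G. finite_simple_graph G \<and> verts G \<noteq> {} \<longrightarrow>
        pick G \<in> verts G \<and> (\<forall>u\<in>verts G. degree G (pick G) \<le> degree G u))"

text \<open>
  The result is the list of the sets output, in the order of output; \<open>eis_loop\<close> is the
  while loop.  For finite simple graphs and a minimum degree rule the loop condition is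
  equivalent to \<open>verts G \<noteq> {}\<close>; its other conjuncts only make the recursion total.
\<close>

function rec_eis :: "('a graph \<Rightarrow> 'a) \<Rightarrow> 'a graph \<Rightarrow> 'a set \<Rightarrow> 'a set list"
  and eis_loop :: "('a graph \<Rightarrow> 'a) \<Rightarrow> 'a graph \<Rightarrow> 'a set \<Rightarrow> 'a set list" where
  "rec_eis pick G S = S # eis_loop pick G S"
| "eis_loop pick G S =
     (if verts G \<noteq> {} \<and> finite (verts G) \<and> pick G \<in> verts G
      then rec_eis pick (delete_verts G (closed_nbrs G (pick G))) (insert (pick G) S)
           @ eis_loop pick (delete_verts G {pick G}) S
      else [])"
  by pat_completeness auto

lemma card_delete_verts_less:
  assumes "finite (verts G)" "v \<in> verts G" "v \<in> U"
  shows "card (verts (delete_verts G U)) < card (verts G)"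
  using assms by (auto simp: delete_verts_def intro!: psubset_card_mono)

termination
proof (relation "measure (\<lambda>x. case x of
    Inl (pick, G, S) \<Rightarrow> 2 * card (verts G) + 1 | Inr (pick, G, S) \<Rightarrow> 2 * card (verts G))",
    goal_cases)
  case (3 pick G S)
  then show ?case
    using card_delete_verts_less[of G "pick G" "closed_nbrs G (pick G)"]
    by (auto simp: closed_nbrs_def)
next
  case (4 pick G S)
  then show ?case
    using card_delete_verts_less[of G "pick G" "{pick G}"] by auto
qed auto

declare rec_eis.simps [simp del] eis_loop.simps [simp del]

definition EIS :: "('a graph \<Rightarrow> 'a) \<Rightarrow> 'a graph \<Rightarrow> 'a set list" where
  "EIS pick G = rec_eis pick G {}"


section \<open>Random access machines\<close>

text \<open>
  The additive random access machine with unit costs, in the style of Cook and Reckhow,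
  over the natural numbers (subtraction is truncated).  \<open>Load i j\<close> is
  \<open>X i := X (X j)\<close>, \<open>Store i j\<close> is \<open>X (X i) := X j\<close>, and \<open>Jump_pos i l\<close> jumps to
  instruction \<open>l\<close> if \<open>X i > 0\<close>.  The input tape is read once, from left to right;
  reading beyond its end gives 0.  The machine halts when it leaves the program.
\<close>

datatype instr =
    Const nat nat
  | Add nat nat nat
  | Sub nat nat nat
  | Load nat nat
  | Store nat nat
  | Jump_pos nat nat
  | Read nat
  | Print nat

type_synonym program = "instr list"

record config =
  pc :: nat
  mem :: "nat \<Rightarrow> nat"
  tape :: "nat list"
  printed :: "nat list"

definition initial :: "nat list \<Rightarrow> config" where
  "initial x = \<lparr>pc = 0, mem = (\<lambda>_. 0), tape = x, printed = []\<rparr>"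

fun exec :: "instr \<Rightarrow> config \<Rightarrow> config" where
  "exec (Const i k) c = c\<lparr>pc := Suc (pc c), mem := (mem c)(i := k)\<rparr>"
| "exec (Add i j k) c = c\<lparr>pc := Suc (pc c), mem := (mem c)(i := mem c j + mem c k)\<rparr>"
| "exec (Sub i j k) c = c\<lparr>pc := Suc (pc c), mem := (mem c)(i := mem c j - mem c k)\<rparr>"
| "exec (Load i j) c = c\<lparr>pc := Suc (pc c), mem := (mem c)(i := mem c (mem c j))\<rparr>"
| "exec (Store i j) c = c\<lparr>pc := Suc (pc c), mem := (mem c)(mem c i := mem c j)\<rparr>"
| "exec (Jump_pos i l) c = c\<lparr>pc := (if mem c i > 0 then l else Suc (pc c))\<rparr>"
| "exec (Read i) c =
     c\<lparr>pc := Suc (pc c), mem := (mem c)(i := (case tape c of [] \<Rightarrow> 0 | x # _ \<Rightarrow> x)),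
       tape := tl (tape c)\<rparr>"
| "exec (Print i) c = c\<lparr>pc := Suc (pc c), printed := printed c @ [mem c i]\<rparr>"

fun accessed :: "instr \<Rightarrow> (nat \<Rightarrow> nat) \<Rightarrow> nat set" where
  "accessed (Const i k) X = {i}"
| "accessed (Add i j k) X = {i, j, k}"
| "accessed (Sub i j k) X = {i, j, k}"
| "accessed (Load i j) X = {i, j, X j}"
| "accessed (Store i j) X = {i, j, X i}"
| "accessed (Jump_pos i l) X = {i}"
| "accessed (Read i) X = {i}"
| "accessed (Print i) X = {i}"

definition halted :: "program \<Rightarrow> config \<Rightarrow> bool" where
  "halted P c \<longleftrightarrow> length P \<le> pc c"

definition step :: "program \<Rightarrow> config \<Rightarrow> config" where
  "step P c = (if halted P c then c else exec (P ! pc c) c)"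

definition config_at :: "program \<Rightarrow> nat list \<Rightarrow> nat \<Rightarrow> config" where
  "config_at P x t = (step P ^^ t) (initial x)"

definition halts_at :: "program \<Rightarrow> nat list \<Rightarrow> nat \<Rightarrow> bool" where
  "halts_at P x t \<longleftrightarrow>
     halted P (config_at P x t) \<and> (\<forall>i<t. \<not> halted P (config_at P x i))"

text \<open>
  A run of \<open>t\<close> steps uses at most \<open>s\<close> words if it only accesses the cells with addresses
  below \<open>s\<close>.  For this to be a meaningful measure, the numbers stored in cells have to
  fit into words, see \<open>words_bounded\<close>.
\<close>

definition space_bounded :: "program \<Rightarrow> nat list \<Rightarrow> nat \<Rightarrow> nat \<Rightarrow> bool" where
  "space_bounded P x t s \<longleftrightarrow>
     (\<forall>i<t. accessed (P ! pc (config_at P x i)) (mem (config_at P x i)) \<subseteq> {..<s})"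

definition words_bounded :: "program \<Rightarrow> nat list \<Rightarrow> nat \<Rightarrow> nat \<Rightarrow> bool" where
  "words_bounded P x t b \<longleftrightarrow> (\<forall>i\<le>t. \<forall>a. mem (config_at P x i) a \<le> b)"


section \<open>Input and output format\<close>

text \<open>
  The input is given by adjacency lists, for any numbering \<open>vs\<close> of the vertices by
  \<open>0, \<dots>, n - 1\<close> and any order of the neighbours.  On the tape, the number of vertices
  is followed by the adjacency lists, each preceded by its length.
\<close>

definition adjacency_lists :: "'a graph \<Rightarrow> 'a list \<Rightarrow> nat list list \<Rightarrow> bool" where
  "adjacency_lists G vs adj \<longleftrightarrow>
     distinct vs \<and> set vs = verts G \<and> length adj = length vs \<and>
     (\<forall>i<length vs. distinct (adj ! i) \<and>
        set (adj ! i) = {j. j < length vs \<and> {vs ! i, vs ! j} \<in> edges G})"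

definition input_tape :: "nat list list \<Rightarrow> nat list" where
  "input_tape adj = length adj # concat (map (\<lambda>js. length js # js) adj)"

text \<open>
  Each solution is printed as its symmetric difference from the previous one: the
  vertices with number \<open>i\<close> that enter or leave are printed once each, as \<open>i + 1\<close>, in
  any order, and the word 0 ends the solution.
\<close>

fun prints_differences :: "'a list \<Rightarrow> 'a set \<Rightarrow> 'a set list \<Rightarrow> nat list \<Rightarrow> bool" where
  "prints_differences vs prev [] out \<longleftrightarrow> out = []"
| "prints_differences vs prev (S # Ss) out \<longleftrightarrow>
     (\<exists>ds rest. out = map Suc ds @ 0 # rest \<and>
        distinct ds \<and> set ds \<subseteq> {..<length vs} \<and>
        (\<lambda>i. vs ! i) ` set ds = sym_diff prev S \<and>
        prints_differences vs S Ss rest)"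

end

theory Submission
  imports Defs
begin

text \<open>
  One iteration of the loop of EIS on a graph with \<open>a + 1\<close> vertices outputs one solution and continues
  with \<open>G - N[v]\<close>, with \<open>b\<close> vertices, and \<open>G - v\<close>, with \<open>a\<close> vertices.  If \<open>H\<close> has \<open>k\<close> vertices then \<open>G\<close> has
  no clique of size \<open>k\<close>, and since \<open>v\<close> has minimum degree this forces \<open>a \<le> k * (b + 1)\<close>.  Hence an
  iteration may cost \<open>O(a\<^sup>3)\<close>: with the potential \<open>a\<^sup>4\<close>, the \<open>b\<^sup>4\<close> paid in advance by the first
  continuation covers this cost and the difference \<open>(a + 1)\<^sup>4 - a\<^sup>4\<close> for all large \<open>a\<close>, up to a
  constant per output that depends on \<open>k\<close> only.

  It remains to run an iteration in time polynomial in the current number of vertices, within linear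
  space.  Every adjacency list is an array segment whose initial part holds the current neighbours;
  deleting \<open>v\<close> swaps it to the end of the initial part of the lists of its neighbours.  As
  deletions are undone in reverse order, undoing one only increments degrees.  The recursion stack is the
  current solution alone: the end of a call is recognised by there being no vertices left, and
  its deletions are undone up to the vertex on top of the solution.
\<close>

subsection \<open>Correctness of EIS\<close>

text \<open>Two costs are not controlled by the current number of vertices. Printing a difference
  takes time proportional to the part of the stack popped since the last output, even if few
  vertices remain. A second potential, 11 times the height of the last printed solution, pays for
  it: an output raises this height by at most one. Reading the input belongs to no iteration; it is
  covered by the \<open>n ^ 4\<close> that the outermost loop leaves unspent. EIS is a function of
  abstract graphs, whereas the swaps permute the lists of the machine. The choice among vertices of
  minimum degree must therefore depend on their numbers and not on their positions in a list. The
  order of deletions matters too: \<open>v\<close> is deleted before its neighbours. Its list then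
  stays fixed while the neighbours are deleted, and undoing only these deletions leaves exactly
  \<open>G - v\<close>, the graph of the next iteration.\<close>

lemma finite_simple_delete_verts:
  "finite_simple_graph G \<Longrightarrow> finite_simple_graph (delete_verts G U)"
  by (auto simp: finite_simple_graph_def simple_graph_def delete_verts_def)

lemma edge_neq: "simple_graph G \<Longrightarrow> {u, v} \<in> edges G \<Longrightarrow> u \<noteq> v"
  unfolding simple_graph_def by force

lemma independent_sets_step:
  assumes "finite_simple_graph G" "v \<in> verts G"
  shows "independent_sets G =
    insert v ` independent_sets (delete_verts G (closed_nbrs G v)) \<union>
    independent_sets (delete_verts G {v})" (is "?L = insert v ` ?A \<union> ?B")
proof (intro set_eqI iffI)
  fix T assume T: "T \<in> ?L"
  show "T \<in> insert v ` ?A \<union> ?B"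
  proof (cases "v \<in> T")
    case True
    have "T - {v} \<in> ?A"
      using T True by (auto simp: independent_sets_def delete_verts_def closed_nbrs_def nbrs_def)
    moreover have "T = insert v (T - {v})" using True by auto
    ultimately show ?thesis by blast
  next
    case False
    then show ?thesis using T by (auto simp: independent_sets_def delete_verts_def)
  qed
next
  fix T assume "T \<in> insert v ` ?A \<union> ?B"
  then show "T \<in> ?L"
  proof
    assume "T \<in> insert v ` ?A"
    then obtain T' where T': "T = insert v T'" "T' \<in> ?A" by auto
    have sub: "T' \<subseteq> verts G - closed_nbrs G v"
      using T' by (auto simp: independent_sets_def delete_verts_def)
    have "{x, y} \<notin> edges G" if "x \<in> T" "y \<in> T" for x y
    proof -
      have "simple_graph G" using assms by (simp add: finite_simple_graph_def)
      then have vv: "{v, v} \<notin> edges G" using edge_neq by metis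
      have xv: "{z, v} \<notin> edges G" if "z \<in> T'" for z
        using sub that by (auto simp: closed_nbrs_def nbrs_def)
      have "{x, y} \<notin> edges G" if "x \<in> T'" "y \<in> T'"
        using T'(2) sub that by (auto simp: independent_sets_def delete_verts_def)
      then show ?thesis
        using that T'(1) vv xv[of x] xv[of y] by (cases "x = v"; cases "y = v") (auto simp: doubleton_eq_iff insert_commute[of v y "{}"])
    qed
    then show ?thesis using sub T' assms by (auto simp: independent_sets_def)
  next
    assume T: "T \<in> ?B"
    then have "T \<subseteq> verts G - {v}" by (auto simp: independent_sets_def delete_verts_def)
    moreover have "{x, y} \<notin> edges G" if "x \<in> T" "y \<in> T" for x y
      using T that calculation by (auto simp: independent_sets_def delete_verts_def)
    ultimately show ?thesis by (auto simp: independent_sets_def)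
  qed
qed

lemma empty_independent [simp]: "{} \<in> independent_sets G"
  by (simp add: independent_sets_def)

lemma eis_loop_unfold:
  "eis_loop pick G S =
     (if verts G \<noteq> {} \<and> finite (verts G) \<and> pick G \<in> verts G
      then insert (pick G) S #
        eis_loop pick (delete_verts G (closed_nbrs G (pick G))) (insert (pick G) S)
           @ eis_loop pick (delete_verts G {pick G}) S
      else [])"
  by (subst eis_loop.simps) (simp add: rec_eis.simps)

text \<open>A call outputs \<open>S\<close> before its loop starts, so the loop is responsible for
  the proper extensions only; hence \<open>{}\<close> is taken out. No set is repeated because
  \<open>v\<close> lies in every output of the first continuation and in none of the second.\<close>

lemma eis_loop_correct:
  assumes "min_degree_rule pick" "finite_simple_graph G" "S \<inter> verts G = {}"
  shows "distinct (eis_loop pick G S) \<and>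
    set (eis_loop pick G S) = (\<lambda>T. S \<union> T) ` (independent_sets G - {{}})"
  using assms(2,3)
proof (induction "card (verts G)" arbitrary: G S rule: less_induct)
  case less
  have fin: "finite (verts G)" using less.prems by (simp add: finite_simple_graph_def)
  show ?case
  proof (cases "verts G = {}")
    case True
    then have "independent_sets G = {{}}" by (auto simp: independent_sets_def)
    then show ?thesis using True by (subst (1 2) eis_loop_unfold) simp
  next
    case False
    define v where "v = pick G"
    have v: "v \<in> verts G"
      using assms(1) less.prems False by (auto simp: min_degree_rule_def v_def)
    define A where "A = delete_verts G (closed_nbrs G v)"
    define B where "B = delete_verts G {v}"
    have eq: "eis_loop pick G S =
        insert v S # eis_loop pick A (insert v S) @ eis_loop pick B S"
      by (subst eis_loop_unfold) (use False fin v in \<open>simp add: v_def A_def B_def\<close>)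
    have vA: "verts A \<subseteq> verts G - {v}" and vB: "verts B = verts G - {v}"
      by (auto simp: A_def B_def delete_verts_def closed_nbrs_def)
    have less: "card (verts A) < card (verts G)" "card (verts B) < card (verts G)"
      using card_delete_verts_less[OF fin v] by (auto simp: A_def B_def closed_nbrs_def)
    have iA: "distinct (eis_loop pick A (insert v S))"
        "set (eis_loop pick A (insert v S)) = (\<lambda>T. insert v S \<union> T) ` (independent_sets A - {{}})"
      using less.hyps[of A "insert v S"] less less.prems vA v
        finite_simple_delete_verts[OF less.prems(1)] by (auto simp: A_def)
    have iB: "distinct (eis_loop pick B S)"
        "set (eis_loop pick B S) = (\<lambda>T. S \<union> T) ` (independent_sets B - {{}})"
      using less.hyps[of B S] less less.prems vB v
        finite_simple_delete_verts[OF less.prems(1)] by (auto simp: B_def)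
    have ind: "independent_sets G = insert v ` independent_sets A \<union> independent_sets B"
      unfolding A_def B_def by (rule independent_sets_step[OF less.prems(1) v])
    have B': "T \<subseteq> verts G - {v}" if "T \<in> independent_sets B" for T
      using that vB by (auto simp: independent_sets_def)
    have A': "T \<subseteq> verts G - {v}" if "T \<in> independent_sets A" for T
      using that vA by (auto simp: independent_sets_def)
    have vS: "v \<notin> S" using v less.prems by auto
    have nA: "insert v S \<notin> set (eis_loop pick A (insert v S))"
    proof
      assume "insert v S \<in> set (eis_loop pick A (insert v S))"
      then obtain T where "T \<in> independent_sets A" "T \<noteq> {}" "insert v S = insert v S \<union> T"
        unfolding iA by auto
      then show False using A'[of T] less.prems(2) by blast
    qed
    have nB: "v \<notin> X" if "X \<in> set (eis_loop pick B S)" for X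
      using that vS B' unfolding iB by auto
    have yA: "v \<in> X" if "X \<in> set (eis_loop pick A (insert v S))" for X
      using that unfolding iA by auto
    have "set (eis_loop pick G S) = (\<lambda>T. S \<union> T) ` (independent_sets G - {{}})"
    proof -
      have "independent_sets G - {{}} =
          insert v ` insert {} (independent_sets A - {{}}) \<union> (independent_sets B - {{}})"
        using ind empty_independent[of A] by auto
      then have "(\<lambda>T. S \<union> T) ` (independent_sets G - {{}}) =
          insert (insert v S) ((\<lambda>T. insert v S \<union> T) ` (independent_sets A - {{}}))
          \<union> (\<lambda>T. S \<union> T) ` (independent_sets B - {{}})"
        by (simp add: image_Un image_image del: insert_Diff_single)
      then show ?thesis using iA iB eq by simp
    qed
    moreover have "distinct (eis_loop pick G S)"
      using eq iA(1) iB(1) nA nB yA by auto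
    ultimately show ?thesis by blast
  qed
qed

lemma EIS_correct:
  assumes "min_degree_rule pick" "finite_simple_graph G"
  shows "distinct (EIS pick G)" "set (EIS pick G) = independent_sets G"
    "length (EIS pick G) = card (independent_sets G)"
proof -
  have *: "distinct (eis_loop pick G {})"
    "set (eis_loop pick G {}) = independent_sets G - {{}}"
    using eis_loop_correct[OF assms, of "{}"] by auto
  have e: "EIS pick G = {} # eis_loop pick G {}"
    by (simp add: EIS_def rec_eis.simps)
  show d: "distinct (EIS pick G)" using * unfolding e by simp
  have "insert {} (independent_sets G - {{}}) = independent_sets G"
    using empty_independent[of G] by (rule insert_Diff)
  then show "set (EIS pick G) = independent_sets G"
    using * unfolding e by simp
  then show "length (EIS pick G) = card (independent_sets G)"
    using distinct_card[OF d] by simp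
qed

subsection \<open>Graphs without large cliques\<close>

text \<open>The greedy argument behind Turan's bound: \<open>j\<close> vertices exclude at most \<open>j * r\<close> vertices
  from being adjacent to all of them.\<close>

lemma greedy_clique:
  fixes nb :: "'v \<Rightarrow> 'v set"
  assumes fin: "finite X" and sub: "\<And>x. x \<in> X \<Longrightarrow> card (X - nb x) \<le> r"
    and sym: "\<And>x y. x \<in> nb y \<Longrightarrow> y \<in> nb x" and irr: "\<And>x. x \<notin> nb x"
    and r: "j \<le> k" "k * r < card X + r"
  shows "\<exists>Q\<subseteq>X. card Q = j \<and> (\<forall>x\<in>Q. \<forall>y\<in>Q. x \<noteq> y \<longrightarrow> x \<in> nb y)"
  using r(1)
proof (induction j)
  case 0
  show ?case by (intro exI[of _ "{}"]) auto
next
  case (Suc j)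
  then obtain Q where Q: "Q \<subseteq> X" "card Q = j" "\<forall>x\<in>Q. \<forall>y\<in>Q. x \<noteq> y \<longrightarrow> x \<in> nb y" by auto
  have fQ: "finite Q" using Q fin finite_subset by blast
  have "card (\<Union>x\<in>Q. X - nb x) \<le> (\<Sum>x\<in>Q. card (X - nb x))"
    by (rule card_UN_le[OF fQ])
  also have "\<dots> \<le> (\<Sum>x\<in>Q. r)" by (rule sum_mono) (use Q sub in auto)
  also have "\<dots> = j * r" using Q by simp
  \<comment> \<open>\<open>k * r < card X + r\<close> expresses \<open>(k - 1) * r < card X\<close>,
    and \<open>j\<close> is at most \<open>k - 1\<close> here.\<close>
  also have "\<dots> < card X"
  proof -
    have "Suc j * r \<le> k * r" using Suc.prems by (intro mult_right_mono) auto
    then show ?thesis using r(2) by simp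
  qed
  finally have "\<not> X \<subseteq> (\<Union>x\<in>Q. X - nb x)"
    using card_mono[of "\<Union>x\<in>Q. X - nb x" X] fin fQ by auto
  then obtain y where y: "y \<in> X" "\<And>x. x \<in> Q \<Longrightarrow> y \<in> nb x" by blast
  then have "y \<notin> Q" using irr by blast
  then show ?case using Q y sym fQ
    by (intro exI[of _ "insert y Q"]) (auto simp: card_insert_if)
qed

text \<open>A clique contains every edge that a bijection can ask for, so any bijection onto it
  embeds \<open>H\<close>; the copy need not be induced.\<close>

lemma clique_has_subgraph:
  assumes H: "simple_graph H" "finite (verts H)"
    and Q: "Q \<subseteq> verts G" "finite Q" "card Q = card (verts H)"
      "\<And>x y. x \<in> Q \<Longrightarrow> y \<in> Q \<Longrightarrow> x \<noteq> y \<Longrightarrow> {x, y} \<in> edges G"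
  shows "has_subgraph G H"
proof -
  obtain f where f: "bij_betw f (verts H) Q"
    using finite_same_card_bij[OF H(2) Q(2)] Q(3) by auto
  define H' where "H' = \<lparr>verts = Q, edges = (\<lambda>e. f ` e) ` edges H\<rparr>"
  have "f ` e \<in> edges G" if "e \<in> edges H" for e
  proof -
    have "e \<subseteq> verts H" "card e = 2" using H(1) that by (auto simp: simple_graph_def)
    then obtain x y where xy: "e = {x, y}" "x \<noteq> y" "x \<in> verts H" "y \<in> verts H"
      by (auto simp: card_2_iff)
    then have "f x \<noteq> f y" "f x \<in> Q" "f y \<in> Q"
      using f by (auto simp: bij_betw_def inj_on_def)
    then show ?thesis using Q(4) xy by simp
  qed
  then have "subgraph H' G" using Q by (auto simp: subgraph_def H'_def)
  moreover have "isomorphic H H'" using f by (auto simp: isomorphic_def H'_def)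
  ultimately show ?thesis by (auto simp: has_subgraph_def)
qed

text \<open>If \<open>a > 2 * k\<close> then \<open>b \<ge> 1\<close>, hence
  \<open>a \<le> 2 * k * b\<close>: \<open>b ^ 4\<close> is at least a fixed fraction of
  \<open>a ^ 4\<close>, while the cost and the growth of the potential are cubic in
  \<open>a\<close>. The finitely many small \<open>a\<close> are absorbed by
  \<open>C\<close>.\<close>

lemma polynomial_recurrence_bound:
  fixes k K :: nat
  shows "\<exists>C. \<forall>a b. a \<le> k * (b + 1) \<longrightarrow>
    K * (a + 3) ^ 3 + (a + 1) ^ 4 \<le> C + b ^ 4 + a ^ 4"
proof -
  \<comment> \<open>\<open>64 * K\<close> comes from \<open>(a + 3) ^ 3 \<le> (4 * a) ^ 3\<close>,
    \<open>15 = 4 + 6 + 4 + 1\<close> from the lower coefficients of \<open>(a + 1) ^ 4\<close>, and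
    the first factor from \<open>a ^ 4 \<le> (2 * k * b) ^ 4\<close>. Writing \<open>k + 1\<close>
    for \<open>k\<close> makes it visibly positive, for cancellation.\<close>
  define M where "M = 16 * (k + 1) ^ 4 * (64 * K + 15)"
  define C where "C = K * (M + 2 * k + 3) ^ 3 + (M + 2 * k + 1) ^ 4"
  have "K * (a + 3) ^ 3 + (a + 1) ^ 4 \<le> C + b ^ 4 + a ^ 4" if ab: "a \<le> k * (b + 1)" for a b
  proof (cases "a \<le> M + 2 * k")
    case True
    have "K * (a + 3) ^ 3 + (a + 1) ^ 4 \<le> C" unfolding C_def
      using True by (intro add_mono mult_left_mono power_mono) auto
    then show ?thesis by simp
  next
    case False
    then have "0 < k" "1 \<le> a" using ab by (cases "k = 0"; simp)+
    have "2 * k \<le> a" using False by simp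
    have b1: "1 \<le> b"
      using ab False by (cases b) simp_all
    have "a \<le> k * (2 * b)"
      using ab by (rule order_trans) (use b1 in simp)
    then have "a ^ 4 \<le> (k * (2 * b)) ^ 4" by (rule power_mono) simp
    also have "\<dots> = 16 * k ^ 4 * b ^ 4" by (simp add: power_mult_distrib)
    also have "\<dots> \<le> 16 * (k + 1) ^ 4 * b ^ 4" by (intro mult_mono power_mono) auto
    finally have 1: "a ^ 4 \<le> 16 * (k + 1) ^ 4 * b ^ 4" .
    have "M * a ^ 3 \<le> a * a ^ 3" using False by (intro mult_right_mono) auto
    also have "a * a ^ 3 = a ^ 4" by (simp flip: power_Suc)
    finally have "(16 * (k + 1) ^ 4) * ((64 * K + 15) * a ^ 3) \<le> (16 * (k + 1) ^ 4) * b ^ 4"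
      using 1 unfolding M_def mult.assoc by (rule order_trans)
    moreover have "0 < 16 * (k + 1) ^ 4" by simp
    ultimately have 2: "(64 * K + 15) * a ^ 3 \<le> b ^ 4"
      by (meson mult_le_cancel1)
    have "(a + 3) ^ 3 \<le> (4 * a) ^ 3" using \<open>1 \<le> a\<close> by (intro power_mono) auto
    then have "K * (a + 3) ^ 3 \<le> K * (64 * a ^ 3)"
      by (intro mult_left_mono) (simp_all add: power_mult_distrib)
    then have 3: "K * (a + 3) ^ 3 \<le> 64 * K * a ^ 3" by simp
    have 4: "(a + 1) ^ 4 \<le> a ^ 4 + 15 * a ^ 3"
    proof -
      have "1 \<le> a ^ 3" "a \<le> a ^ 3" "a ^ 2 \<le> a ^ 3"
        using \<open>1 \<le> a\<close> by (simp_all add: power_increasing self_le_power)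
      moreover have "(a + 1) ^ 4 = a ^ 4 + 4 * a ^ 3 + 6 * a ^ 2 + 4 * a + 1"
        by (simp add: algebra_simps power_numeral_reduce)
      ultimately show ?thesis by linarith
    qed
    have "64 * K * a ^ 3 + 15 * a ^ 3 \<le> b ^ 4"
      using 2 by (simp add: distrib_right)
    then show ?thesis using 3 4 by linarith
  qed
  then show ?thesis by blast
qed

subsection \<open>A structured language with arrays\<close>

datatype com =
    SKIP
  | IMM nat nat
  | ADD nat nat nat
  | SUB nat nat nat
  | GET nat nat nat
  | PUT nat nat nat
  | READ nat
  | PRINT nat
  | SEQ com com (infixr \<open>;;\<close> 60)
  | IF nat com com
  | WHILE nat com

text \<open>\<open>GET r k i\<close> reads array \<open>k\<close> at the index held in register \<open>i\<close>, and \<open>PUT k i r\<close> writes it;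
  \<open>ticks\<close> is a ghost clock.\<close>

record state =
  reg :: "nat \<Rightarrow> nat"
  arr :: "nat \<Rightarrow> nat \<Rightarrow> nat"
  inp :: "nat list"
  outp :: "nat list"
  ticks :: nat

abbreviation tick :: "state \<Rightarrow> state" where
  "tick s \<equiv> s\<lparr>ticks := Suc (ticks s)\<rparr>"

abbreviation set_reg :: "nat \<Rightarrow> nat \<Rightarrow> state \<Rightarrow> state" where
  "set_reg r x s \<equiv> tick (s\<lparr>reg := (reg s)(r := x)\<rparr>)"

abbreviation set_arr :: "nat \<Rightarrow> nat \<Rightarrow> nat \<Rightarrow> state \<Rightarrow> state" where
  "set_arr k i x s \<equiv> tick (s\<lparr>arr := (arr s)(k := (arr s k)(i := x))\<rparr>)"

text \<open>\<open>N\<close> limits array indices; \<open>B\<close> limits constants, sums and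
  inputs, the only sources of larger values. A derivation thus carries the space and word bounds
  with it. \<open>SKIP\<close> and sequencing are free, every test takes one tick.\<close>

inductive big :: "nat \<Rightarrow> nat \<Rightarrow> com \<Rightarrow> state \<Rightarrow> state \<Rightarrow> bool" for N B where
  "big N B SKIP s s"
| "k \<le> B \<Longrightarrow> big N B (IMM r k) s (set_reg r k s)"
| "reg s i + reg s j \<le> B \<Longrightarrow>
    big N B (ADD r i j) s (set_reg r (reg s i + reg s j) s)"
| "big N B (SUB r i j) s (set_reg r (reg s i - reg s j) s)"
| "reg s i < N \<Longrightarrow> big N B (GET r k i) s (set_reg r (arr s k (reg s i)) s)"
| "reg s i < N \<Longrightarrow> big N B (PUT k i r) s
    (set_arr k (reg s i) (reg s r) s)"
| "inp s = x # xs \<Longrightarrow> x \<le> B \<Longrightarrow>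
    big N B (READ r) s (set_reg r x (s\<lparr>inp := xs\<rparr>))"
| "big N B (PRINT r) s (tick (s\<lparr>outp := outp s @ [reg s r]\<rparr>))"
| "big N B c1 s s' \<Longrightarrow> big N B c2 s' s'' \<Longrightarrow> big N B (c1 ;; c2) s s''"
| "reg s r > 0 \<Longrightarrow> big N B c1 (tick s) s' \<Longrightarrow> big N B (IF r c1 c2) s s'"
| "reg s r = 0 \<Longrightarrow> big N B c2 (tick s) s' \<Longrightarrow> big N B (IF r c1 c2) s s'"
| "reg s r > 0 \<Longrightarrow> big N B c (tick s) s' \<Longrightarrow> big N B (WHILE r c) s' s'' \<Longrightarrow>
    big N B (WHILE r c) s s''"
| "reg s r = 0 \<Longrightarrow> big N B (WHILE r c) s (tick s)"

text \<open>Asserting a terminating run makes this total correctness, and the ghost clock lets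
  \<open>Q\<close> speak about the running time.\<close>

definition wp :: "nat \<Rightarrow> nat \<Rightarrow> com \<Rightarrow> (state \<Rightarrow> bool) \<Rightarrow> state \<Rightarrow> bool" where
  "wp N B c Q s \<longleftrightarrow> (\<exists>s'. big N B c s s' \<and> Q s')"

inductive_cases big_cases:
  "big N B SKIP s s'" "big N B (IMM r k) s s'" "big N B (ADD r i j) s s'"
  "big N B (SUB r i j) s s'" "big N B (GET r k i) s s'" "big N B (PUT k i r) s s'"
  "big N B (READ r) s s'" "big N B (PRINT r) s s'" "big N B (c1 ;; c2) s s'"
  "big N B (IF r c1 c2) s s'"

inductive_cases big_WHILE: "big N B (WHILE r c) s s'"

lemma wp_simps:
  "wp N B SKIP Q s = Q s"
  "wp N B (IMM r k) Q s = (k \<le> B \<and> Q (set_reg r k s))"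
  "wp N B (ADD r i j) Q s = (reg s i + reg s j \<le> B \<and>
     Q (set_reg r (reg s i + reg s j) s))"
  "wp N B (SUB r i j) Q s = Q (set_reg r (reg s i - reg s j) s)"
  "wp N B (GET r k i) Q s = (reg s i < N \<and>
     Q (set_reg r (arr s k (reg s i)) s))"
  "wp N B (PUT k i r) Q s = (reg s i < N \<and>
     Q (set_arr k (reg s i) (reg s r) s))"
  "wp N B (READ r) Q s = (\<exists>x xs. inp s = x # xs \<and> x \<le> B \<and>
     Q (set_reg r x (s\<lparr>inp := xs\<rparr>)))"
  "wp N B (PRINT r) Q s = Q (tick (s\<lparr>outp := outp s @ [reg s r]\<rparr>))"
  "wp N B (c1 ;; c2) Q s = wp N B c1 (wp N B c2 Q) s"
  "wp N B (IF r c1 c2) Q s =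
     (if reg s r > 0 then wp N B c1 Q (tick s) else wp N B c2 Q (tick s))"
          apply (unfold wp_def)
          apply (fastforce intro: big.intros elim: big_cases)+
  apply (cases "reg s r > 0")
   apply (auto intro: big.intros elim: big_cases(10))
  done

lemma wp_WHILE:
  "wp N B (WHILE r c) Q s =
     (if reg s r > 0 then wp N B c (wp N B (WHILE r c) Q) (tick s) else Q (tick s))"
proof (cases "reg s r > 0")
  case True
  then have "big N B (WHILE r c) s s'' \<longleftrightarrow>
      (\<exists>s'. big N B c (tick s) s' \<and> big N B (WHILE r c) s' s'')" for s''
    by (auto intro: big.intros(12) elim: big_WHILE)
  then show ?thesis using True by (auto simp: wp_def)
next
  case False
  then have "big N B (WHILE r c) s s'' \<longleftrightarrow> s'' = tick s" for s''
    by (auto intro: big.intros(13) elim: big_WHILE)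
  then show ?thesis using False by (simp add: wp_def)
qed

lemma wp_mono: "wp N B c Q s \<Longrightarrow> (\<And>s'. Q s' \<Longrightarrow> Q' s') \<Longrightarrow> wp N B c Q' s"
  unfolding wp_def by blast

text \<open>The index \<open>m\<close> is the variant: every loop treated by this rule counts down
  by one, and its time bound is a part of the invariant.\<close>

lemma wp_while_inv:
  fixes I :: "nat \<Rightarrow> state \<Rightarrow> bool"
  assumes "I m s"
    and "\<And>m s. I m s \<Longrightarrow> reg s r > 0 \<Longrightarrow>
      m > 0 \<and> wp N B c (I (m - 1)) (tick s)"
    and "\<And>m s. I m s \<Longrightarrow> reg s r = 0 \<Longrightarrow> Q (tick s)"
  shows "wp N B (WHILE r c) Q s"
  using assms(1)
proof (induction m arbitrary: s rule: less_induct)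
  case (less m)
  show ?case
  proof (cases "reg s r > 0")
    case True
    then have "m > 0" "wp N B c (I (m - 1)) (tick s)" using assms(2) less.prems by auto
    then have "wp N B c (wp N B (WHILE r c) Q) (tick s)"
      using less.IH[of "m - 1"] by (auto elim: wp_mono)
    then show ?thesis using True by (subst wp_WHILE) simp
  next
    case False
    then show ?thesis using assms(3) less.prems by (subst wp_WHILE) simp
  qed
qed

subsection \<open>Compilation\<close>

text \<open>Cells 0 and 1 are scratch, register \<open>r < 30\<close> lives in cell \<open>r + 2\<close>, and the eight arrays are
  interleaved above: entry \<open>i\<close> of array \<open>k\<close> is in cell \<open>8 * i + (32 + k)\<close>.  The argument \<open>p\<close> is the
  position of the code, as jumps are absolute.\<close>

fun address :: "nat \<Rightarrow> nat \<Rightarrow> instr list" where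
  "address k i = [Add 0 (i + 2) (i + 2), Add 0 0 0, Add 0 0 0, Const 1 (32 + k), Add 0 0 1]"

text \<open>Jumps of the machine are conditional; \<open>Const 0 1\<close> and a jump on the scratch
  cell 0 form an unconditional one. The second branch of an \<open>IF\<close> is placed first, right
  behind the failing test.\<close>

fun compile :: "nat \<Rightarrow> com \<Rightarrow> instr list" where
  "compile p SKIP = []"
| "compile p (IMM r k) = [Const (r + 2) k]"
| "compile p (ADD r i j) = [Add (r + 2) (i + 2) (j + 2)]"
| "compile p (SUB r i j) = [Sub (r + 2) (i + 2) (j + 2)]"
| "compile p (GET r k i) = address k i @ [Load (r + 2) 0]"
| "compile p (PUT k i r) = address k i @ [Store 0 (r + 2)]"
| "compile p (READ r) = [Read (r + 2)]"
| "compile p (PRINT r) = [Print (r + 2)]"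
| "compile p (c1 ;; c2) = compile p c1 @ compile (p + length (compile p c1)) c2"
| "compile p (IF r c1 c2) =
    (let C2 = compile (p + 1) c2; C1 = compile (p + length C2 + 3) c1 in
     Jump_pos (r + 2) (p + length C2 + 3) # C2 @
     [Const 0 1, Jump_pos 0 (p + length C2 + 3 + length C1)] @ C1)"
| "compile p (WHILE r c) =
    (let C = compile (p + 3) c in
     [Jump_pos (r + 2) (p + 3), Const 0 1, Jump_pos 0 (p + 5 + length C)] @ C @
     [Const 0 1, Jump_pos 0 p])"

fun wf_com :: "com \<Rightarrow> bool" where
  "wf_com SKIP = True"
| "wf_com (IMM r k) = (r < 30)"
| "wf_com (ADD r i j) = (r < 30 \<and> i < 30 \<and> j < 30)"
| "wf_com (SUB r i j) = (r < 30 \<and> i < 30 \<and> j < 30)"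
| "wf_com (GET r k i) = (r < 30 \<and> k < 8 \<and> i < 30)"
| "wf_com (PUT k i r) = (r < 30 \<and> k < 8 \<and> i < 30)"
| "wf_com (READ r) = (r < 30)"
| "wf_com (PRINT r) = (r < 30)"
| "wf_com (c1 ;; c2) = (wf_com c1 \<and> wf_com c2)"
| "wf_com (IF r c1 c2) = (r < 30 \<and> wf_com c1 \<and> wf_com c2)"
| "wf_com (WHILE r c) = (r < 30 \<and> wf_com c)"

definition represents :: "config \<Rightarrow> state \<Rightarrow> bool" where
  "represents cf s \<longleftrightarrow> (\<forall>r<30. mem cf (r + 2) = reg s r) \<and>
     (\<forall>k<8. \<forall>i. mem cf (8 * i + (32 + k)) = arr s k i) \<and>
     tape cf = inp s \<and> printed cf = outp s"

text \<open>One relation for everything that the final claim asks of a run: number of steps, no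
  earlier halt, accessed cells and word size. It composes by \<open>reach_trans\<close>, and
  \<open>reach_config\<close> turns it back into iterates of \<open>step\<close>.\<close>

inductive reach :: "program \<Rightarrow> nat \<Rightarrow> nat \<Rightarrow> config \<Rightarrow> nat \<Rightarrow> config \<Rightarrow> bool" for P S W where
  refl: "(\<forall>a. mem c a \<le> W) \<Longrightarrow> reach P S W c 0 c"
| step: "(\<forall>a. mem c a \<le> W) \<Longrightarrow> pc c < length P \<Longrightarrow> accessed (P ! pc c) (mem c) \<subseteq> {..<S} \<Longrightarrow>
    reach P S W (exec (P ! pc c) c) t c' \<Longrightarrow> reach P S W c (Suc t) c'"

lemma reach_trans: "reach P S W c t c' \<Longrightarrow> reach P S W c' t' c'' \<Longrightarrow> reach P S W c (t + t') c''"
  by (induction rule: reach.induct) (auto intro: reach.intros)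

lemma reach_config:
  "reach P S W c t c' \<Longrightarrow> (step P ^^ t) c = c' \<and>
    (\<forall>i<t. pc ((step P ^^ i) c) < length P \<and>
      accessed (P ! pc ((step P ^^ i) c)) (mem ((step P ^^ i) c)) \<subseteq> {..<S}) \<and>
    (\<forall>i\<le>t. \<forall>a. mem ((step P ^^ i) c) a \<le> W)"
proof (induction rule: reach.induct)
  case (refl c)
  then show ?case by simp
next
  case (step c t c')
  then have s: "Defs.step P c = exec (P ! pc c) c"
    by (simp add: Defs.step_def halted_def)
  have *: "(Defs.step P ^^ Suc i) c = (Defs.step P ^^ i) (exec (P ! pc c) c)" for i
    using s by (simp add: funpow_swap1)
  show ?case
  proof (intro conjI allI impI)
    show "(Defs.step P ^^ Suc t) c = c'" using * step.IH by simp
  next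
    fix i assume "i < Suc t"
    then show "pc ((Defs.step P ^^ i) c) < length P"
      using step.hyps step.IH * by (cases i) auto
  next
    fix i assume "i < Suc t"
    then show "accessed (P ! pc ((Defs.step P ^^ i) c)) (mem ((Defs.step P ^^ i) c)) \<subseteq> {..<S}"
      using step.hyps step.IH * by (cases i) auto
  next
    fix i a assume "i \<le> Suc t"
    then show "mem ((Defs.step P ^^ i) c) a \<le> W"
      using step.hyps step.IH * by (cases i) auto
  qed
qed

lemma reach_mem: "reach P S W c t c' \<Longrightarrow> mem c' a \<le> W"
  by (induction rule: reach.induct) auto

lemma reach_one:
  assumes "P = pre @ I # post" "pc c = length pre" "\<forall>a. mem c a \<le> W"
    "accessed I (mem c) \<subseteq> {..<S}" "\<forall>a. mem (exec I c) a \<le> W"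
  shows "reach P S W c (Suc 0) (exec I c)"
  by (rule reach.step) (use assms in \<open>auto intro: reach.refl\<close>)

text \<open>Three doublings replace the multiplication by 8. An index below \<open>N\<close> yields
  an address of at most \<open>8 * (N - 1) + 39\<close>, which is below \<open>32 + 8 * N\<close>;
  the space bound of the program originates here.\<close>

lemma reach_address:
  assumes P: "P = pre @ address k i @ post" and pc: "pc c = length pre"
    and W: "\<forall>a. mem c a \<le> W" and x: "mem c (i + 2) < N" and k: "k < 8" and i: "i < 30"
    and bnd: "40 + 8 * N \<le> W" "32 + 8 * N \<le> S"
  shows "\<exists>c'. reach P S W c 5 c' \<and> pc c' = length pre + 5 \<and>
    mem c' 0 = 8 * mem c (i + 2) + (32 + k) \<and> (\<forall>a\<ge>2. mem c' a = mem c a) \<and>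
    tape c' = tape c \<and> printed c' = printed c"
proof -
  let ?x = "mem c (i + 2)"
  define c' where "c' = c\<lparr>pc := length pre + 5,
    mem := (mem c)(0 := 8 * ?x + (32 + k), 1 := 32 + k)\<rparr>"
  have nth: "P ! length pre = Add 0 (i + 2) (i + 2)" "P ! Suc (length pre) = Add 0 0 0"
    "P ! Suc (Suc (length pre)) = Add 0 0 0" "P ! Suc (Suc (Suc (length pre))) = Const 1 (32 + k)"
    "P ! Suc (Suc (Suc (Suc (length pre)))) = Add 0 0 1"
    by (simp_all add: P nth_append)
  have len: "length pre + 5 \<le> length P" by (simp add: P)
  have "reach P S W c (Suc (Suc (Suc (Suc (Suc 0))))) c'"
    apply (rule reach.step)
       apply (use W in simp)
      apply (use len pc in simp)
     apply (use bnd i in \<open>simp add: pc nth\<close>)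
    apply (rule reach.step)
       apply (use W x bnd in \<open>simp add: pc nth\<close>)
      apply (use len in \<open>simp add: pc nth\<close>)
     apply (use bnd in \<open>simp add: pc nth\<close>)
    apply (rule reach.step)
       apply (use W x bnd in \<open>simp add: pc nth\<close>)
      apply (use len in \<open>simp add: pc nth\<close>)
     apply (use bnd in \<open>simp add: pc nth\<close>)
    apply (rule reach.step)
       apply (use W x bnd in \<open>simp add: pc nth\<close>)
      apply (use len in \<open>simp add: pc nth\<close>)
     apply (use bnd in \<open>simp add: pc nth\<close>)
    apply (rule reach.step)
       apply (use W x bnd k in \<open>simp add: pc nth\<close>)
      apply (use len in \<open>simp add: pc nth\<close>)
     apply (use bnd in \<open>simp add: pc nth\<close>)
    apply (simp add: pc nth)
    apply (subgoal_tac "c' = c\<lparr>pc := Suc (Suc (Suc (Suc (Suc (length pre))))),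
          mem := (mem c)(0 := ?x + ?x + (?x + ?x) + (?x + ?x + (?x + ?x)) + (32 + k), Suc 0 := 32 + k)\<rparr>")
    subgoal
      using reach.refl[of c' W P S] W x bnd k by (simp add: fun_upd_twist)
    subgoal
      by (simp add: c'_def)
    done
  then have "reach P S W c 5 c'" by (simp add: eval_nat_numeral)
  then show ?thesis by (intro exI[of _ c']) (simp add: c'_def)
qed

text \<open>The residue modulo 8 is the number of the array, so writing to one array leaves the
  others alone.\<close>

lemma cell_inj:
  fixes j :: nat
  shows "k < 8 \<Longrightarrow> l < 8 \<Longrightarrow> 8 * j + (32 + l) = 8 * i + (32 + k) \<longleftrightarrow> j = i \<and> l = k"
  by presburger

text \<open>Arbitrary code before and after makes the claim applicable inside larger programs
  despite absolute jumps. The factor 6 is the cost of an array access, five instructions for the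
  address and one for the access itself; a test with the jumps around its branch or loop body takes
  at most three.\<close>

lemma compile_correct:
  assumes "big N B c s s'" and "wf_com c" and "P = pre @ compile (length pre) c @ post"
    and "represents cf s" and "pc cf = length pre" and "\<forall>a. mem cf a \<le> W"
    and "40 + 8 * N \<le> W" "32 + 8 * N \<le> S" "B \<le> W" "1 \<le> W"
  shows "\<exists>t cf'. reach P S W cf t cf' \<and> represents cf' s' \<and>
    pc cf' = length pre + length (compile (length pre) c) \<and> t + 6 * ticks s \<le> 6 * ticks s'"
  using assms(1-6)
proof (induction arbitrary: pre post cf rule: big.induct)
  case (1 s)
  then show ?case by (auto intro!: exI[of _ 0] exI[of _ cf] reach.refl)
next
  case (2 k r s)
  let ?I = "Const (r + 2) k"
  have "reach P S W cf (Suc 0) (exec ?I cf)"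
    by (rule reach_one) (use 2 assms in auto)
  moreover have "represents (exec ?I cf) (set_reg r k s)"
    using 2 by (auto simp: represents_def)
  ultimately show ?case using 2 by (intro exI[of _ "Suc 0"] exI[of _ "exec ?I cf"]) auto
next
  case (3 s i j r)
  let ?I = "Add (r + 2) (i + 2) (j + 2)"
  have *: "mem cf (i + 2) + mem cf (j + 2) = reg s i + reg s j"
    using 3 by (auto simp: represents_def)
  have "reach P S W cf (Suc 0) (exec ?I cf)"
    by (rule reach_one) (use 3 assms * in auto)
  moreover have "represents (exec ?I cf)
      (set_reg r (reg s i + reg s j) s)"
    using 3 * by (auto simp: represents_def)
  ultimately show ?case using 3 by (intro exI[of _ "Suc 0"] exI[of _ "exec ?I cf"]) auto
next
  case (4 r i j s)
  let ?I = "Sub (r + 2) (i + 2) (j + 2)"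
  have *: "mem cf (i + 2) - mem cf (j + 2) = reg s i - reg s j"
    using 4 by (auto simp: represents_def)
  have W: "mem cf (i + 2) - mem cf (j + 2) \<le> W" using 4 by (meson diff_le_self le_trans)
  have "reach P S W cf (Suc 0) (exec ?I cf)"
    by (rule reach_one) (use 4 assms * W in auto)
  moreover have "represents (exec ?I cf)
      (set_reg r (reg s i - reg s j) s)"
    using 4 * by (auto simp: represents_def)
  ultimately show ?case using 4 by (intro exI[of _ "Suc 0"] exI[of _ "exec ?I cf"]) auto
next
  case (5 s i r k)
  have x: "mem cf (i + 2) = reg s i" using 5 by (auto simp: represents_def)
  obtain c1 where c1: "reach P S W cf 5 c1" "pc c1 = length pre + 5"
    "mem c1 0 = 8 * mem cf (i + 2) + (32 + k)" "\<forall>a\<ge>2. mem c1 a = mem cf a"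
    "tape c1 = tape cf" "printed c1 = printed cf"
    using reach_address[of P pre k i "Load (r + 2) 0 # post" cf W N S] 5 assms x by auto
  let ?I = "Load (r + 2) 0"
  have m1: "mem c1 (8 * reg s i + (32 + k)) = arr s k (reg s i)"
    using c1(4) 5 by (auto simp: represents_def)
  have m2: "arr s k (reg s i) \<le> W" using m1 reach_mem[OF c1(1)] by metis
  have "reach P S W c1 (Suc 0) (exec ?I c1)"
    by (rule reach_one[of _ "pre @ address k i" _ post])
      (use 5 assms c1 x m1 m2 reach_mem[OF c1(1)] in auto)
  from reach_trans[OF c1(1) this] have "reach P S W cf 6 (exec ?I c1)" by simp
  moreover have "represents (exec ?I c1) (set_reg r (arr s k (reg s i)) s)"
    using 5 c1 x m1 by (auto simp: represents_def)
  ultimately show ?case using 5 c1 by (intro exI[of _ 6] exI[of _ "exec ?I c1"]) auto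
next
  case (6 s i k r)
  have x: "mem cf (i + 2) = reg s i" using 6 by (auto simp: represents_def)
  obtain c1 where c1: "reach P S W cf 5 c1" "pc c1 = length pre + 5"
    "mem c1 0 = 8 * mem cf (i + 2) + (32 + k)" "\<forall>a\<ge>2. mem c1 a = mem cf a"
    "tape c1 = tape cf" "printed c1 = printed cf"
    using reach_address[of P pre k i "Store 0 (r + 2) # post" cf W N S] 6 assms x by auto
  let ?I = "Store 0 (r + 2)"
  have "reach P S W c1 (Suc 0) (exec ?I c1)"
    by (rule reach_one[of _ "pre @ address k i" _ post])
      (use 6 assms c1 x reach_mem[OF c1(1)] in auto)
  from reach_trans[OF c1(1) this] have "reach P S W cf 6 (exec ?I c1)" by simp
  moreover have "represents (exec ?I c1)
      (set_arr k (reg s i) (reg s r) s)"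
  proof -
    have inj: "8 * j + (32 + l) = 8 * reg s i + (32 + k) \<longleftrightarrow> j = reg s i \<and> l = k"
      if "l < 8" for j l :: nat
      using that \<open>wf_com (PUT k i r)\<close> by (intro cell_inj) auto
    have "mem c1 (r + 2) = reg s r" using c1(4) 6 by (auto simp: represents_def)
    then show ?thesis using 6 c1 x inj by (auto simp: represents_def)
  qed
  ultimately show ?case using 6 c1 by (intro exI[of _ 6] exI[of _ "exec ?I c1"]) auto
next
  case (7 s x xs r)
  let ?I = "Read (r + 2)"
  have tp: "tape cf = x # xs" using 7 by (simp add: represents_def)
  have "reach P S W cf (Suc 0) (exec ?I cf)"
    by (rule reach_one) (use 7 assms tp in auto)
  moreover have "represents (exec ?I cf) (set_reg r x (s\<lparr>inp := xs\<rparr>))"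
    using 7 tp by (auto simp: represents_def)
  ultimately show ?case using 7 by (intro exI[of _ "Suc 0"] exI[of _ "exec ?I cf"]) auto
next
  case (8 r s)
  let ?I = "Print (r + 2)"
  have "reach P S W cf (Suc 0) (exec ?I cf)"
    by (rule reach_one) (use 8 assms in auto)
  moreover have "represents (exec ?I cf) (tick (s\<lparr>outp := outp s @ [reg s r]\<rparr>))"
    using 8 by (auto simp: represents_def)
  ultimately show ?case using 8 by (intro exI[of _ "Suc 0"] exI[of _ "exec ?I cf"]) auto
next
  case (9 c1 s s' c2 s'')
  let ?C1 = "compile (length pre) c1"
  obtain t1 cf1 where 1: "reach P S W cf t1 cf1" "represents cf1 s'"
    "pc cf1 = length pre + length ?C1" "t1 + 6 * ticks s \<le> 6 * ticks s'"
    using "9.IH"(1)[of pre "compile (length pre + length ?C1) c2 @ post" cf] "9.prems" by auto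
  obtain t2 cf2 where 2: "reach P S W cf1 t2 cf2" "represents cf2 s''"
    "pc cf2 = length pre + length ?C1 + length (compile (length pre + length ?C1) c2)"
    "t2 + 6 * ticks s' \<le> 6 * ticks s''"
    using "9.IH"(2)[of "pre @ ?C1" post cf1] "9.prems" 1 reach_mem[OF 1(1)] by auto
  show ?case using reach_trans[OF 1(1) 2(1)] 1 2
    by (intro exI[of _ "t1 + t2"] exI[of _ cf2]) auto
next
  case (10 s r c1 s' c2)
  let ?C2 = "compile (length pre + 1) c2"
  let ?C1 = "compile (length pre + length ?C2 + 3) c1"
  let ?J = "Jump_pos (r + 2) (length pre + length ?C2 + 3)"
  let ?mid = "[Const 0 1, Jump_pos 0 (length pre + length ?C2 + 3 + length ?C1)]"
  have P: "P = pre @ ?J # (?C2 @ ?mid @ ?C1 @ post)"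
    using "10.prems" by (simp add: Let_def)
  have r: "mem cf (r + 2) > 0" using 10 by (auto simp: represents_def)
  have 0: "reach P S W cf (Suc 0) (exec ?J cf)"
    by (rule reach_one[OF P]) (use 10 assms in auto)
  have "represents (exec ?J cf) (tick s)" using "10.prems" by (auto simp: represents_def)
  moreover let ?pre = "pre @ ?J # ?C2 @ ?mid"
  have l: "length ?pre = length pre + length ?C2 + 3" by simp
  have "P = ?pre @ compile (length ?pre) c1 @ post" unfolding l using P by simp
  moreover have "pc (exec ?J cf) = length ?pre" using r by simp
  ultimately obtain t cf' where 1: "reach P S W (exec ?J cf) t cf'" "represents cf' s'"
    "pc cf' = length ?pre + length (compile (length ?pre) c1)"
    "t + 6 * ticks (tick s) \<le> 6 * ticks s'"
    using "10.IH"[of ?pre post "exec ?J cf"] "10.prems"(1) reach_mem[OF 0] by fastforce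
  have 1: "reach P S W (exec ?J cf) t cf'" "represents cf' s'"
    "pc cf' = length pre + length ?C2 + 3 + length ?C1"
    "t + 6 * ticks (tick s) \<le> 6 * ticks s'"
    using 1 unfolding l by simp_all
  show ?case using reach_trans[OF 0 1(1)] 1
    by (intro exI[of _ "Suc 0 + t"] exI[of _ cf']) (auto simp: Let_def)
next
  case (11 s r c2 s' c1)
  let ?C2 = "compile (length pre + 1) c2"
  let ?C1 = "compile (length pre + length ?C2 + 3) c1"
  let ?J = "Jump_pos (r + 2) (length pre + length ?C2 + 3)"
  let ?J' = "Jump_pos 0 (length pre + length ?C2 + 3 + length ?C1)"
  have P: "P = pre @ ?J # (?C2 @ [Const 0 1, ?J'] @ ?C1 @ post)"
    using "11.prems" by (simp add: Let_def)
  have r: "mem cf (r + 2) = 0" using 11 by (auto simp: represents_def)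
  have 0: "reach P S W cf (Suc 0) (exec ?J cf)"
    by (rule reach_one[OF P]) (use 11 assms in auto)
  have "represents (exec ?J cf) (tick s)" using "11.prems" by (auto simp: represents_def)
  moreover let ?pre = "pre @ [?J]"
  have l: "length ?pre = length pre + 1" by simp
  have "P = ?pre @ compile (length ?pre) c2 @ ([Const 0 1, ?J'] @ ?C1 @ post)"
    unfolding l using P by simp
  moreover have "pc (exec ?J cf) = length ?pre" using r "11.prems" by simp
  ultimately obtain t cf' where 1: "reach P S W (exec ?J cf) t cf'" "represents cf' s'"
    "pc cf' = length ?pre + length (compile (length ?pre) c2)"
    "t + 6 * ticks (tick s) \<le> 6 * ticks s'"
    using "11.IH"[of ?pre _ "exec ?J cf"] "11.prems"(1) reach_mem[OF 0] by fastforce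
  have 1: "reach P S W (exec ?J cf) t cf'" "represents cf' s'"
    "pc cf' = length pre + 1 + length ?C2"
    "t + 6 * ticks (tick s) \<le> 6 * ticks s'"
    using 1 unfolding l by simp_all
  have 2: "reach P S W cf' (Suc 0) (exec (Const 0 1) cf')"
    by (rule reach_one[of _ "pre @ ?J # ?C2" _ "?J' # ?C1 @ post"])
      (use P 1 assms reach_mem[OF 1(1)] in auto)
  have 3: "reach P S W (exec (Const 0 1) cf') (Suc 0) (exec ?J' (exec (Const 0 1) cf'))"
    by (rule reach_one[of _ "pre @ ?J # ?C2 @ [Const 0 1]" _ "?C1 @ post"])
      (use P 1 assms reach_mem[OF 2] in auto)
  have "represents (exec ?J' (exec (Const 0 1) cf')) s'"
    using 1 by (auto simp: represents_def)
  then show ?case using reach_trans[OF reach_trans[OF reach_trans[OF 0 1(1)] 2] 3] 1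
    by (intro exI[of _ "Suc 0 + t + Suc 0 + Suc 0"] exI[of _ "exec ?J' (exec (Const 0 1) cf')"])
      (auto simp: Let_def)
next
  case (12 s r c s' s'')
  let ?C = "compile (length pre + 3) c"
  let ?J = "Jump_pos (r + 2) (length pre + 3)"
  let ?J' = "Jump_pos 0 (length pre + 5 + length ?C)"
  let ?J'' = "Jump_pos 0 (length pre)"
  have P: "P = pre @ ?J # ([Const 0 1, ?J'] @ ?C @ [Const 0 1, ?J''] @ post)"
    using "12.prems" by (simp add: Let_def)
  have r: "mem cf (r + 2) > 0" using 12 by (auto simp: represents_def)
  have 0: "reach P S W cf (Suc 0) (exec ?J cf)"
    by (rule reach_one[OF P]) (use 12 assms in auto)
  have "represents (exec ?J cf) (tick s)" using "12.prems" by (auto simp: represents_def)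
  moreover let ?pre = "pre @ [?J, Const 0 1, ?J']"
  have l: "length ?pre = length pre + 3" by simp
  have "P = ?pre @ compile (length ?pre) c @ ([Const 0 1, ?J''] @ post)"
    unfolding l using P by simp
  moreover have "pc (exec ?J cf) = length ?pre" using r by simp
  moreover have "wf_com c" using "12.prems" by simp
  ultimately obtain t cf' where 1: "reach P S W (exec ?J cf) t cf'" "represents cf' s'"
    "pc cf' = length ?pre + length (compile (length ?pre) c)"
    "t + 6 * ticks (tick s) \<le> 6 * ticks s'"
    using "12.IH"(1)[of ?pre _ "exec ?J cf"] reach_mem[OF 0] by fastforce
  have 1: "reach P S W (exec ?J cf) t cf'" "represents cf' s'"
    "pc cf' = length pre + 3 + length ?C"
    "t + 6 * ticks (tick s) \<le> 6 * ticks s'"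
    using 1 unfolding l by simp_all
  have 2: "reach P S W cf' (Suc 0) (exec (Const 0 1) cf')"
    by (rule reach_one[of _ "pre @ [?J, Const 0 1, ?J'] @ ?C" _ "?J'' # post"])
      (use P 1 assms reach_mem[OF 1(1)] in auto)
  let ?cf2 = "exec ?J'' (exec (Const 0 1) cf')"
  have 3: "reach P S W (exec (Const 0 1) cf') (Suc 0) ?cf2"
    by (rule reach_one[of _ "pre @ [?J, Const 0 1, ?J'] @ ?C @ [Const 0 1]" _ post])
      (use P 1 assms reach_mem[OF 2] in auto)
  have "represents ?cf2 s'" using 1 by (auto simp: represents_def)
  then obtain t' cf'' where 4: "reach P S W ?cf2 t' cf''" "represents cf'' s''"
    "pc cf'' = length pre + length (compile (length pre) (WHILE r c))"
    "t' + 6 * ticks s' \<le> 6 * ticks s''"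
    using "12.IH"(2)[of pre post ?cf2] "12.prems"(1,2) reach_mem[OF 3]
    by (auto simp del: compile.simps)
  show ?case using reach_trans[OF reach_trans[OF reach_trans[OF reach_trans[OF 0 1(1)] 2] 3] 4(1)] 1 4
    by (intro exI[of _ "Suc 0 + t + Suc 0 + Suc 0 + t'"] exI[of _ cf'']) auto
next
  case (13 s r c)
  let ?C = "compile (length pre + 3) c"
  let ?J = "Jump_pos (r + 2) (length pre + 3)"
  let ?J' = "Jump_pos 0 (length pre + 5 + length ?C)"
  let ?J'' = "Jump_pos 0 (length pre)"
  have P: "P = pre @ ?J # ([Const 0 1, ?J'] @ ?C @ [Const 0 1, ?J''] @ post)"
    using "13.prems" by (simp add: Let_def)
  have r: "mem cf (r + 2) = 0" using 13 by (auto simp: represents_def)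
  have 0: "reach P S W cf (Suc 0) (exec ?J cf)"
    by (rule reach_one[OF P]) (use 13 assms in auto)
  have 1: "reach P S W (exec ?J cf) (Suc 0) (exec (Const 0 1) (exec ?J cf))"
    by (rule reach_one[of _ "pre @ [?J]" _ "?J' # ?C @ [Const 0 1, ?J''] @ post"])
      (use P assms r 13 reach_mem[OF 0] in auto)
  let ?cf2 = "exec ?J' (exec (Const 0 1) (exec ?J cf))"
  have 2: "reach P S W (exec (Const 0 1) (exec ?J cf)) (Suc 0) ?cf2"
    by (rule reach_one[of _ "pre @ [?J, Const 0 1]" _ "?C @ [Const 0 1, ?J''] @ post"])
      (use P assms r 13 reach_mem[OF 1] in auto)
  have "represents ?cf2 (tick s)" using "13.prems" by (auto simp: represents_def)
  then show ?case using reach_trans[OF reach_trans[OF 0 1] 2]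
    by (intro exI[of _ "Suc 0 + Suc 0 + Suc 0"] exI[of _ ?cf2]) (auto simp: Let_def)
qed

lemma wp_run:
  assumes "wp N B c Q \<lparr>reg = \<lambda>_. 0, arr = \<lambda>_ _. 0, inp = x, outp = [], ticks = 0\<rparr>" "wf_com c"
    and "40 + 8 * N \<le> W" "B \<le> W"
  shows "\<exists>t s. Q s \<and> halts_at (compile 0 c) x t \<and>
    printed (config_at (compile 0 c) x t) = outp s \<and> t \<le> 6 * ticks s \<and>
    space_bounded (compile 0 c) x t (32 + 8 * N) \<and> words_bounded (compile 0 c) x t W"
proof -
  let ?s0 = "\<lparr>reg = \<lambda>_. 0, arr = \<lambda>_ _. 0, inp = x, outp = [], ticks = 0\<rparr>"
  obtain s where s: "big N B c ?s0 s" "Q s" using assms(1) by (auto simp: wp_def)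
  have "\<exists>t cf'. reach (compile 0 c) (32 + 8 * N) W (initial x) t cf' \<and> represents cf' s \<and>
    pc cf' = length ([] :: program) + length (compile (length ([] :: program)) c) \<and> t + 6 * ticks ?s0 \<le> 6 * ticks s"
    by (rule compile_correct[OF s(1) assms(2), where pre = "[]" and post = "[]"])
      (use assms in \<open>simp_all add: represents_def initial_def\<close>)
  then obtain t cf' where t: "reach (compile 0 c) (32 + 8 * N) W (initial x) t cf'"
    "represents cf' s" "pc cf' = length (compile 0 c)" "t \<le> 6 * ticks s"
    by auto
  note r = reach_config[OF t(1)]
  have "config_at (compile 0 c) x t = cf'" using r by (simp add: config_at_def)
  then show ?thesis using r t s(2)
    by (intro exI[of _ t] exI[of _ s])
      (auto simp: halts_at_def halted_def config_at_def space_bounded_def words_bounded_def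
        represents_def not_le)
qed

subsection \<open>Deleting and restoring vertices\<close>

declare One_nat_def [simp del]

text \<open>Registers are layered: a subroutine on the graph overwrites only registers below some
  \<open>k\<close> and its callers keep their data above, so a single number tells what
  survives.\<close>

definition frame :: "nat \<Rightarrow> state \<Rightarrow> state \<Rightarrow> bool" where
  "frame k s s' \<longleftrightarrow> (\<forall>r\<ge>k. reg s' r = reg s r) \<and> arr s' 3 = arr s 3 \<and>
     inp s' = inp s \<and> outp s' = outp s"

text \<open>Array 0 holds the current degrees, array 1 the offsets of the adjacency lists in array 2, and
  array 3 the solution, as a stack.  Register 14 is \<open>n\<close>, register 15 the height of the stack, register 16
  its height at the last output, and register 17 is the flag of the main loop.  Registers 7, 8 and 11
  pass vertices to the subroutines; the others are scratch.\<close>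

definition SEARCH :: com where
  "SEARCH = WHILE 4 (IMM 0 1 ;; SUB 3 3 0 ;; GET 5 2 3 ;; SUB 4 5 8 ;; SUB 6 8 5 ;; ADD 4 4 6)"

text \<open>The sum of both truncated differences is 0 exactly if two numbers agree, which serves as
  the equality test; register 4 starts at 1 to force the first round. The scan runs downwards from
  the end of the initial part, and the occurrence at \<open>j\<close> guarantees that it
  succeeds.\<close>

lemma wp_SEARCH:
  assumes "reg s 3 = p + d" "reg s 4 = 1" "reg s 8 = w" "j < d" "arr s 2 (p + j) = w"
    "p + d \<le> N" "w \<le> B" "1 \<le> B" "\<And>j. j < d \<Longrightarrow> arr s 2 (p + j) \<le> B"
    and Q: "\<And>s' i. i < d \<Longrightarrow> arr s 2 (p + i) = w \<Longrightarrow> arr s' = arr s \<Longrightarrow> inp s' = inp s \<Longrightarrow>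
      outp s' = outp s \<Longrightarrow> (\<forall>r. r \<notin> {0,3,4,5,6} \<longrightarrow> reg s' r = reg s r) \<Longrightarrow> reg s' 3 = p + i \<Longrightarrow>
      ticks s' \<le> ticks s + 1 + 7 * d \<Longrightarrow> Q s'"
  shows "wp N B SEARCH Q s"
  unfolding SEARCH_def
proof (rule wp_while_inv[where m = d and I = "\<lambda>m st. m \<le> d \<and> arr st = arr s \<and> inp st = inp s \<and>
    outp st = outp s \<and> (\<forall>r. r \<notin> {0,3,4,5,6} \<longrightarrow> reg st r = reg s r) \<and> reg st 3 = p + m \<and>
    (if reg st 4 > 0 then \<forall>i. m \<le> i \<and> i < d \<longrightarrow> arr s 2 (p + i) \<noteq> w
     else m < d \<and> arr s 2 (p + m) = w) \<and> ticks st + 7 * m \<le> ticks s + 7 * d"], goal_cases)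
  case 1
  then show ?case using assms by simp
next
  case (2 m st)
  then have m: "m > 0" using assms(4,5) by (metis gr0I le0)
  obtain m' where m': "m = Suc m'" using m by (cases m) auto
  have w: "reg st 8 = w" using 2 assms(3) by simp
  have x: "arr s 2 (p + m') \<le> B" "p + m' < N" using assms 2 m' by auto
  have ne: "i = m' \<or> Suc m' \<le> i" if "m' \<le> i" for i using that by auto
  have arrst: "arr st = arr s" using 2 by simp
  show ?case
  proof (intro conjI m)
    show "wp N B (IMM 0 1 ;; SUB 3 3 0 ;; GET 5 2 3 ;; SUB 4 5 8 ;; SUB 6 8 5 ;; ADD 4 4 6)
      (\<lambda>st. m - 1 \<le> d \<and> arr st = arr s \<and> inp st = inp s \<and>
      outp st = outp s \<and> (\<forall>r. r \<notin> {0,3,4,5,6} \<longrightarrow> reg st r = reg s r) \<and> reg st 3 = p + (m - 1) \<and>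
      (if reg st 4 > 0 then \<forall>i. m - 1 \<le> i \<and> i < d \<longrightarrow> arr s 2 (p + i) \<noteq> w
      else m - 1 < d \<and> arr s 2 (p + (m - 1)) = w) \<and> ticks st + 7 * (m - 1) \<le> ticks s + 7 * d) (tick st)"
      using 2 m' w x assms(7,8) arrst by (auto simp: wp_simps dest!: ne)
  qed
next
  case (3 m st)
  then show ?case using Q[of m "tick st"] by auto
qed

definition REMOVE :: com where
  "REMOVE = GET 1 1 7 ;; GET 2 0 7 ;; ADD 3 1 2 ;; IMM 4 1 ;; SEARCH ;; IMM 0 1 ;; SUB 2 2 0 ;;
    PUT 0 7 2 ;; ADD 2 1 2 ;; GET 5 2 2 ;; PUT 2 3 5 ;; PUT 2 2 8"

text \<open>The number \<open>n\<close> stands for an additional vertex adjacent to all others.  Its adjacency list is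
  the list of the remaining vertices, so that it needs no separate treatment, and all degrees are
  larger by one than in the graph.\<close>

locale layout =
  fixes n :: nat and L :: "nat \<Rightarrow> nat list" and N B :: nat and off :: "nat \<Rightarrow> nat"
  assumes distinct_L: "u \<le> n \<Longrightarrow> distinct (L u)"
    and L_le: "u \<le> n \<Longrightarrow> set (L u) \<subseteq> {..n}"
    and L_sym: "u \<le> n \<Longrightarrow> w \<le> n \<Longrightarrow> w \<in> set (L u) \<longleftrightarrow> u \<in> set (L w)"
    and L_irr: "u \<le> n \<Longrightarrow> u \<notin> set (L u)"
    and L_n: "set (L n) = {..<n}"
    and off_def: "off = (\<lambda>u. \<Sum>i<u. length (L i))"
    and N: "off (Suc n) < N" "n < N"
    and B: "2 * N \<le> B"
begin

lemma off_add: "u < v \<Longrightarrow> off u + length (L u) \<le> off v"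
proof -
  assume "u < v"
  then have "off (Suc u) \<le> off v" unfolding off_def by (intro sum_mono2) auto
  then show ?thesis by (simp add: off_def)
qed

lemma off_N: "u \<le> n \<Longrightarrow> off u + length (L u) < N"
  using off_add[of u "Suc n"] N by simp

lemma off_disj:
  "u \<noteq> v \<Longrightarrow> i < length (L u) \<Longrightarrow> j < length (L v) \<Longrightarrow> off u + i \<noteq> off v + j"
  using off_add[of u v] off_add[of v u] by (cases "u < v") auto

definition seg :: "(nat \<Rightarrow> nat \<Rightarrow> nat) \<Rightarrow> nat \<Rightarrow> nat list" where
  "seg A u = map (\<lambda>j. A 2 (off u + j)) [0..<length (L u)]"

text \<open>Of the adjacency list of \<open>u\<close>, the final part \<open>\<delta> u\<close> is currently deleted, most recent first.\<close>

definition ginv :: "(nat \<Rightarrow> nat list) \<Rightarrow> (nat \<Rightarrow> nat \<Rightarrow> nat) \<Rightarrow> bool" where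
  "ginv \<delta> A \<longleftrightarrow> (\<forall>u\<le>n. A 1 u = off u \<and> A 0 u \<le> length (L u) \<and> drop (A 0 u) (seg A u) = \<delta> u \<and>
     distinct (seg A u) \<and> set (seg A u) = set (L u))"

lemma length_seg [simp]: "length (seg A u) = length (L u)"
  by (simp add: seg_def)

lemma nth_seg: "j < length (L u) \<Longrightarrow> seg A u ! j = A 2 (off u + j)"
  by (simp add: seg_def)

lemma ginvD:
  assumes "ginv \<delta> A" "u \<le> n"
  shows "A 1 u = off u" "A 0 u \<le> length (L u)" "drop (A 0 u) (seg A u) = \<delta> u"
    "distinct (seg A u)" "set (seg A u) = set (L u)"
  using assms by (auto simp: ginv_def)

definition alive :: "(nat \<Rightarrow> nat \<Rightarrow> nat) \<Rightarrow> nat \<Rightarrow> nat list" where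
  "alive A u = take (A 0 u) (seg A u)"

lemma alive:
  assumes "ginv \<delta> A" "u \<le> n"
  shows "length (alive A u) = A 0 u" "distinct (alive A u)"
    "set (alive A u) = set (L u) - set (\<delta> u)" "A 0 u = card (set (L u) - set (\<delta> u))"
    "\<And>j. j < A 0 u \<Longrightarrow> alive A u ! j = A 2 (off u + j)"
proof -
  note g = ginvD[OF assms]
  show l: "length (alive A u) = A 0 u" and d: "distinct (alive A u)"
    using g by (simp_all add: alive_def)
  have e: "alive A u @ \<delta> u = seg A u" using g(3) by (metis alive_def append_take_drop_id)
  then have "distinct (alive A u @ \<delta> u)" "set (alive A u @ \<delta> u) = set (L u)" using g by simp_all
  then show s: "set (alive A u) = set (L u) - set (\<delta> u)" by auto
  show "A 0 u = card (set (L u) - set (\<delta> u))" using distinct_card[OF d] l s by simp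
  show "\<And>j. j < A 0 u \<Longrightarrow> alive A u ! j = A 2 (off u + j)"
    using g(2) by (simp add: alive_def nth_seg)
qed

lemma ginv_length:
  assumes "ginv \<delta> A" "u \<le> n"
  shows "A 0 u + length (\<delta> u) = length (L u)"
  using ginvD[OF assms] by (metis add_diff_inverse_nat length_drop length_seg not_less)

text \<open>Exchanging position \<open>i\<close> with the last position \<open>l\<close> of the
  initial part only permutes the segment and puts \<open>w\<close> in front of the deleted suffix,
  so a deletion is a push onto a stack. Other segments are disjoint from this one.\<close>

lemma ginv_remove:
  assumes g: "ginv \<delta> A" and u: "u \<le> n" and i: "i < A 0 u" "A 2 (off u + i) = w"
  defines "l \<equiv> A 0 u - 1"
  assumes A': "A' = A(0 := (A 0)(u := l), 2 := (A 2)(off u + i := A 2 (off u + l), off u + l := w))"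
  shows "ginv (\<delta>(u := w # \<delta> u)) A'" "\<And>v. v \<noteq> u \<Longrightarrow> seg A' v = seg A v"
proof -
  note gu = ginvD[OF g u]
  have l: "l < length (L u)" "i < length (L u)" "i \<le> l" "Suc l = A 0 u"
    using i gu by (auto simp: l_def)
  show s: "seg A' v = seg A v" if "v \<noteq> u" for v
    using off_disj[OF that _ l(1)] off_disj[OF that _ l(2)] by (auto simp: seg_def A')
  have su: "seg A' u = (seg A u)[i := seg A u ! l, l := seg A u ! i]"
    using l i by (intro nth_equalityI) (auto simp: A' nth_seg nth_list_update)
  have "drop l (seg A' u) = w # \<delta> u"
  proof -
    have "drop l (seg A' u) = seg A' u ! l # drop (Suc l) (seg A' u)"
      using l(1) by (metis Cons_nth_drop_Suc length_seg)
    also have "seg A' u ! l = w" using l i by (simp add: nth_seg A')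
    also have "drop (Suc l) (seg A' u) = drop (Suc l) (seg A u)"
      using l su by simp
    finally show ?thesis using gu l by simp
  qed
  moreover have "distinct (seg A' u)" "set (seg A' u) = set (L u)"
    using su l gu by simp_all
  ultimately show "ginv (\<delta>(u := w # \<delta> u)) A'"
    using g s l by (auto simp: ginv_def A')
qed

lemma wp_REMOVE:
  assumes g: "ginv \<delta> (arr s)" and u: "reg s 7 = u" "u \<le> n" and w: "reg s 8 = w" "w \<le> n"
    and wu: "w \<in> set (L u) - set (\<delta> u)"
    and Q: "\<And>s'. ginv (\<delta>(u := w # \<delta> u)) (arr s') \<Longrightarrow> frame 7 s s' \<Longrightarrow>
      (\<And>v. v \<noteq> u \<Longrightarrow> seg (arr s') v = seg (arr s) v) \<Longrightarrow>
      ticks s' \<le> ticks s + 12 + 7 * arr s 0 u \<Longrightarrow> Q s'"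
  shows "wp N B REMOVE Q s"
proof -
  let ?A = "arr s"
  note gu = ginvD[OF g u(2)]
  note al = alive[OF g u(2)]
  obtain j where j: "j < ?A 0 u" "?A 2 (off u + j) = w"
    using wu al by (metis in_set_conv_nth)
  have le: "?A 2 (off u + j) \<le> n" if "j < ?A 0 u" for j
    using that al L_le[OF u(2)] nth_mem[of j "alive ?A u"] by fastforce
  have dN: "off u + ?A 0 u < N" using gu off_N[OF u(2)] by simp
  have nB: "n < B" "N < B" "1 \<le> B" using N B by auto
  have uN: "u < N" "off u + ?A 0 u \<le> B" using u N dN nB by auto
  show ?thesis
    unfolding REMOVE_def
    apply (simp add: wp_simps u w gu uN nB)
    apply (rule wp_SEARCH[where p = "off u" and d = "?A 0 u" and w = w and j = j])
    subgoal by simp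
    subgoal by simp
    subgoal using w by simp
    subgoal using j by simp
    subgoal using j by simp
    subgoal using dN by simp
    subgoal using w nB by simp
    subgoal using nB by simp
    subgoal for j using le[of j] nB by simp
    subgoal for s1 i
      using u w gu dN nB N j
      apply (simp add: wp_simps)
      apply (intro conjI)
      subgoal by simp
      subgoal by simp
      apply (rule Q)
      subgoal by (rule ginv_remove(1)[OF g u(2), of i w]) (auto simp: fun_eq_iff)
      subgoal by (auto simp: frame_def)
      subgoal for v by (rule ginv_remove(2)[OF g u(2), of i w]) (auto simp: fun_eq_iff)
      subgoal by simp
      done
    done
qed

end

text \<open>The list of \<open>w\<close> itself is not changed: it keeps the vertices from whose
  lists \<open>w\<close> is removed, and \<open>UNDO\<close> traverses the same entries later. The
  extra vertex is one of them, so \<open>w\<close> also leaves the list of remaining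
  vertices.\<close>

definition DEL :: com where
  "DEL = GET 9 0 8 ;; GET 10 1 8 ;;
    WHILE 9 (IMM 0 1 ;; SUB 9 9 0 ;; ADD 7 10 9 ;; GET 7 2 7 ;; REMOVE)"

definition UNDO :: com where
  "UNDO = GET 9 0 8 ;; GET 10 1 8 ;;
    WHILE 9 (IMM 0 1 ;; SUB 9 9 0 ;; ADD 7 10 9 ;; GET 7 2 7 ;; GET 5 0 7 ;; ADD 5 5 0 ;; PUT 0 7 5)"

context layout
begin

lemma BN: "1 \<le> B" "n < B" "N < B"
  using N B by auto

lemma dat_le:
  assumes "ginv \<delta> A" "u \<le> n" "j < A 0 u"
  shows "A 2 (off u + j) \<le> n" "off u + j < N" "off u + j \<le> B" "off u + A 0 u \<le> B"
proof -
  show "A 2 (off u + j) \<le> n"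
    using assms alive[OF assms(1,2)] L_le[OF assms(2)] nth_mem[of j "alive A u"] by fastforce
  show "off u + j < N" "off u + j \<le> B" "off u + A 0 u \<le> B"
    using assms(3) ginvD[OF assms(1,2)] off_N[OF assms(2)] BN by auto
qed

lemma wp_DEL:
  assumes g: "ginv \<delta> (arr s)" and w: "reg s 8 = w" "w \<le> n"
    and wu: "\<And>u. u \<in> set (L w) - set (\<delta> w) \<Longrightarrow> w \<notin> set (\<delta> u)"
    and M: "\<And>u. u \<in> set (L w) - set (\<delta> w) \<Longrightarrow> arr s 0 u \<le> M"
    and Q: "\<And>s'. ginv (\<lambda>u. if u \<in> set (L w) - set (\<delta> w) then w # \<delta> u else \<delta> u) (arr s') \<Longrightarrow>
      frame 11 s s' \<Longrightarrow>
      (\<And>v. v \<notin> set (L w) - set (\<delta> w) \<Longrightarrow> seg (arr s') v = seg (arr s) v) \<Longrightarrow>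
      ticks s' \<le> ticks s + 3 + (17 + 7 * M) * arr s 0 w \<Longrightarrow> Q s'"
  shows "wp N B DEL Q s"
proof -
  let ?A = "arr s"
  define xs where "xs = alive ?A w"
  define d where "d = ?A 0 w"
  note gw = ginvD[OF g w(2)]
  note al = alive[OF g w(2), folded xs_def d_def]
  \<comment> \<open>Entries are handled from the last to the first, so those at positions
    \<open>m\<close> and above are done.\<close>
  define D where "D m = (\<lambda>u. if u \<in> set (drop m xs) then w # \<delta> u else \<delta> u)" for m
  define I where "I m st \<longleftrightarrow> m \<le> d \<and> reg st 9 = m \<and> ginv (D m) (arr st) \<and> frame 11 s st \<and>
      reg st 8 = w \<and> reg st 10 = off w \<and>
      (\<forall>v. v \<notin> set xs \<longrightarrow> seg (arr st) v = seg ?A v) \<and>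
      ticks st + (17 + 7 * M) * m \<le> ticks s + 2 + (17 + 7 * M) * d" for m st
  have wxs: "w \<notin> set xs" using al L_irr[OF w(2)] by auto
  have wN: "w < N" using w N by simp
  show ?thesis
    unfolding DEL_def
    apply (simp add: wp_simps w wN)
    apply (rule wp_while_inv[where I = I and m = d])
    subgoal
      using g gw al(1) w by (auto simp: I_def D_def frame_def d_def)
    subgoal for m st
      apply (intro conjI)
      subgoal by (simp add: I_def)
      subgoal
      proof -
        assume I: "I m st" and pos: "0 < reg st 9"
        then obtain m' where m': "m = Suc m'" by (cases m) (auto simp: I_def)
        have md: "m' < d" "reg st 9 = Suc m'" using I m' by (auto simp: I_def)
        have gD: "ginv (D m) (arr st)" using I by (simp add: I_def)
        have segw: "seg (arr st) w = seg ?A w" using I wxs by (simp add: I_def)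
        define u where "u = xs ! m'"
        have uxs: "u \<in> set xs" using md al(1) nth_mem[of m' xs] by (simp add: u_def)
        have dr: "drop m' xs = u # drop m xs" using md(1) al(1) m' Cons_nth_drop_Suc[of m' xs] by (simp add: u_def)
        have "distinct (drop m' xs)" using al by simp
        then have ud: "u \<notin> set (drop m xs)" unfolding dr by simp
        have un: "u \<le> n" using uxs al L_le[OF w(2)] by auto
        have datu: "arr st 2 (off w + m') = u"
          using nth_seg[of m' w "arr st"] nth_seg[of m' w ?A] segw al(5)[OF md(1)] md gw
          by (simp add: d_def u_def)
        have Du: "D m u = \<delta> u" "(D m)(u := w # D m u) = D m'"
          using ud dr m' by (auto simp: D_def fun_eq_iff)
        \<comment> \<open>An entry not yet handled still has its initial degree, since the length of
          its deleted part determines it.\<close>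
        have deg: "arr st 0 u \<le> M"
          using ginv_length[OF gD un] ginv_length[OF g un] Du M[of u] uxs al(3) by simp
        have wLu: "w \<in> set (L u) - set (D m u)"
          using uxs al Du wu[of u] L_sym[OF un w(2)] by auto
        have bn: "off w + m' < N" "off w + m' \<le> B"
          using dat_le[OF g w(2)] md by (auto simp: d_def)
        show ?thesis
          using I pos md bn datu BN(1) unfolding m'
          apply (simp add: wp_simps I_def)
          apply (rule wp_REMOVE[where \<delta> = "D m" and u = u and w = w])
          subgoal using gD by simp
          subgoal by simp
          subgoal using un by simp
          subgoal by simp
          subgoal using w by simp
          subgoal using wLu by simp
          subgoal for s'
            using m' Du(2) deg uxs I unfolding I_def
            apply (intro conjI)
            subgoal by simp
            subgoal by (simp add: frame_def)
            subgoal by simp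
            subgoal by (simp add: frame_def)
            subgoal by (simp add: frame_def)
            subgoal by (simp add: frame_def)
            subgoal
              apply (intro allI impI)
              subgoal for v by (cases "v = u") auto
              done
            subgoal using mult_le_mono2[OF deg, of 7] by simp
            done
          done
      qed
      done
    subgoal for m st
      apply (rule Q)
      subgoal
        using al(3) by (auto simp: I_def D_def)
      subgoal by (simp add: I_def frame_def)
      subgoal using al by (simp add: I_def)
      subgoal by (simp add: I_def d_def)
      done
    done
qed

text \<open>No entry has to move: the head of the deleted suffix adjoins the initial part, so
  shifting the border by one restores it.\<close>

lemma ginv_restore:
  assumes g: "ginv \<delta> A" and u: "u \<le> n" "\<delta> u = w # r"
  shows "ginv (\<delta>(u := r)) (A(0 := (A 0)(u := A 0 u + 1)))"
proof -
  have s: "seg (A(0 := (A 0)(u := Suc (A 0 u)))) = seg A" by (auto simp: seg_def fun_eq_iff)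
  have "Suc (A 0 u) \<le> length (L u)" using ginv_length[OF g u(1)] u(2) by simp
  moreover have "drop (Suc (A 0 u)) (seg A u) = r"
    using ginvD[OF g u(1)] u(2) by (metis drop_Suc list.sel(3) tl_drop)
  ultimately have "ginv (\<delta>(u := r)) (A(0 := (A 0)(u := Suc (A 0 u))))"
    using g by (auto simp: ginv_def s)
  then show ?thesis by (simp only: Suc_eq_plus1)
qed

lemma wp_UNDO:
  assumes g: "ginv (\<lambda>u. if u \<in> set (L w) - set (\<delta> w) then w # \<delta> u else \<delta> u) (arr s)"
    and w: "reg s 8 = w" "w \<le> n"
    and Q: "\<And>s'. ginv \<delta> (arr s') \<Longrightarrow> frame 11 s s' \<Longrightarrow>
      ticks s' \<le> ticks s + 3 + 8 * arr s 0 w \<Longrightarrow> Q s'"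
  shows "wp N B UNDO Q s"
proof -
  let ?A = "arr s"
  define xs where "xs = alive ?A w"
  define d where "d = ?A 0 w"
  note gw = ginvD[OF g w(2)]
  \<comment> \<open>Since \<open>w\<close> is not its own neighbour, the assumption \<open>g\<close>
    describes its own list as it was before the deletion.\<close>
  have wL: "w \<notin> set (L w)" using L_irr w by simp
  note al' = alive[OF g w(2), folded xs_def d_def]
  have al: "length xs = d" "distinct xs" "set xs = set (L w) - set (\<delta> w)"
    "\<And>j. j < d \<Longrightarrow> xs ! j = ?A 2 (off w + j)"
    using al' wL by auto
  define D where "D m = (\<lambda>u. if u \<in> set (take m xs) then w # \<delta> u else \<delta> u)" for m
  define I where "I m st \<longleftrightarrow> m \<le> d \<and> reg st 9 = m \<and> ginv (D m) (arr st) \<and> frame 11 s st \<and>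
      reg st 8 = w \<and> reg st 10 = off w \<and> arr st 2 = ?A 2 \<and>
      ticks st + 8 * m \<le> ticks s + 2 + 8 * d" for m st
  have wxs: "w \<notin> set xs" using al L_irr[OF w(2)] by auto
  have wN: "w < N" using w N by simp
  show ?thesis
    unfolding UNDO_def
    apply (simp add: wp_simps w wN)
    apply (rule wp_while_inv[where I = I and m = d])
    subgoal
    proof -
      have "D d = (\<lambda>u. if u \<in> set (L w) - set (\<delta> w) then w # \<delta> u else \<delta> u)"
        using al by (simp add: D_def)
      then show ?thesis using g gw w by (simp add: I_def frame_def d_def)
    qed
    subgoal for m st
      apply (intro conjI)
      subgoal by (simp add: I_def)
      subgoal
      proof -
        assume I: "I m st" and pos: "0 < reg st 9"
        then obtain m' where m': "m = Suc m'" by (cases m) (auto simp: I_def)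
        have md: "m' < d" "reg st 9 = Suc m'" using I m' by (auto simp: I_def)
        have gD: "ginv (D m) (arr st)" using I by (simp add: I_def)
        define u where "u = xs ! m'"
        have uxs: "u \<in> set xs" using md al(1) nth_mem[of m' xs] by (simp add: u_def)
        have tk: "take m xs = take m' xs @ [u]"
          using md al m' by (simp add: u_def take_Suc_conv_app_nth)
        have "distinct (take m xs)" using al by simp
        then have ud: "u \<notin> set (take m' xs)" unfolding tk by simp
        have un: "u \<le> n" using uxs al L_le[OF w(2)] by auto
        have datu: "arr st 2 (off w + m') = u"
          using al(4)[OF md(1)] I by (simp add: I_def u_def)
        have Du: "D m u = w # \<delta> u" "(D m)(u := \<delta> u) = D m'"
          using ud tk m' by (auto simp: D_def fun_eq_iff)
        have "Suc (arr st 0 u) \<le> length (L u)"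
          using ginv_length[OF gD un] Du by simp
        then have deg: "Suc (arr st 0 u) \<le> B" using off_N[OF un] BN by simp
        have bn: "off w + m' < N" "off w + m' \<le> B" "u < N"
          using dat_le[OF g w(2)] md un N by (auto simp: d_def)
        show ?thesis
          using I pos md bn datu BN(1) deg m'
          apply (simp add: wp_simps)
          using ginv_restore[OF gD un Du(1), unfolded Du(2)]
          apply (auto simp: I_def frame_def)
          done
      qed
      done
    subgoal for m st
      apply (rule Q)
      subgoal by (auto simp: I_def D_def)
      subgoal by (simp add: I_def frame_def)
      subgoal by (simp add: I_def d_def)
      done
    done
qed

text \<open>\<open>dl D u\<close> is the deleted part of the adjacency list of \<open>u\<close> once the vertices of \<open>D\<close> have been
  deleted (last one first): the list of a vertex is frozen by its own deletion.\<close>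

fun dl :: "nat list \<Rightarrow> nat \<Rightarrow> nat list" where
  "dl [] u = []"
| "dl (w # D) u = (if u \<in> set (L w) \<and> u \<notin> set D then w # dl D u else dl D u)"

lemma dl_subset: "set (dl D u) \<subseteq> set D"
  by (induction D) auto

text \<open>Freezing concerns deleted vertices only; the list of a vertex still present records all
  deletions of its neighbours.\<close>

lemma dl_alive:
  "set D \<subseteq> {..<n} \<Longrightarrow> u \<le> n \<Longrightarrow> u \<notin> set D \<Longrightarrow> set (dl D u) = set D \<inter> set (L u)"
proof (induction D)
  case (Cons w D)
  then show ?case using L_sym[of u w] by auto
qed simp

text \<open>The extra vertex is adjacent to all others and never deleted, so the dead part of its
  list is the whole deletion stack. This is where \<open>TOP\<close> finds the vertex to restore
  next, without further memory.\<close>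

lemma dl_n: "set D \<subseteq> {..<n} \<Longrightarrow> dl D n = D"
proof (induction D)
  case (Cons w D)
  then show ?case using L_sym[of n w] L_n by auto
qed simp

text \<open>Brings \<open>dl\<close> into the form in which \<open>wp_DEL\<close> and
  \<open>wp_UNDO\<close> describe one deletion. As \<open>w\<close> is still present,
  \<open>dl D w\<close> contains all its deleted neighbours, which are the vertices that freezing
  excludes.\<close>

lemma dl_Cons:
  assumes "set D \<subseteq> {..<n}" "w < n" "w \<notin> set D"
  shows "dl (w # D) = (\<lambda>u. if u \<in> set (L w) - set (dl D w) then w # dl D u else dl D u)"
  using dl_alive[of D w] assms by (auto simp: fun_eq_iff)

lemma card_alive:
  assumes "set D \<subseteq> {..<n}" "u \<le> n" "distinct D"
  shows "card (set (L u) - set D) \<le> Suc n - length D"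
proof -
  have "card ({..n} - set D) = Suc n - length D"
    using assms distinct_card[of D] by (subst card_Diff_subset) auto
  moreover have "card (set (L u) - set D) \<le> card ({..n} - set D)"
    using L_le[OF assms(2)] by (intro card_mono) auto
  ultimately show ?thesis by simp
qed

lemma degree_alive:
  assumes "ginv (dl D) A" "set D \<subseteq> {..<n}" "u \<le> n" "u \<notin> set D"
  shows "A 0 u = card (set (L u) - set D)" "set (alive A u) = set (L u) - set D"
    "distinct D \<Longrightarrow> A 0 u \<le> Suc n - length D"
proof -
  have e: "set (L u) - set (dl D u) = set (L u) - set D"
    using dl_alive[OF assms(2-4)] by auto
  show c: "A 0 u = card (set (L u) - set D)" and "set (alive A u) = set (L u) - set D"
    using alive[OF assms(1,3)] e by auto
  assume "distinct D"
  then show "A 0 u \<le> Suc n - length D" using c card_alive[OF assms(2,3)] by simp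
qed

lemma degree_n:
  assumes "ginv (dl D) A" "set D \<subseteq> {..<n}" "distinct D"
  shows "A 0 n = n - length D" "length D \<le> n"
proof -
  have "card ({..<n} - set D) = n - length D"
    using assms distinct_card[of D] by (subst card_Diff_subset) auto
  then show "A 0 n = n - length D" using degree_alive[OF assms(1,2), of n] assms(2) L_n by auto
  show "length D \<le> n" using assms distinct_card[of D] card_mono[of "{..<n}" "set D"] by auto
qed

lemma wp_DEL_dl:
  assumes g: "ginv (dl D) (arr s)" and D: "distinct (w # D)" "set (w # D) \<subseteq> {..<n}"
    and w: "reg s 8 = w" and M: "Suc n - length D \<le> M"
    and Q: "\<And>s'. ginv (dl (w # D)) (arr s') \<Longrightarrow> frame 11 s s' \<Longrightarrow>
      (\<And>v. v \<in> set (w # D) \<Longrightarrow> seg (arr s') v = seg (arr s) v) \<Longrightarrow>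
      ticks s' \<le> ticks s + 3 + (17 + 7 * M) * M \<Longrightarrow> Q s'"
  shows "wp N B DEL Q s"
proof (rule wp_DEL[OF g w])
  show wn: "w \<le> n" using D by simp
  note dg = degree_alive[OF g _ _ _]
  have e: "set (L w) - set (dl D w) = set (L w) - set D"
    using dl_alive[of D w] D by auto
  show "w \<notin> set (dl D u)" for u using dl_subset[of D u] D by auto
  show "arr s 0 u \<le> M" if "u \<in> set (L w) - set (dl D w)" for u
    using that dg[of u] L_le[OF wn] D M unfolding e by fastforce
  fix s' assume s': "ginv (\<lambda>u. if u \<in> set (L w) - set (dl D w) then w # dl D u else dl D u) (arr s')"
    "frame 11 s s'"
    "\<And>v. v \<notin> set (L w) - set (dl D w) \<Longrightarrow> seg (arr s') v = seg (arr s) v"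
    "ticks s' \<le> ticks s + 3 + (17 + 7 * M) * arr s 0 w"
  have "arr s 0 w \<le> M" using dg[of w] D M by fastforce
  then have "(17 + 7 * M) * arr s 0 w \<le> (17 + 7 * M) * M" by (rule mult_le_mono2)
  then have t: "ticks s' \<le> ticks s + 3 + (17 + 7 * M) * M" using s'(4) by linarith
  have "ginv (dl (w # D)) (arr s')" using s'(1) D dl_Cons[of D w] by simp
  moreover have "seg (arr s') v = seg (arr s) v" if "v \<in> set (w # D)" for v
    using that s'(3)[of v] L_irr[OF wn] unfolding e by auto
  ultimately show "Q s'" using Q[of s'] s'(2) t by blast
qed

lemma wp_UNDO_dl:
  assumes g: "ginv (dl (w # D)) (arr s)" and D: "distinct (w # D)" "set (w # D) \<subseteq> {..<n}"
    and w: "reg s 8 = w" and M: "Suc n - length D \<le> M"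
    and Q: "\<And>s'. ginv (dl D) (arr s') \<Longrightarrow> frame 11 s s' \<Longrightarrow>
      ticks s' \<le> ticks s + 3 + 8 * M \<Longrightarrow> Q s'"
  shows "wp N B UNDO Q s"
proof (rule wp_UNDO[OF _ w])
  show wn: "w \<le> n" using D by simp
  show "ginv (\<lambda>u. if u \<in> set (L w) - set (dl D w) then w # dl D u else dl D u) (arr s)"
    using g dl_Cons[of D w] D by simp
  fix s' assume s': "ginv (dl D) (arr s')" "frame 11 s s'" "ticks s' \<le> ticks s + 3 + 8 * arr s 0 w"
  have "dl (w # D) w = dl D w" using L_irr[OF wn] by simp
  then have "arr s 0 w = arr s' 0 w"
    using ginv_length[OF g wn] ginv_length[OF s'(1) wn] by simp
  also have "\<dots> \<le> M" using degree_alive[OF s'(1), of w] D M by fastforce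
  finally show "Q s'" using Q s' by simp
qed

end

subsection \<open>One iteration\<close>

text \<open>The vertex in register 11 has been deleted before, which freezes its list: the traversal
  is not disturbed by the deletions that it performs. Register 4 holds \<open>n\<close> minus the
  current entry, which is 0 only for the extra vertex, the one that must stay.\<close>

definition NBRS :: com where
  "NBRS = GET 12 0 11 ;; GET 13 1 11 ;;
    WHILE 12 (IMM 0 1 ;; SUB 12 12 0 ;; ADD 8 13 12 ;; GET 8 2 8 ;; SUB 4 14 8 ;; IF 4 DEL SKIP)"

text \<open>The order of the list of \<open>n\<close> depends on the history of swaps. Preferring
  the smaller number among equal degrees makes the result a function of the current graph.\<close>

definition PICK :: com where
  "PICK = GET 10 1 14 ;; GET 9 0 14 ;; IMM 0 1 ;; SUB 9 9 0 ;; ADD 7 10 9 ;; GET 11 2 7 ;; GET 12 0 11 ;;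
    WHILE 9 (IMM 0 1 ;; SUB 9 9 0 ;; ADD 7 10 9 ;; GET 7 2 7 ;; GET 6 0 7 ;; SUB 4 12 6 ;;
      IF 4 (IMM 0 0 ;; ADD 11 7 0 ;; ADD 12 6 0)
        (SUB 4 6 12 ;; IF 4 SKIP (SUB 4 11 7 ;; IF 4 (IMM 0 0 ;; ADD 11 7 0 ;; ADD 12 6 0) SKIP)))"

text \<open>Cells from the current height up to that of the last output still hold the vertices
  popped in between. They form the difference, together with the new vertex in register 11; if this
  one is itself among them, it cancels. Register 9 stays 1 as long as it has not been met.\<close>

definition EMIT :: com where
  "EMIT = IMM 9 1 ;; SUB 4 16 15 ;;
    WHILE 4 (IMM 0 1 ;; SUB 4 4 0 ;; ADD 5 15 4 ;; GET 7 3 5 ;; SUB 6 7 11 ;; SUB 5 11 7 ;; ADD 6 6 5 ;;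
      IF 6 (ADD 7 7 0 ;; PRINT 7) (IMM 9 0)) ;;
    IMM 0 1 ;; IF 9 (ADD 6 11 0 ;; PRINT 6) SKIP ;; IMM 6 0 ;; PRINT 6 ;;
    PUT 3 15 11 ;; ADD 15 15 0 ;; IMM 0 0 ;; ADD 16 15 0"

definition TOP :: com where
  "TOP = GET 10 1 14 ;; GET 9 0 14 ;; ADD 7 10 9 ;; GET 8 2 7 ;; SUB 4 8 11 ;; SUB 5 11 8 ;; ADD 4 4 5"

text \<open>The chosen vertex is at the bottom of the deletions of its call and is not restored
  itself: the loop that chose it continues without it.\<close>

definition UP :: com where
  "UP = IMM 0 1 ;; SUB 15 15 0 ;; GET 11 3 15 ;; TOP ;; WHILE 4 (UNDO ;; TOP)"

context layout
begin

lemma wp_NBRS: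
  assumes g: "ginv (dl (v # D)) (arr s)" and D: "distinct (v # D)" "set (v # D) \<subseteq> {..<n}"
    and v: "reg s 11 = v" "reg s 14 = n" and M: "Suc n - length D \<le> M"
    and Q: "\<And>s' E. ginv (dl (E @ v # D)) (arr s') \<Longrightarrow> distinct (E @ v # D) \<Longrightarrow>
      set E = set (L v) - {n} - set D \<Longrightarrow> frame 14 s s' \<Longrightarrow>
      ticks s' \<le> ticks s + 3 + (10 + (17 + 7 * M) * M) * M \<Longrightarrow> Q s'"
  shows "wp N B NBRS Q s"
proof -
  let ?A = "arr s"
  define xs where "xs = alive ?A v"
  define d where "d = ?A 0 v"
  define K where "K = 10 + (17 + 7 * M) * M"
  have vn: "v \<le> n" "v < n" using D by simp_all
  note gv = ginvD[OF g vn(1)]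
  note al' = alive[OF g vn(1), folded xs_def d_def]
  have vL: "v \<notin> set (L v)" using L_irr vn by simp
  have e: "set (L v) - set (dl (v # D) v) = set (L v) - set D"
    using dl_alive[of D v] D vL by auto
  have al: "length xs = d" "distinct xs" "set xs = set (L v) - set D"
    "\<And>j. j < d \<Longrightarrow> xs ! j = ?A 2 (off v + j)"
    using al' unfolding e by auto
  have dM: "d \<le> M" using al'(4) card_alive[of D v] D M unfolding e by simp
  define I where "I m st \<longleftrightarrow> m \<le> d \<and> reg st 12 = m \<and> reg st 13 = off v \<and>
      (\<exists>E. ginv (dl (E @ v # D)) (arr st) \<and> distinct (E @ v # D) \<and> set E = set (drop m xs) - {n}) \<and>
      seg (arr st) v = seg ?A v \<and> frame 14 s st \<and>
      ticks st + K * m \<le> ticks s + 2 + K * d" for m st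
  have vN: "v < N" using vn N by simp
  show ?thesis
    unfolding NBRS_def
    apply (simp add: wp_simps v vN)
    apply (rule wp_while_inv[where I = I and m = d])
    subgoal
      using g gv al(1) D by (auto simp: I_def frame_def d_def intro!: exI[of _ "[]"])
    subgoal for m st
      apply (intro conjI)
      subgoal by (simp add: I_def)
      subgoal
      proof -
        assume I: "I m st" and pos: "0 < reg st 12"
        then obtain m' where m': "m = Suc m'" by (cases m) (auto simp: I_def)
        have md: "m' < d" "reg st 12 = Suc m'" "reg st 13 = off v" "reg st 14 = n"
          using I m' v by (auto simp: I_def frame_def)
        obtain E where E: "ginv (dl (E @ v # D)) (arr st)" "distinct (E @ v # D)"
          "set E = set (drop m xs) - {n}" using I by (auto simp: I_def)
        have segv: "seg (arr st) v = seg ?A v" using I by (simp add: I_def)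
        have fr: "frame 14 s st" using I by (simp add: I_def)
        have tk: "ticks st + K * Suc m' \<le> ticks s + 2 + K * d" using I m' by (simp add: I_def)
        define w where "w = xs ! m'"
        have wxs: "w \<in> set xs" using md al(1) nth_mem[of m' xs] by (simp add: w_def)
        have dr: "drop m' xs = w # drop m xs"
          using md(1) al(1) m' Cons_nth_drop_Suc[of m' xs] by (simp add: w_def)
        have "distinct (drop m' xs)" using al by simp
        then have wd: "w \<notin> set (drop m xs)" unfolding dr by simp
        have wn: "w \<le> n" using wxs al L_le[OF vn(1)] by auto
        have datw: "arr st 2 (off v + m') = w"
          using nth_seg[of m' v "arr st"] nth_seg[of m' v ?A] segv al(4)[OF md(1)] md gv
          by (simp add: d_def w_def)
        have bn: "off v + m' < N" "off v + m' \<le> B"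
          using dat_le[OF g vn(1)] md by (auto simp: d_def)
        show ?thesis
        proof (cases "w = n")
          case True
          then have "set E = set (drop m' xs) - {n}" using E dr by auto
          then show ?thesis
            using md bn datw BN(1) True m' E(1,2) segv fr tk
            by (auto simp: wp_simps I_def frame_def K_def)
        next
          case False
          then have w: "w < n" using wn by simp
          have wD: "distinct (w # E @ v # D)" "set (w # E @ v # D) \<subseteq> {..<n}"
          proof -
            have "set (drop m xs) \<subseteq> set xs" by (rule set_drop_subset)
            then have "set E \<subseteq> {..<n}" using E al L_le[OF vn(1)] by force
            then show "set (w # E @ v # D) \<subseteq> {..<n}" using D w by auto
            have "w \<noteq> v" using wxs al vL by auto
            then show "distinct (w # E @ v # D)" using E wd wxs al by auto
          qed
          show ?thesis
            using md bn datw BN(1) w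
            apply (simp add: wp_simps)
            apply (rule wp_DEL_dl[where D = "E @ v # D" and w = w and M = M])
            subgoal using E by simp
            subgoal by (rule wD(1))
            subgoal by (rule wD(2))
            subgoal by simp
            subgoal using M by simp
            subgoal for s'
              unfolding I_def
              apply (intro conjI exI[of _ "w # E"])
              subgoal using m' by simp
              subgoal using m' by (simp add: frame_def)
              subgoal using m' by (simp add: frame_def)
              subgoal by simp
              subgoal using wD by simp
              subgoal using E dr m' w by auto
              subgoal using segv by simp
              subgoal using fr by (simp add: frame_def)
              subgoal using tk m' by (simp add: K_def)
              done
            done
        qed
      qed
      done
    subgoal for m st
    proof -
      assume I: "I m st" and "reg st 12 = 0"
      then have m: "m = 0" by (simp add: I_def)
      obtain E where E: "ginv (dl (E @ v # D)) (arr st)" "distinct (E @ v # D)"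
          "set E = set xs - {n}" using I m by (auto simp: I_def)
      have "K * d \<le> K * M" using dM by simp
      moreover have "ticks st \<le> ticks s + 2 + K * d" using I m by (simp add: I_def)
      ultimately have tk: "ticks (tick st) \<le> ticks s + 3 + K * M" by (simp, linarith)
      have "frame 14 s (tick st)" using I by (simp add: I_def frame_def)
      then show ?thesis
        using E al(3) tk by (intro Q[of E]) (auto simp: K_def)
    qed
    done
qed

lemma wp_PICK:
  assumes g: "ginv (dl D) (arr s)" and D: "distinct D" "set D \<subseteq> {..<n}" "length D < n"
    and n: "reg s 14 = n"
    and Q: "\<And>s' v. reg s' 11 = v \<Longrightarrow> v < n \<Longrightarrow> v \<notin> set D \<Longrightarrow>
      (\<And>u. u < n \<Longrightarrow> u \<notin> set D \<Longrightarrow> arr s 0 v < arr s 0 u \<or> arr s 0 v = arr s 0 u \<and> v \<le> u) \<Longrightarrow>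
      arr s' = arr s \<Longrightarrow> frame 13 s s' \<Longrightarrow> ticks s' \<le> ticks s + 8 + 15 * (n - length D) \<Longrightarrow> Q s'"
  shows "wp N B PICK Q s"
proof -
  let ?A = "arr s"
  define xs where "xs = alive ?A n"
  define d where "d = ?A 0 n"
  note gn = ginvD[OF g order.refl]
  note al' = alive[OF g order.refl, folded xs_def d_def]
  have al: "length xs = d" "set xs = {..<n} - set D" "\<And>j. j < d \<Longrightarrow> xs ! j = ?A 2 (off n + j)"
    using al' dl_n[OF D(2)] L_n by auto
  have d: "d = n - length D" using degree_n[OF g D(2,1)] by (simp add: d_def)
  have "d \<noteq> 0" using d D(3) by simp
  then obtain d' where d': "d = Suc d'" using not0_implies_Suc by blast
  define better where "better v u \<longleftrightarrow> ?A 0 v < ?A 0 u \<or> ?A 0 v = ?A 0 u \<and> v \<le> u" for v u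
  have dat: "off n + j < N" "off n + j \<le> B" "?A 2 (off n + j) = xs ! j" "xs ! j < n" "xs ! j < N"
    "?A 0 (xs ! j) \<le> B" "xs ! j \<le> B" "xs ! j \<in> set xs" if "j < d" for j
  proof -
    show "off n + j < N" "off n + j \<le> B" using dat_le[OF g, of n j] that by (auto simp: d_def)
    show "?A 2 (off n + j) = xs ! j" "xs ! j \<in> set xs"
      using that al nth_mem[of j xs] by auto
    then show "xs ! j < n" "xs ! j < N" "xs ! j \<le> B" using al N BN by auto
    then show "?A 0 (xs ! j) \<le> B"
      using ginvD(2)[OF g, of "xs ! j"] off_N[of "xs ! j"] BN by simp
  qed
  define I where "I m st \<longleftrightarrow> m < d \<and> reg st 9 = m \<and> reg st 10 = off n \<and> arr st = ?A \<and>
      frame 13 s st \<and> reg st 12 = ?A 0 (reg st 11) \<and> reg st 11 \<in> set xs \<and>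
      (\<forall>u\<in>set (drop m xs). better (reg st 11) u) \<and>
      ticks st + 15 * m \<le> ticks s + 7 + 15 * d" for m st
  have dr: "drop j xs = xs ! j # drop (Suc j) xs" if "j < d" for j
    using Cons_nth_drop_Suc[of j xs] al that by simp
  show ?thesis
    unfolding PICK_def
    using dat[of d'] d' gn n N BN
    apply (simp add: wp_simps flip: d_def)
    apply (rule wp_while_inv[where I = I and m = d'])
    subgoal
      using dr[of d'] al by (auto simp: I_def frame_def better_def)
    subgoal for m st
      apply (intro conjI)
      subgoal by (simp add: I_def)
      subgoal
      proof -
        assume I: "I m st" and pos: "0 < reg st 9"
        then obtain m' where m': "m = Suc m'" by (cases m) (auto simp: I_def)
        have md: "m' < d" "reg st 9 = Suc m'" "reg st 10 = off n" "arr st = ?A"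
          "reg st 12 = ?A 0 (reg st 11)" using I m' by (auto simp: I_def)
        have v: "reg st 11 \<in> set xs" "reg st 11 \<le> B" "?A 0 (reg st 11) \<le> B"
        proof -
          show v: "reg st 11 \<in> set xs" using I by (simp add: I_def)
          then show "reg st 11 \<le> B" "?A 0 (reg st 11) \<le> B"
            using al(1) dat by (metis in_set_conv_nth)+
        qed
        have all: "\<forall>u\<in>set (drop m xs). better (reg st 11) u" and fr: "frame 13 s st"
          and tk: "ticks st + 15 * Suc m' \<le> ticks s + 7 + 15 * d"
          using I m' by (auto simp: I_def)
        have dr': "drop m' xs = xs ! m' # drop m xs" using dr md m' by simp
        show ?thesis
          using dat[OF md(1)] md v BN(1) fr tk all dr' m'
          by (auto simp: wp_simps I_def frame_def better_def)
      qed
      done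
    subgoal for m st
      using al by (intro Q[of _ "reg st 11"]) (auto simp: I_def better_def frame_def d)
    done
qed

text \<open>The loop handles \<open>p - length T\<close> popped cells at 11 ticks each, a number
  unrelated to the size of the current graph. Stating the cost with the heights on both sides makes
  it telescope over successive outputs.\<close>

lemma wp_EMIT:
  assumes st: "reg s 15 = length T" "reg s 16 = p" "length T \<le> p"
      "map (arr s 3) [0..<length T] = T" "distinct (map (arr s 3) [0..<p])"
      "\<And>j. j < p \<Longrightarrow> arr s 3 j < n"
    and v: "reg s 11 = v" "v < n" "v \<notin> set T"
    and Q: "\<And>s' ds. arr s' = (arr s)(3 := (arr s 3)(length T := v)) \<Longrightarrow> inp s' = inp s \<Longrightarrow>
      (\<And>r. r \<notin> {0,4,5,6,7,9,15,16} \<Longrightarrow> reg s' r = reg s r) \<Longrightarrow>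
      reg s' 15 = length T + 1 \<Longrightarrow> reg s' 16 = length T + 1 \<Longrightarrow>
      outp s' = outp s @ map Suc ds @ [0] \<Longrightarrow> distinct ds \<Longrightarrow>
      set ds = sym_diff (arr s 3 ` {..<p}) (insert v (set T)) \<Longrightarrow>
      ticks s' + 11 * length T \<le> ticks s + 13 + 11 * p \<Longrightarrow> Q s'"
  shows "wp N B EMIT Q s"
proof -
  let ?A = "arr s 3"
  let ?t = "length T"
  \<comment> \<open>The stack has no repetitions and only entries below \<open>n\<close>, so its
    height is at most \<open>n\<close> and its indices stay in bounds.\<close>
  have inj: "inj_on ?A {..<p}" using st(5) by (auto simp: distinct_map atLeast0LessThan)
  have T: "set T = ?A ` {..<?t}" by (subst st(4)[symmetric]) (auto simp: atLeast0LessThan)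
  have "card (?A ` {..<p}) \<le> card {..<n}" using st(6) by (intro card_mono) auto
  then have pn: "p \<le> n" using card_image[OF inj] by simp
  have "set T \<subseteq> {..<n}" using T st(3,6) by auto
  then have "set T \<subseteq> {..<n} - {v}" using v(3) by blast
  then have "card (set T) \<le> card ({..<n} - {v})" by (intro card_mono) auto
  moreover have "card (set T) = ?t"
    unfolding T using inj_on_subset[OF inj, of "{..<?t}"] st(3) by (simp add: card_image)
  ultimately have tn: "?t < n" using v(2) by (simp add: card_Diff_singleton)
  define I where "I m st \<longleftrightarrow> m \<le> p - ?t \<and> reg st 4 = m \<and> arr st = arr s \<and> inp st = inp s \<and>
      (\<forall>r. r \<notin> {0,4,5,6,7,9} \<longrightarrow> reg st r = reg s r) \<and>
      (\<exists>ds. outp st = outp s @ map Suc ds \<and> distinct ds \<and> set ds = ?A ` {?t + m..<p} - {v}) \<and>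
      reg st 9 = (if v \<in> ?A ` {?t + m..<p} then 0 else 1) \<and>
      ticks st + 11 * m \<le> ticks s + 2 + 11 * (p - ?t)" for m and st :: state
  show ?thesis
    unfolding EMIT_def
    using BN
    apply (simp add: wp_simps)
    apply (rule wp_while_inv[where I = I and m = "p - ?t"])
    subgoal using st by (auto simp: I_def)
    subgoal for m s1
      apply (intro conjI)
      subgoal by (simp add: I_def)
      subgoal
      proof -
        assume I: "I m s1" and pos: "0 < reg s1 4"
        then obtain m' where m': "m = Suc m'" by (cases m) (auto simp: I_def)
        define u where "u = ?A (?t + m')"
        have mp: "?t + m' < p" "reg s1 4 = Suc m'" "arr s1 = arr s" "reg s1 15 = ?t" "reg s1 11 = v"
          using I m' st v by (auto simp: I_def)
        obtain ds where ds: "outp s1 = outp s @ map Suc ds" "distinct ds"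
          "set ds = ?A ` {?t + m..<p} - {v}" using I by (auto simp: I_def)
        have r9: "reg s1 9 = (if v \<in> ?A ` {?t + m..<p} then 0 else 1)" using I by (simp add: I_def)
        have un: "u < n" using st(6) mp by (simp add: u_def)
        have set: "{?t + m'..<p} = insert (?t + m') {?t + m..<p}" using mp m' by auto
        have unew: "u \<notin> ?A ` {?t + m..<p}"
          using mp m' inj_onD[OF inj, of "?t + m'"] by (fastforce simp: u_def)
        have r: "\<forall>r. r \<notin> {0,4,5,6,7,9} \<longrightarrow> reg s1 r = reg s r" and "inp s1 = inp s"
          and tk: "ticks s1 + 11 * Suc m' \<le> ticks s + 2 + 11 * (p - ?t)"
          using I m' by (auto simp: I_def)
        have bn: "?t + m' < N" "?t + m' \<le> B" using mp pn N BN by auto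
        show ?thesis
        proof (cases "u = v")
          case True
          then show ?thesis
            using mp bn BN(1) un m' r tk ds set unew \<open>inp s1 = inp s\<close>
            by (auto simp: wp_simps I_def simp flip: u_def intro!: exI[of _ ds])
        next
          case False
          then have "0 < u - v + (v - u)" by arith
          then show ?thesis
            using mp bn BN un v(2) m' r r9 tk ds set unew \<open>inp s1 = inp s\<close> False
            by (auto simp: wp_simps I_def simp flip: u_def intro!: exI[of _ "ds @ [u]"])
        qed
      qed
      done
    subgoal for m s1
    proof -
      assume I: "I m s1" and "reg s1 4 = 0"
      then have m: "m = 0" by (simp add: I_def)
      obtain ds where ds: "outp s1 = outp s @ map Suc ds" "distinct ds"
        "set ds = ?A ` {?t..<p} - {v}" using I m by (auto simp: I_def)
      define ds' where "ds' = (if v \<in> ?A ` {?t..<p} then ds else ds @ [v])"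
      have split: "{..<p} = {..<?t} \<union> {?t..<p}" using st(3) by auto
      have disj: "?A ` {..<?t} \<inter> ?A ` {?t..<p} = {}"
        using inj st(3) by (force simp: inj_on_def)
      have 1: "distinct ds'" using ds by (auto simp: ds'_def)
      have 2: "set ds' = sym_diff (?A ` {..<p}) (insert v (set T))"
        using ds(3) disj v(3) unfolding ds'_def T split image_Un by auto
      have r9: "reg s1 9 = (if v \<in> ?A ` {?t..<p} then 0 else 1)" using I m by (simp add: I_def)
      have r: "\<And>r. r \<notin> {0,4,5,6,7,9} \<Longrightarrow> reg s1 r = reg s r" "inp s1 = inp s" "arr s1 = arr s"
          and tk: "ticks s1 \<le> ticks s + 2 + 11 * (p - ?t)"
          using I m by (auto simp: I_def)
      show ?thesis
      proof (cases "v \<in> ?A ` {?t..<p}")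
        case True
        then have e: "ds' = ds" by (simp add: ds'_def)
        show ?thesis
          using r9 True r st(1) v tn N BN
          apply (simp add: wp_simps)
          apply (rule Q[of _ ds'])
          using 1 2 ds tk st(3) by (auto simp: e)
      next
        case False
        then have e: "ds' = ds @ [v]" by (simp add: ds'_def)
        show ?thesis
          using r9 False r st(1) v tn N BN
          apply (simp add: wp_simps)
          apply (rule Q[of _ ds'])
          using 1 2 ds tk st(3) by (auto simp: e)
      qed
    qed
    done
qed

lemma wp_TOP:
  assumes g: "ginv (dl (w # D)) (arr s)" and D: "distinct (w # D)" "set (w # D) \<subseteq> {..<n}"
    and r: "reg s 14 = n" "reg s 11 = v" "v < n"
    and Q: "\<And>s'. arr s' = arr s \<Longrightarrow> frame 11 s s' \<Longrightarrow> reg s' 8 = w \<Longrightarrow>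
      (reg s' 4 > 0 \<longleftrightarrow> w \<noteq> v) \<Longrightarrow> ticks s' = ticks s + 7 \<Longrightarrow> Q s'"
  shows "wp N B TOP Q s"
proof -
  let ?A = "arr s"
  note gn = ginvD[OF g order.refl]
  have dn: "?A 0 n = n - Suc (length D)" "Suc (length D) \<le> n" using degree_n[OF g D(2,1)] by auto
  have ln: "length (L n) = n" using distinct_card[OF distinct_L[of n]] L_n by simp
  have j: "?A 0 n < length (L n)" using dn ln by simp
  have "seg ?A n ! ?A 0 n = hd (drop (?A 0 n) (seg ?A n))" using j by (simp add: hd_drop_conv_nth)
  also have "\<dots> = w" using gn(3) dl_n[OF D(2)] by simp
  finally have w: "?A 2 (off n + ?A 0 n) = w" using j by (simp add: nth_seg)
  have "off n + ?A 0 n < N" using off_N[of n] j by simp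
  moreover have "w < n" using D by simp
  moreover then have "w - v + (v - w) \<le> B" using r(3) BN by arith
  ultimately show ?thesis
    unfolding TOP_def using gn(1) r w N BN
    apply (simp add: wp_simps)
    apply (rule Q)
    by (auto simp: frame_def)
qed

lemma wp_UP:
  assumes g: "ginv (dl (E @ v # D)) (arr s)"
    and D: "distinct (E @ v # D)" "set (E @ v # D) \<subseteq> {..<n}"
    and r: "reg s 14 = n" "reg s 15 = Suc t" "arr s 3 t = v" "t < N"
    and M: "Suc n - length D \<le> M"
    and Q: "\<And>s'. ginv (dl (v # D)) (arr s') \<Longrightarrow> arr s' 3 = arr s 3 \<Longrightarrow> inp s' = inp s \<Longrightarrow>
      outp s' = outp s \<Longrightarrow> reg s' 15 = t \<Longrightarrow> (\<And>r. r \<ge> 14 \<Longrightarrow> r \<noteq> 15 \<Longrightarrow> reg s' r = reg s r) \<Longrightarrow>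
      ticks s' \<le> ticks s + 11 + (11 + 8 * M) * length E \<Longrightarrow> Q s'"
  shows "wp N B UP Q s"
proof -
  have vn: "v < n" using D by simp
  define s0 where "s0 = s\<lparr>reg := (reg s)(0 := 1, 15 := t, 11 := v), ticks := ticks s + 3\<rparr>"
  define I where "I m st \<longleftrightarrow> (\<exists>E' w D'. E' @ v # D = w # D' \<and> length E' = m \<and>
      distinct (E' @ v # D) \<and> set (E' @ v # D) \<subseteq> {..<n} \<and>
      ginv (dl (E' @ v # D)) (arr st) \<and> frame 11 s0 st \<and> reg st 8 = w \<and>
      (reg st 4 > 0 \<longleftrightarrow> w \<noteq> v) \<and>
      ticks st + (11 + 8 * M) * m \<le> ticks s0 + 7 + (11 + 8 * M) * length E)" for m st
  \<comment> \<open>\<open>TOP\<close> ends each round and also precedes the loop, so one claim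
    about it yields the invariant in both places.\<close>
  have init: "wp N B TOP (I (length E')) st" if "ginv (dl (E' @ v # D)) (arr st)"
    "distinct (E' @ v # D)" "set (E' @ v # D) \<subseteq> {..<n}" "frame 11 s0 st"
    "ticks st + (11 + 8 * M) * length E' \<le> ticks s0 + (11 + 8 * M) * length E" for E' st
  proof -
    obtain w D' where wD: "E' @ v # D = w # D'" by (cases E') auto
    have "reg st 14 = n" "reg st 11 = v" using that r by (auto simp: frame_def s0_def)
    then show ?thesis
      apply (rule wp_TOP[where w = w and D = D', rotated 3])
      subgoal using vn by simp
      subgoal for s'
        unfolding I_def
        apply (rule exI[of _ E'], rule exI[of _ w], rule exI[of _ D'])
        using that wD by (simp add: frame_def)
      using that wD by simp_all
  qed
  have step: "0 < m \<and> wp N B (UNDO ;; TOP) (I (m - 1)) (tick st)"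
    if I: "I m st" and pos: "reg st 4 > 0" for m st
  proof -
    obtain E' w D' where E: "E' @ v # D = w # D'" "length E' = m"
      "distinct (E' @ v # D)" "set (E' @ v # D) \<subseteq> {..<n}"
      "ginv (dl (E' @ v # D)) (arr st)" "frame 11 s0 st" "reg st 8 = w" "reg st 4 > 0 \<longleftrightarrow> w \<noteq> v"
      "ticks st + (11 + 8 * M) * m \<le> ticks s0 + 7 + (11 + 8 * M) * length E"
      using I unfolding I_def by (elim exE conjE) (rule that)
    then have "w \<noteq> v" using E(8) pos by simp
    then obtain E'' where E'': "E' = w # E''" using E(1) by (cases E') auto
    have "wp N B UNDO (wp N B TOP (I (length E''))) (tick st)"
      apply (rule wp_UNDO_dl[where w = w and D = "E'' @ v # D" and M = M])
      subgoal using E E'' by simp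
      subgoal using E E'' by simp
      subgoal using E E'' by simp
      subgoal using E by simp
      subgoal using M by simp
      subgoal for s'
        apply (rule init)
        using E E'' by (auto simp: frame_def)
      done
    then show ?thesis using E E'' by (auto simp: wp_simps)
  qed
  have fin: "Q (tick st)" if I: "I m st" and pos: "reg st 4 = 0" for m st
  proof -
    obtain E' w D' where E: "E' @ v # D = w # D'" "length E' = m" "distinct (E' @ v # D)"
      "ginv (dl (E' @ v # D)) (arr st)" "frame 11 s0 st" "reg st 4 > 0 \<longleftrightarrow> w \<noteq> v"
      "ticks st + (11 + 8 * M) * m \<le> ticks s0 + 7 + (11 + 8 * M) * length E"
      using I unfolding I_def by (elim exE conjE) (rule that)
    have "w = v" using E(6) pos by simp
    \<comment> \<open>Otherwise \<open>v\<close> would be the head of \<open>E'\<close> and occur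
      again behind it, against distinctness.\<close>
    then have "E' = []" using E(1,3) by (cases E') auto
    then show ?thesis using E by (intro Q) (auto simp: frame_def s0_def)
  qed
  have "wp N B TOP (I (length E)) s0"
    by (rule init) (use g D in \<open>auto simp: frame_def s0_def\<close>)
  then have "wp N B TOP (wp N B (WHILE 4 (UNDO ;; TOP)) Q) s0"
    by (rule wp_mono) (rule wp_while_inv[where I = I], use step fin in auto)
  moreover have "s\<lparr>reg := (reg s)(0 := 1, 15 := t, 11 := v),
      ticks := Suc (Suc (Suc (ticks s)))\<rparr> = s0"
    by (simp add: s0_def)
  ultimately show ?thesis
    unfolding UP_def using BN r by (simp add: wp_simps)
qed

end

subsection \<open>The main loop\<close>

text \<open>The degree of \<open>n\<close> is the number of remaining vertices. No return addresses
  are needed: an exhausted graph ends the call of the vertex on top of the solution, and the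
  outermost loop if the solution is empty.\<close>

definition STEP :: com where
  "STEP = GET 4 0 14 ;; IF 4 (PICK ;; EMIT ;; IMM 0 0 ;; ADD 8 11 0 ;; DEL ;; NBRS) (IF 15 UP (IMM 17 0))"

definition LOOP :: com where
  "LOOP = WHILE 17 STEP"

text \<open>Ties are broken by the position in the numbering of the vertices.  The choice from a set that
  does not meet the numbering only serves to make this a minimum degree rule for every \<open>vs\<close>.\<close>

definition least_pick :: "'a list \<Rightarrow> 'a graph \<Rightarrow> 'a" where
  "least_pick vs G =
    (let M = {v \<in> verts G. \<forall>u\<in>verts G. degree G v \<le> degree G u} in
     if M \<inter> set vs = {} then SOME v. v \<in> M
     else vs ! (LEAST i. i < length vs \<and> vs ! i \<in> M))"

lemma min_degree_rule_least_pick: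
  fixes vs :: "'a list"
  shows "min_degree_rule (least_pick vs)"
  unfolding min_degree_rule_def
proof (intro allI impI)
  fix G :: "'a graph"
  assume G: "finite_simple_graph G \<and> verts G \<noteq> {}"
  define M where "M = {v \<in> verts G. \<forall>u\<in>verts G. degree G v \<le> degree G u}"
  have "\<exists>v. v \<in> M"
  proof -
    obtain x where x: "x \<in> verts G" using G by auto
    show ?thesis
      using arg_min_natI[of "\<lambda>v. v \<in> verts G" x "degree G"]
        arg_min_nat_le[of "\<lambda>v. v \<in> verts G" _ "degree G"] x by (auto simp: M_def)
  qed
  moreover have "vs ! (LEAST i. i < length vs \<and> vs ! i \<in> M) \<in> M" if meet: "M \<inter> set vs \<noteq> {}"
  proof -
    obtain x where x: "x \<in> M" "x \<in> set vs" using meet by auto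
    obtain i where "i < length vs" "vs ! i = x" using x(2) unfolding in_set_conv_nth by blast
    then have "i < length vs \<and> vs ! i \<in> M" using x(1) by simp
    from LeastI[of "\<lambda>i. i < length vs \<and> vs ! i \<in> M", OF this] show ?thesis by simp
  qed
  ultimately have "least_pick vs G \<in> M"
    unfolding least_pick_def Let_def M_def[symmetric] by (auto intro: someI)
  then show "least_pick vs G \<in> verts G \<and> (\<forall>u\<in>verts G. degree G (least_pick vs G) \<le> degree G u)"
    by (simp add: M_def)
qed

section \<open>Printed differences of concatenated lists of solutions\<close>

lemma prints_differences_Cons:
  assumes "distinct ds" "set ds \<subseteq> {..<length vs}" "(!) vs ` set ds = sym_diff prev S"
    and "prints_differences vs S Ss rest"
  shows "prints_differences vs prev (S # Ss) (map Suc ds @ 0 # rest)"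
  unfolding prints_differences.simps
  apply (rule exI[of _ ds])
  apply (rule exI[of _ rest])
  using assms apply simp
  done

lemma prints_differences_append:
  "prints_differences vs prev Ss out \<Longrightarrow> prints_differences vs (last (prev # Ss)) Ss' out' \<Longrightarrow>
    prints_differences vs prev (Ss @ Ss') (out @ out')"
proof (induction Ss arbitrary: prev out)
  case (Cons S Ss)
  then obtain ds rest where "out = map Suc ds @ 0 # rest" "distinct ds" "set ds \<subseteq> {..<length vs}"
    "(\<lambda>i. vs ! i) ` set ds = sym_diff prev S" "prints_differences vs S Ss rest" by auto
  moreover have "prints_differences vs (last (S # Ss)) Ss' out'" using Cons.prems(2) by simp
  ultimately show ?case using Cons.IH[of S rest]
    apply simp
    apply (rule exI[of _ ds], rule exI[of _ "rest @ out'"])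
    apply simp
    done
qed simp

lemma image_sym_diff:
  assumes "inj_on f A" "P \<subseteq> A" "Q \<subseteq> A"
  shows "f ` sym_diff P Q = sym_diff (f ` P) (f ` Q)"
proof -
  have "P - Q \<subseteq> A" "Q - P \<subseteq> A" using assms by auto
  then show ?thesis
    using assms by (simp add: image_Un inj_on_image_set_diff[OF assms(1)])
qed

section \<open>EIS on induced subgraphs given by vertex numbers\<close>

locale eis_layout = layout n L N B off
  for n :: nat and L :: "nat \<Rightarrow> nat list" and N B :: nat and off :: "nat \<Rightarrow> nat" +
  fixes G :: "'a graph" and vs :: "'a list"
  assumes simple: "finite_simple_graph G"
    and vs: "distinct vs" "set vs = verts G" "length vs = n"
    and L_edges: "u < n \<Longrightarrow> set (L u) = insert n {j. j < n \<and> {vs ! u, vs ! j} \<in> edges G}"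
begin

definition ind :: "nat set \<Rightarrow> 'a graph" where
  "ind X = \<lparr>verts = (!) vs ` X, edges = {e \<in> edges G. e \<subseteq> (!) vs ` X}\<rparr>"

lemma verts_ind: "verts (ind X) = (!) vs ` X"
  by (simp add: ind_def)

lemma inj_vs: "inj_on ((!) vs) {..<n}"
  using inj_on_nth[OF vs(1), of "{..<n}"] vs(3) by auto

lemma ind_full: "ind {..<n} = G"
proof -
  have "(!) vs ` {..<n} = verts G" using vs by (auto simp: set_conv_nth)
  moreover have "{e \<in> edges G. e \<subseteq> verts G} = edges G"
    using simple by (auto simp: finite_simple_graph_def simple_graph_def)
  ultimately show ?thesis by (simp add: ind_def)
qed

lemma finite_simple_ind: "X \<subseteq> {..<n} \<Longrightarrow> finite_simple_graph (ind X)"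
  using simple finite_subset[of X "{..<n}"]
  by (auto simp: finite_simple_graph_def simple_graph_def ind_def)

lemma delete_ind:
  assumes "X \<subseteq> {..<n}" "Y \<subseteq> {..<n}"
  shows "delete_verts (ind X) ((!) vs ` Y) = ind (X - Y)"
proof -
  have "(!) vs ` X - (!) vs ` Y = (!) vs ` (X - Y)"
    using inj_on_image_set_diff[OF inj_vs, of X Y] assms by auto
  then show ?thesis by (auto simp: delete_verts_def ind_def)
qed

lemma nbrs_ind:
  assumes X: "X \<subseteq> {..<n}" and v: "v \<in> X"
  shows "nbrs (ind X) (vs ! v) = (!) vs ` (set (L v) \<inter> X)"
proof -
  have "v < n" using X v by auto
  then have "set (L v) \<inter> X = {j \<in> X. {vs ! v, vs ! j} \<in> edges G}"
    using L_edges[of v] X by auto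
  then show ?thesis using v by (auto simp: nbrs_def ind_def insert_commute)
qed

lemma degree_ind:
  assumes X: "X \<subseteq> {..<n}" and v: "v \<in> X"
  shows "degree (ind X) (vs ! v) = card (set (L v) \<inter> X)"
proof -
  have "inj_on ((!) vs) (set (L v) \<inter> X)" by (rule inj_on_subset[OF inj_vs]) (use X in auto)
  then show ?thesis unfolding degree_def nbrs_ind[OF assms] by (rule card_image)
qed

text \<open>Minimality of degree and number in lexicographic order, which \<open>wp_PICK\<close>
  delivers, determines the vertex uniquely; so the machine follows the abstract rule. The extra
  vertex shifts all degrees alike and does not affect the comparison.\<close>

lemma least_pick_ind:
  assumes X: "X \<subseteq> {..<n}" and v: "v \<in> X"
    and le: "\<And>u. u \<in> X \<Longrightarrow> card (set (L v) \<inter> X) < card (set (L u) \<inter> X) \<or>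
      card (set (L v) \<inter> X) = card (set (L u) \<inter> X) \<and> v \<le> u"
  shows "least_pick vs (ind X) = vs ! v"
proof -
  let ?d = "\<lambda>u. card (set (L u) \<inter> X)"
  define M where "M = {x \<in> verts (ind X). \<forall>y\<in>verts (ind X). degree (ind X) x \<le> degree (ind X) y}"
  have M: "vs ! i \<in> M \<longleftrightarrow> i \<in> X \<and> (\<forall>u\<in>X. ?d i \<le> ?d u)" if "i < n" for i
  proof -
    have "vs ! i \<in> (!) vs ` X \<longleftrightarrow> i \<in> X" using inj_on_image_mem_iff[OF inj_vs, of i X] that X by auto
    moreover have "vs ! i \<in> M \<longleftrightarrow> vs ! i \<in> (!) vs ` X \<and>
        (\<forall>u\<in>X. degree (ind X) (vs ! i) \<le> degree (ind X) (vs ! u))"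
      by (simp add: M_def verts_ind)
    ultimately show ?thesis by (simp add: degree_ind[OF X] cong: conj_cong)
  qed
  have vn: "v < n" using X v by auto
  have vM: "vs ! v \<in> M" using M[OF vn] le v by force
  then have "M \<inter> set vs \<noteq> {}" using vn vs(3) by auto
  moreover have "(LEAST i. i < length vs \<and> vs ! i \<in> M) = v"
  proof (rule Least_equality)
    show "v < length vs \<and> vs ! v \<in> M" using vn vs(3) vM by simp
    fix i assume "i < length vs \<and> vs ! i \<in> M"
    then have "i \<in> X" "?d i \<le> ?d v" using M vs(3) v by auto
    then show "v \<le> i" using le[of i] by auto
  qed
  ultimately show ?thesis unfolding least_pick_def Let_def M_def[symmetric] by simp
qed

lemma eis_loop_ind:
  assumes X: "X \<subseteq> {..<n}" and v: "v \<in> X"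
    and le: "\<And>u. u \<in> X \<Longrightarrow> card (set (L v) \<inter> X) < card (set (L u) \<inter> X) \<or>
      card (set (L v) \<inter> X) = card (set (L u) \<inter> X) \<and> v \<le> u"
  shows "eis_loop (least_pick vs) (ind X) S = insert (vs ! v) S #
    eis_loop (least_pick vs) (ind (X - insert v (set (L v)))) (insert (vs ! v) S) @
    eis_loop (least_pick vs) (ind (X - {v})) S"
proof -
  have p: "least_pick vs (ind X) = vs ! v" by (rule least_pick_ind[OF assms])
  have "closed_nbrs (ind X) (vs ! v) = (!) vs ` insert v (set (L v) \<inter> X)"
    by (simp add: closed_nbrs_def nbrs_ind[OF X v])
  moreover have "X - insert v (set (L v) \<inter> X) = X - insert v (set (L v))" by auto
  ultimately have 1: "delete_verts (ind X) (closed_nbrs (ind X) (vs ! v)) = ind (X - insert v (set (L v)))"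
    using delete_ind[OF X, of "insert v (set (L v) \<inter> X)"] X v by auto
  have 2: "delete_verts (ind X) {vs ! v} = ind (X - {v})"
    using delete_ind[OF X, of "{v}"] X v by auto
  have "verts (ind X) \<noteq> {}" "finite (verts (ind X))" "vs ! v \<in> verts (ind X)"
    using v finite_simple_ind[OF X] by (auto simp: ind_def finite_simple_graph_def)
  then show ?thesis by (subst eis_loop_unfold) (simp add: p 1 2)
qed

lemma eis_loop_ind_empty: "eis_loop (least_pick vs) (ind {}) S = []"
  by (subst eis_loop_unfold) (simp add: ind_def)

text \<open>\<open>D\<close> lists the deleted vertices and \<open>T\<close> the current solution; the stack cells below
  register 16 still hold the solution that was printed last.\<close>

definition minv :: "nat list \<Rightarrow> nat list \<Rightarrow> state \<Rightarrow> bool" where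
  "minv D T s \<longleftrightarrow> distinct D \<and> set D \<subseteq> {..<n} \<and> ginv (dl D) (arr s) \<and> set T \<subseteq> set D \<and>
    reg s 14 = n \<and> reg s 15 = length T \<and> length T \<le> reg s 16 \<and> reg s 17 = 1 \<and>
    map (arr s 3) [0..<length T] = T \<and> distinct (map (arr s 3) [0..<reg s 16]) \<and>
    (\<forall>j<reg s 16. arr s 3 j < n)"

definition prev :: "state \<Rightarrow> 'a set" where
  "prev s = (!) vs ` arr s 3 ` {..<reg s 16}"

lemma minv_tick [simp]: "minv D T (tick s) = minv D T s"
  by (simp add: minv_def)

lemma minv_n: "minv D T s \<Longrightarrow> arr s 0 n = n - length D \<and> length D \<le> n"
  using degree_n by (auto simp: minv_def)

text \<open>\<open>a + 2\<close> counts the \<open>a + 1\<close> remaining vertices and the extra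
  one, and bounds all degrees. With \<open>M = a + 2\<close>, the coefficient
  \<open>42 + 24 * M + 7 * M * M\<close> adds up \<open>15\<close> for \<open>PICK\<close>,
  \<open>17 + 7 * M\<close> for \<open>DEL\<close> and \<open>10 + (17 + 7 * M) * M\<close> for
  \<open>NBRS\<close>.\<close>

lemma wp_STEP_down:
  assumes m: "minv D T s" and D: "n - length D = Suc a"
    and Q: "\<And>s' v E ds. v < n \<Longrightarrow> v \<notin> set D \<Longrightarrow>
      (\<And>u. u < n \<Longrightarrow> u \<notin> set D \<Longrightarrow> card (set (L v) - set D) < card (set (L u) - set D) \<or>
         card (set (L v) - set D) = card (set (L u) - set D) \<and> v \<le> u) \<Longrightarrow>
      set E = set (L v) - {n} - set D \<Longrightarrow> minv (E @ v # D) (T @ [v]) s' \<Longrightarrow>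
      reg s' 16 = length T + 1 \<Longrightarrow>
      outp s' = outp s @ map Suc ds @ [0] \<Longrightarrow> distinct ds \<Longrightarrow>
      set ds = sym_diff (arr s 3 ` {..<reg s 16}) (insert v (set T)) \<Longrightarrow> set ds \<subseteq> {..<n} \<Longrightarrow>
      ticks s' + 11 * reg s' 16 \<le> ticks s + 11 * reg s 16 + 45 +
        (42 + 24 * (a + 2) + 7 * (a + 2) * (a + 2)) * (a + 2) \<Longrightarrow> Q s'"
  shows "wp N B STEP Q s"
proof -
  define M where "M = a + 2"
  have mD: "distinct D" "set D \<subseteq> {..<n}" "ginv (dl D) (arr s)" "set T \<subseteq> set D"
    and r: "reg s 14 = n" "reg s 15 = length T" "length T \<le> reg s 16" "reg s 17 = 1"
    and st: "map (arr s 3) [0..<length T] = T" "distinct (map (arr s 3) [0..<reg s 16])"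
    "\<And>j. j < reg s 16 \<Longrightarrow> arr s 3 j < n"
    using m by (auto simp: minv_def)
  have M: "Suc n - length D \<le> M" using D by (simp add: M_def)
  have len: "length D < n" "n - length D \<le> M" using D by (simp_all add: M_def)
  have dn: "arr s 0 n = Suc a" using minv_n[OF m] D by simp
  have dT: "distinct T"
    using st(2) r(3) distinct_take[OF st(2), of "length T"] st(1) by (simp add: take_map)
  show ?thesis
    unfolding STEP_def
    using N BN r dn
    apply (simp add: wp_simps)
    apply (rule wp_PICK[where D = D])
    subgoal using mD by simp
    subgoal using mD by simp
    subgoal using mD by simp
    subgoal using len by simp
    subgoal by simp
    subgoal for s1 v
      apply (simp only: wp_simps(9))
      apply (rule wp_EMIT[where T = T and v = v and p = "reg s 16"])
      subgoal by (simp add: frame_def)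
      subgoal by (simp add: frame_def)
      subgoal by (simp add: frame_def)
      subgoal using st(1) by simp
      subgoal using st(2) by simp
      subgoal using st(3) by simp
      subgoal by simp
      subgoal by simp
      subgoal using mD by auto
      subgoal for s2 ds
        apply (simp add: wp_simps)
        apply (rule wp_DEL_dl[where D = D and w = v and M = M])
        subgoal using mD(3) by (simp add: ginv_def seg_def)
        subgoal using mD by simp
        subgoal using mD by simp
        subgoal by simp
        subgoal by (rule M)
        subgoal for s3
          apply (rule wp_NBRS[where D = D and v = v and M = M])
          subgoal by simp
          subgoal using mD by simp
          subgoal using mD by simp
          subgoal by (simp add: frame_def)
          subgoal by (simp add: frame_def)
          subgoal by (rule M)
          subgoal premises P for s4 E
          proof -
            have vn: "v < n" and vD: "v \<notin> set D" by (rule P)+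
            have E: "ginv (dl (E @ v # D)) (arr s4)" "distinct (E @ v # D)"
              "set E = set (L v) - {n} - set D" by (rule P)+
            have ds: "distinct ds" "set ds = sym_diff (arr s 3 ` {..<reg s 16}) (insert v (set T))"
              by (rule P)+
            have A: "arr s4 3 = (arr s 3)(length T := v)" using P by (simp add: frame_def)
            have R: "reg s4 14 = n" "reg s4 15 = length T + 1" "reg s4 16 = length T + 1"
              "reg s4 17 = 1" using P by (simp_all add: frame_def)
            have O: "outp s4 = outp s @ map Suc ds @ [0]" using P by (simp add: frame_def)
            have "15 * (n - length D) \<le> 15 * M" using len by simp
            then have tk: "ticks s4 + 11 * reg s4 16 \<le> ticks s + 11 * reg s 16 + 45 +
                (42 + 24 * M + 7 * M * M) * M"
              using P R by (simp add: algebra_simps)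
            have le: "card (set (L v) - set D) < card (set (L u) - set D) \<or>
              card (set (L v) - set D) = card (set (L u) - set D) \<and> v \<le> u"
              if u: "u < n" "u \<notin> set D" for u
            proof -
              have "arr s 0 v < arr s 0 u \<or> arr s 0 v = arr s 0 u \<and> v \<le> u"
                using P(12)[OF u] by simp
              moreover have "arr s 0 u = card (set (L u) - set D)" "arr s 0 v = card (set (L v) - set D)"
                using degree_alive(1)[OF mD(3,2)] u vn vD by auto
              ultimately show ?thesis by simp
            qed
            have En: "set E \<subseteq> {..<n}" using E(3) L_le[of v] vn by fastforce
            have dTv: "distinct (T @ [v])" using dT mD(4) vD by auto
            have Tn: "set T \<subseteq> {..<n}" using mD by auto
            have st4: "map (arr s4 3) [0..<Suc (length T)] = T @ [v]"
              using st(1) by (simp add: A)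
            have m4: "minv (E @ v # D) (T @ [v]) s4"
              unfolding minv_def
            proof (intro conjI)
              show "\<forall>j<reg s4 16. arr s4 3 j < n"
                using R(3) vn st(3) r(3) by (simp add: A)
              show "distinct (map (arr s4 3) [0..<reg s4 16])"
                using st4 dTv R(3) by (metis Suc_eq_plus1)
            qed (use E R mD(1,2,4) En vn dTv st4 in auto)
            show ?thesis
              by (rule Q[OF vn vD le E(3) m4 R(3) O ds]) (use ds(2) Tn st(3) vn tk in
                  \<open>auto simp: M_def\<close>)
          qed
          done
        done
      done
    done
qed

text \<open>Only the height in register 15 drops. The popped cell and register 16 stay, because the
  next output is computed from the solution printed last.\<close>

lemma wp_STEP_up:
  assumes m: "minv (E @ v # D) (T @ [v]) s" and full: "length (E @ v # D) = n"
    and TD: "set T \<subseteq> set D"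
    and Q: "\<And>s'. minv (v # D) T s' \<Longrightarrow> outp s' = outp s \<Longrightarrow> reg s' 16 = reg s 16 \<Longrightarrow>
      arr s' 3 = arr s 3 \<Longrightarrow>
      ticks s' \<le> ticks s + 14 + (11 + 8 * (Suc n - length D)) * length E \<Longrightarrow> Q s'"
  shows "wp N B STEP Q s"
proof -
  have mD: "distinct (E @ v # D)" "set (E @ v # D) \<subseteq> {..<n}" "ginv (dl (E @ v # D)) (arr s)"
    and T: "set (T @ [v]) \<subseteq> set (E @ v # D)"
    and r: "reg s 14 = n" "reg s 15 = Suc (length T)" "Suc (length T) \<le> reg s 16" "reg s 17 = 1"
    and st: "map (arr s 3) [0..<Suc (length T)] = T @ [v]" "distinct (map (arr s 3) [0..<reg s 16])"
    "\<And>j. j < reg s 16 \<Longrightarrow> arr s 3 j < n"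
    using m by (auto simp: minv_def)
  have vn: "v < n" and D: "distinct (v # D)" "set (v # D) \<subseteq> {..<n}" using mD by auto
  have A: "map (arr s 3) [0..<length T] = T" "arr s 3 (length T) = v" using st(1) by auto
  have dn: "arr s 0 n = 0" using minv_n[OF m] full by simp
  have "take (Suc (length T)) (map (arr s 3) [0..<reg s 16]) = T @ [v]"
    using st(1) r(3) by (simp add: take_map)
  then have "distinct (T @ [v])" using distinct_take[OF st(2)] by metis
  then have "length T = card (set T)" by (simp add: distinct_card)
  also have "\<dots> \<le> card {..<n}" using T mD by (intro card_mono) auto
  finally have tN: "length T < N" using N by simp
  show ?thesis
    unfolding STEP_def
    using N BN r dn
    apply (simp add: wp_simps)
    apply (rule wp_UP[where E = E and v = v and D = D and t = "length T" and M = "Suc n - length D"])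
    subgoal using mD by simp
    subgoal using mD by simp
    subgoal using mD by simp
    subgoal by simp
    subgoal by simp
    subgoal using A by simp
    subgoal using tN by simp
    subgoal by simp
    subgoal for s'
      apply (rule Q)
      subgoal using A D TD st by (auto simp: minv_def)
      by auto
    done
qed


section \<open>The recursion in continuation form and its potential\<close>

definition sols :: "nat list \<Rightarrow> nat list \<Rightarrow> 'a set list" where
  "sols D T = eis_loop (least_pick vs) (ind ({..<n} - set D)) ((!) vs ` set T)"

lemma card_alive_n:
  assumes "set D \<subseteq> {..<n}" "u < n"
  shows "card (set (L u) - set D) = Suc (card (set (L u) \<inter> ({..<n} - set D)))"
proof -
  have "set (L u) - set D = insert n (set (L u) \<inter> ({..<n} - set D))"
    using assms L_edges[of u] by auto
  then show ?thesis by simp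
qed

lemma sols_unfold:
  assumes D: "set D \<subseteq> {..<n}" and v: "v < n" "v \<notin> set D"
    and le: "\<And>u. u < n \<Longrightarrow> u \<notin> set D \<Longrightarrow> card (set (L v) - set D) < card (set (L u) - set D) \<or>
         card (set (L v) - set D) = card (set (L u) - set D) \<and> v \<le> u"
    and E: "set E = set (L v) - {n} - set D"
  shows "sols D T = (!) vs ` set (T @ [v]) # sols (E @ v # D) (T @ [v]) @ sols (v # D) T"
proof -
  let ?X = "{..<n} - set D"
  have "?X - insert v (set (L v)) = {..<n} - set (E @ v # D)" using E by auto
  moreover have "?X - {v} = {..<n} - set (v # D)" by auto
  moreover have "insert (vs ! v) ((!) vs ` set T) = (!) vs ` set (T @ [v])" by auto
  ultimately show ?thesis
    unfolding sols_def
    using eis_loop_ind[of ?X v "(!) vs ` set T"] le v card_alive_n[OF D] by simp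
qed

text \<open>The code is one flat loop where EIS is recursive, hence the continuation form: the run
  passes through a state in which all remaining vertices are deleted, \<open>T\<close> is again the
  current solution and \<open>sols D T\<close> has been printed; it suffices to finish from there.
  Both continuations of an iteration become instances of the induction hypothesis. The term
  \<open>(n - length D) ^ 4\<close> is time left unspent.\<close>

lemma wp_LOOP:
  assumes rec: "\<And>a b. a \<le> k * (b + 1) \<Longrightarrow> 200 * (a + 3) ^ 3 + (a + 1) ^ 4 \<le> C + b ^ 4 + a ^ 4"
    and size: "\<And>X v. X \<subseteq> {..<n} \<Longrightarrow> v \<in> X \<Longrightarrow>
      (\<And>u. u \<in> X \<Longrightarrow> card (set (L v) \<inter> X) \<le> card (set (L u) \<inter> X)) \<Longrightarrow>
      card X \<le> k * (card (X - insert v (set (L v))) + 1)"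
    and m: "minv D T s"
    and Q: "\<And>s' E out. minv (E @ D) T s' \<Longrightarrow> length (E @ D) = n \<Longrightarrow> outp s' = outp s @ out \<Longrightarrow>
      prints_differences vs (prev s) (sols D T) out \<Longrightarrow> prev s' = last (prev s # sols D T) \<Longrightarrow>
      ticks s' + 11 * reg s' 16 + (n - length D) ^ 4
        \<le> ticks s + 11 * reg s 16 + C * length (sols D T) \<Longrightarrow> wp N B LOOP Q s'"
  shows "wp N B LOOP Q s"
  using m Q
proof (induction "n - length D" arbitrary: D T s rule: less_induct)
  case less
  note m = less.prems(1)
  have mD: "distinct D" "set D \<subseteq> {..<n}" "set T \<subseteq> set D" and r: "reg s 17 = 1"
    using m by (auto simp: minv_def)
  have Dn: "length D \<le> n" using minv_n[OF m] by simp
  show ?case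
  proof (cases "n - length D")
    case 0
    then have "card (set D) = card {..<n}" using Dn mD(1) by (simp add: distinct_card)
    then have "set D = {..<n}" using mD(2) by (intro card_subset_eq) auto
    then have "sols D T = []" by (simp add: sols_def eis_loop_ind_empty)
    then show ?thesis using less.prems(2)[of "[]" s "[]"] m 0 Dn by simp
  next
    case (Suc a)
    have "wp N B STEP (wp N B LOOP Q) (tick s)"
    proof (rule wp_STEP_down[where D = D and T = T and a = a])
      show "minv D T (tick s)" using m by simp
      show "n - length D = Suc a" by (rule Suc)
      fix s1 v E ds
      assume v: "v < n" "v \<notin> set D"
        and le: "\<And>u. u < n \<Longrightarrow> u \<notin> set D \<Longrightarrow>
          card (set (L v) - set D) < card (set (L u) - set D) \<or>
          card (set (L v) - set D) = card (set (L u) - set D) \<and> v \<le> u"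
        and E: "set E = set (L v) - {n} - set D"
        and m1: "minv (E @ v # D) (T @ [v]) s1"
        and p1: "reg s1 16 = length T + 1"
        and out1: "outp s1 = outp (tick s) @ map Suc ds @ [0]"
        and ds: "distinct ds" "set ds = sym_diff (arr (tick s) 3 ` {..<reg (tick s) 16}) (insert v (set T))"
          "set ds \<subseteq> {..<n}"
        and t1: "ticks s1 + 11 * reg s1 16 \<le> ticks (tick s) + 11 * reg (tick s) 16 + 45 +
          (42 + 24 * (a + 2) + 7 * (a + 2) * (a + 2)) * (a + 2)"
      define A where "A = sols (E @ v # D) (T @ [v])"
      define A' where "A' = sols (v # D) T"
      define b where "b = n - length (E @ v # D)"
      have sols: "sols D T = (!) vs ` set (T @ [v]) # A @ A'"
        unfolding A_def A'_def by (rule sols_unfold[OF mD(2) v _ E]) (rule le)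
      have ab: "200 * (a + 3) ^ 3 + (a + 1) ^ 4 \<le> C + b ^ 4 + a ^ 4"
      proof (rule rec)
        let ?X = "{..<n} - set D"
        have X: "card ?X = Suc a" using Suc mD by (simp add: card_Diff_subset distinct_card)
        have d: "distinct (E @ v # D)" "set (E @ v # D) \<subseteq> {..<n}" using m1 by (auto simp: minv_def)
        have "?X - insert v (set (L v)) = {..<n} - set (E @ v # D)" using E by auto
        also have "card \<dots> = b"
          unfolding b_def distinct_card[OF d(1), symmetric]
          by (subst card_Diff_subset) (use d(2) in auto)
        finally have "card ?X \<le> k * (b + 1)"
          using size[of ?X v] v le card_alive_n[OF mD(2)] by force
        then show "a \<le> k * (b + 1)" using X by simp
      qed
      show "wp N B LOOP Q s1"
      proof (rule less.hyps[OF _ m1])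
        show "n - length (E @ v # D) < n - length D" using Suc by simp
        fix s2 E2 out2
        assume m2: "minv (E2 @ E @ v # D) (T @ [v]) s2" and full: "length (E2 @ E @ v # D) = n"
          and out2: "outp s2 = outp s1 @ out2"
            "prints_differences vs (prev s1) (sols (E @ v # D) (T @ [v])) out2"
          and prev2: "prev s2 = last (prev s1 # sols (E @ v # D) (T @ [v]))"
          and t2: "ticks s2 + 11 * reg s2 16 + (n - length (E @ v # D)) ^ 4
            \<le> ticks s1 + 11 * reg s1 16 + C * length (sols (E @ v # D) (T @ [v]))"
        have lE: "length (E2 @ E) = a" using full Suc by simp
        have "wp N B STEP (wp N B LOOP Q) (tick s2)"
        proof (rule wp_STEP_up[where E = "E2 @ E" and v = v and D = D and T = T])
          show "minv ((E2 @ E) @ v # D) (T @ [v]) (tick s2)" using m2 by simp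
          show "length ((E2 @ E) @ v # D) = n" using full by simp
          show "set T \<subseteq> set D" by (rule mD)
          fix s3
          assume m3: "minv (v # D) T s3" and out3: "outp s3 = outp (tick s2)"
            and p3: "reg s3 16 = reg (tick s2) 16" "arr s3 3 = arr (tick s2) 3"
            and t3: "ticks s3 \<le> ticks (tick s2) + 14 + (11 + 8 * (Suc n - length D)) * length (E2 @ E)"
          have prev3: "prev s3 = prev s2" using p3 by (simp add: prev_def)
          show "wp N B LOOP Q s3"
          proof (rule less.hyps[OF _ m3])
            show "n - length (v # D) < n - length D" using Suc by simp
            fix s4 E4 out4
            assume m4: "minv (E4 @ v # D) T s4" and full4: "length (E4 @ v # D) = n"
              and out4: "outp s4 = outp s3 @ out4"
                "prints_differences vs (prev s3) (sols (v # D) T) out4"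
              and prev4: "prev s4 = last (prev s3 # sols (v # D) T)"
              and t4: "ticks s4 + 11 * reg s4 16 + (n - length (v # D)) ^ 4
                \<le> ticks s3 + 11 * reg s3 16 + C * length (sols (v # D) T)"
            have prev1: "prev s1 = (!) vs ` set (T @ [v])"
            proof -
              have "reg s1 16 = length (T @ [v])" using p1 by simp
              then have "map (arr s1 3) [0..<reg s1 16] = T @ [v]"
                using m1 unfolding minv_def by metis
              then have "set (T @ [v]) = set (map (arr s1 3) [0..<reg s1 16])" by simp
              also have "\<dots> = arr s1 3 ` {..<reg s1 16}" by (simp add: atLeast0LessThan)
              finally show ?thesis by (simp add: prev_def)
            qed
            show "wp N B LOOP Q s4"
            proof (rule less.prems(2)[of "E4 @ [v]" s4 "map Suc ds @ 0 # (out2 @ out4)"])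
              show "minv ((E4 @ [v]) @ D) T s4" "length ((E4 @ [v]) @ D) = n"
                using m4 full4 by simp_all
              show "outp s4 = outp s @ map Suc ds @ 0 # out2 @ out4"
                using out1 out2(1) out3 out4(1) by simp
              have "prints_differences vs ((!) vs ` set (T @ [v])) (A @ A') (out2 @ out4)"
                using prints_differences_append[OF out2(2)] out4(2) prev2 prev3 prev1
                by (simp add: A_def A'_def)
              moreover have "(\<lambda>i. vs ! i) ` set ds = sym_diff (prev s) ((!) vs ` set (T @ [v]))"
              proof -
                let ?P = "arr s 3 ` {..<reg s 16}" and ?Q = "set (T @ [v])"
                have P: "?P \<subseteq> {..<n}" "?Q \<subseteq> {..<n}" using m mD v by (auto simp: minv_def)
                have "set ds = sym_diff ?P ?Q" using ds(2) by auto
                then show ?thesis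
                  unfolding prev_def using image_sym_diff[OF inj_vs P] by metis
              qed
              moreover have "set ds \<subseteq> {..<length vs}" using ds(3) vs(3) by simp
              ultimately show "prints_differences vs (prev s) (sols D T)
                  (map Suc ds @ 0 # out2 @ out4)"
                using ds(1) unfolding sols by (intro prints_differences_Cons)
              show "prev s4 = last (prev s # sols D T)"
                unfolding sols using prev4 prev3 prev2 prev1 by (auto simp: A_def A'_def)
              have c: "C * length (sols D T) = C + C * length A + C * length A'"
                by (simp add: sols algebra_simps)
              have M: "Suc n - length D = a + 2" using Suc by simp
              define X1 where "X1 = (42 + 24 * (a + 2) + 7 * (a + 2) * (a + 2)) * (a + 2)"
              define X2 where "X2 = (11 + 8 * (a + 2)) * a"
              \<comment> \<open>The way down and the way up take at most \<open>46 + X1\<close> and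
                \<open>15 + X2\<close> ticks, loop tests included; 200 is a generous coefficient for
                this cubic.\<close>
              have "62 + X1 + X2 \<le> 200 * (a + 3) ^ 3"
                unfolding X1_def X2_def by (simp add: algebra_simps power_numeral_reduce)
              moreover have "ticks s3 \<le> ticks s2 + 15 + X2"
                using t3 unfolding M lE X2_def by simp
              moreover have "ticks s1 + 11 * reg s1 16 \<le> ticks s + 46 + 11 * reg s 16 + X1"
                using t1 unfolding X1_def[symmetric] by simp
              moreover have "n - length (v # D) = a" "reg s3 16 = reg s2 16"
                "n - length D = a + 1" using Suc p3 by simp_all
              \<comment> \<open>The first continuation leaves \<open>b ^ 4\<close> unspent, the
                second \<open>a ^ 4\<close>, and the output contributes \<open>C\<close>. By
                \<open>ab\<close> this pays for the iteration and leaves \<open>(a + 1) ^ 4\<close>;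
                the stack heights telescope.\<close>
              ultimately show "ticks s4 + 11 * reg s4 16 + (n - length D) ^ 4
                  \<le> ticks s + 11 * reg s 16 + C * length (sols D T)"
                using t2 t4[unfolded A'_def[symmetric]] ab
                unfolding c A_def[symmetric] b_def[symmetric] by simp
            qed
          qed
        qed
        then show "wp N B LOOP Q s2"
          using m2 unfolding LOOP_def by (subst wp_WHILE) (simp add: minv_def)
      qed
    qed
    then show ?thesis using r unfolding LOOP_def by (subst wp_WHILE) simp
  qed
qed

end

subsection \<open>Reading the input\<close>

definition ENTRIES :: com where
  "ENTRIES = WHILE 4 (READ 5 ;; PUT 2 2 5 ;; IMM 0 1 ;; ADD 2 2 0 ;; SUB 4 4 0)"

text \<open>\<open>PUT 2 2 14\<close> puts the extra vertex in front of the list, so the degree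
  stored is one more than the length read.\<close>

definition ROW :: com where
  "ROW = READ 4 ;; PUT 1 1 2 ;; PUT 2 2 14 ;; IMM 0 1 ;; ADD 2 2 0 ;; ADD 5 4 0 ;; PUT 0 1 5 ;;
    ENTRIES ;; IMM 0 1 ;; ADD 1 1 0 ;; SUB 3 3 0"

text \<open>The second loop writes the list of the extra vertex. \<open>PRINT 15\<close> emits the 0
  that ends an empty difference: the empty set is the first output of EIS, made before its loop
  starts.\<close>

definition READER :: com where
  "READER = READ 14 ;; IMM 1 0 ;; IMM 2 0 ;; IMM 0 0 ;; ADD 3 14 0 ;; WHILE 3 ROW ;;
    PUT 1 14 2 ;; PUT 0 14 14 ;; IMM 1 0 ;; IMM 0 0 ;; ADD 3 14 0 ;;
    WHILE 3 (PUT 2 2 1 ;; IMM 0 1 ;; ADD 1 1 0 ;; ADD 2 2 0 ;; SUB 3 3 0) ;;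
    IMM 15 0 ;; IMM 16 0 ;; PRINT 15 ;; IMM 17 1"

lemma wp_ENTRIES:
  assumes "reg s 4 = length js" "inp s = js @ rest" "reg s 2 = q" "q + length js < N" "N \<le> B"
    "\<forall>j\<in>set js. j \<le> B" "length js \<le> B" "1 \<le> B"
    and Q: "\<And>s'. reg s' 2 = q + length js \<Longrightarrow> inp s' = rest \<Longrightarrow> outp s' = outp s \<Longrightarrow>
      (\<And>r. r \<notin> {0,2,4,5} \<Longrightarrow> reg s' r = reg s r) \<Longrightarrow> (\<And>k. k \<noteq> 2 \<Longrightarrow> arr s' k = arr s k) \<Longrightarrow>
      (\<And>x. x < q \<Longrightarrow> arr s' 2 x = arr s 2 x) \<Longrightarrow>
      (\<And>j. j < length js \<Longrightarrow> arr s' 2 (q + j) = js ! j) \<Longrightarrow>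
      ticks s' = ticks s + 1 + 6 * length js \<Longrightarrow> Q s'"
  shows "wp N B ENTRIES Q s"
  using assms
proof (induction js arbitrary: s q)
  case Nil
  then show ?case unfolding ENTRIES_def by (subst wp_WHILE) simp
next
  case (Cons x js)
  define s1 where "s1 = s\<lparr>reg := (reg s)(5 := x, 0 := 1, 2 := q + 1, 4 := length js),
    inp := js @ rest, arr := (arr s)(2 := (arr s 2)(q := x)), ticks := ticks s + 6\<rparr>"
  have "wp N B ENTRIES Q s1"
  proof (rule Cons.IH[where q = "q + 1"])
    fix s' :: state
    assume *: "reg s' 2 = q + 1 + length js" "inp s' = rest" "outp s' = outp s1"
      "\<And>r. r \<notin> {0,2,4,5} \<Longrightarrow> reg s' r = reg s1 r" "\<And>k. k \<noteq> 2 \<Longrightarrow> arr s' k = arr s1 k"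
      "\<And>x. x < q + 1 \<Longrightarrow> arr s' 2 x = arr s1 2 x"
      "\<And>j. j < length js \<Longrightarrow> arr s' 2 (q + 1 + j) = js ! j"
      "ticks s' = ticks s1 + 1 + 6 * length js"
    show "Q s'"
    proof (rule Cons.prems(9))
      fix j assume j: "j < length (x # js)"
      show "arr s' 2 (q + j) = (x # js) ! j"
      proof (cases j)
        case 0
        then show ?thesis using *(6)[of q] by (simp add: s1_def)
      next
        case (Suc j')
        then have "q + j = q + 1 + j'" by simp
        then show ?thesis using *(7)[of j'] j Suc by (simp only:) simp
      qed
    qed (use * in \<open>auto simp: s1_def\<close>)
  qed (use Cons.prems(1-8) in \<open>auto simp: s1_def\<close>)
  moreover have "wp N B ENTRIES Q s =
      wp N B (READ 5 ;; PUT 2 2 5 ;; IMM 0 1 ;; ADD 2 2 0 ;; SUB 4 4 0) (wp N B ENTRIES Q) (tick s)"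
    unfolding ENTRIES_def by (subst wp_WHILE) (use Cons.prems in simp)
  moreover have "s\<lparr>inp := js @ rest, arr := (arr s)(2 := (arr s 2)(q := x)),
    reg := (reg s)(5 := x, 0 := 1, 2 := q + 1, 4 := length js),
    ticks := Suc (Suc (Suc (Suc (Suc (Suc (ticks s))))))\<rparr> = s1"
    by (simp add: s1_def)
  ultimately show ?case
    using Cons.prems(1-8) by (simp add: wp_simps)
qed

context layout
begin

lemma wp_ROW:
  assumes "i < n" "reg s 1 = i" "reg s 2 = off i" "reg s 14 = n" "L i = n # js"
    "inp s = length js # js @ rest"
    and Q: "\<And>s'. reg s' 1 = i + 1 \<Longrightarrow> reg s' 2 = off (Suc i) \<Longrightarrow> reg s' 3 = reg s 3 - 1 \<Longrightarrow>
      reg s' 14 = n \<Longrightarrow> inp s' = rest \<Longrightarrow> outp s' = outp s \<Longrightarrow>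
      arr s' 1 = (arr s 1)(i := off i) \<Longrightarrow> arr s' 0 = (arr s 0)(i := length js + 1) \<Longrightarrow>
      (\<And>x. x < off i \<Longrightarrow> arr s' 2 x = arr s 2 x) \<Longrightarrow>
      (\<And>j. j < length (L i) \<Longrightarrow> arr s' 2 (off i + j) = L i ! j) \<Longrightarrow>
      ticks s' = ticks s + 11 + 6 * length js \<Longrightarrow> Q s'"
  shows "wp N B ROW Q s"
proof -
  have o: "off i + length js + 1 < N" using off_N[of i] assms(1,5) by simp
  have js: "\<forall>j\<in>set js. j \<le> B" using L_le[of i] assms(1,5) BN by fastforce
  have oS: "off (Suc i) = off i + length js + 1" using assms(5) by (simp add: off_def)
  show ?thesis
    unfolding ROW_def
    using assms(1-6) o N BN
    apply (simp add: wp_simps)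
    apply (rule wp_ENTRIES[where js = js and rest = rest and q = "off i + 1"])
    subgoal by simp
    subgoal by simp
    subgoal by simp
    subgoal by simp
    subgoal by simp
    subgoal using js by simp
    subgoal by simp
    subgoal by simp
    subgoal premises P for s'
    proof -
      have a2: "arr s' 2 (off i) = n" "\<And>x. x < off i \<Longrightarrow> arr s' 2 x = arr s 2 x"
        "\<And>j. j < length js \<Longrightarrow> arr s' 2 (off i + 1 + j) = js ! j"
        using P by simp_all
      have "arr s' 2 (off i + j) = L i ! j" if j: "j < length (L i)" for j
      proof (cases j)
        case 0
        then show ?thesis using a2(1) assms(5) by simp
      next
        case (Suc j')
        then have "off i + j = off i + 1 + j'" by simp
        then show ?thesis using a2(3)[of j'] j Suc assms(5) by (simp only:) simp
      qed
      then show ?thesis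
        using P a2(2) oS assms(5) N BN
        by (simp add: wp_simps) (rule Q, simp_all)
    qed
    done
qed


lemma wp_READER:
  assumes L: "\<And>u. u < n \<Longrightarrow> L u = n # adj ! u" "L n = [0..<n]" "length adj = n"
    and s: "s = \<lparr>reg = \<lambda>_. 0, arr = \<lambda>_ _. 0, inp = input_tape adj, outp = [], ticks = 0\<rparr>"
    and Q: "\<And>s'. ginv (\<lambda>_. []) (arr s') \<Longrightarrow> reg s' 14 = n \<Longrightarrow> reg s' 15 = 0 \<Longrightarrow> reg s' 16 = 0 \<Longrightarrow>
      reg s' 17 = 1 \<Longrightarrow> outp s' = [0] \<Longrightarrow> ticks s' \<le> 20 + 18 * n + 6 * off n \<Longrightarrow> Q s'"
  shows "wp N B READER Q s"
proof -
  have ln: "length (L n) = n" using L by simp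
  have on: "off (Suc n) = off n + n" using ln by (simp add: off_def)
  define rest where "rest i = concat (map (\<lambda>js. length js # js) (drop i adj))" for i
  define rows_ok where "rows_ok i A \<longleftrightarrow> (\<forall>u<i. A 1 u = off u \<and> A 0 u = length (L u) \<and>
      (\<forall>j<length (L u). A 2 (off u + j) = L u ! j))" for i and A :: "nat \<Rightarrow> nat \<Rightarrow> nat"
  define I where "I m st \<longleftrightarrow> m \<le> n \<and> reg st 3 = m \<and> reg st 1 = n - m \<and> reg st 2 = off (n - m) \<and>
      reg st 14 = n \<and> inp st = rest (n - m) \<and> outp st = [] \<and> rows_ok (n - m) (arr st) \<and>
      ticks st \<le> 5 + 12 * (n - m) + 6 * off (n - m)" for m and st :: state
  define J where "J m st \<longleftrightarrow> m \<le> n \<and> reg st 3 = m \<and> reg st 1 = n - m \<and> reg st 2 = off n + (n - m) \<and>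
      reg st 14 = n \<and> outp st = [] \<and> rows_ok n (arr st) \<and> arr st 1 n = off n \<and> arr st 0 n = n \<and>
      (\<forall>j<n - m. arr st 2 (off n + j) = j) \<and>
      ticks st \<le> 11 + 12 * n + 6 * off n + 6 * (n - m)" for m and st :: state
  have rows: "m > 0 \<and> wp N B ROW (I (m - 1)) (tick st)" if I: "I m st" and "reg st 3 > 0" for m st
  proof -
    have m: "0 < m" "m \<le> n" using that by (auto simp: I_def)
    define i where "i = n - m"
    have i: "i < n" "n - (m - 1) = Suc i" using m by (auto simp: i_def)
    have dn: "rows_ok i (arr st)" using I by (simp add: I_def i_def)
    have dr: "drop i adj = adj ! i # drop (Suc i) adj"
      using i L(3) by (metis Cons_nth_drop_Suc)
    have "wp N B ROW (I (m - 1)) (tick st)"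
    proof (rule wp_ROW[where i = i and js = "adj ! i" and rest = "rest (Suc i)"])
      show "inp (tick st) = length (adj ! i) # adj ! i @ rest (Suc i)"
        using I dr by (simp add: I_def i_def[symmetric] rest_def)
      fix s' :: state
      assume *: "reg s' 1 = i + 1" "reg s' 2 = off (Suc i)" "reg s' 3 = reg (tick st) 3 - 1"
        "reg s' 14 = n" "inp s' = rest (Suc i)" "outp s' = outp (tick st)"
        "arr s' 1 = (arr (tick st) 1)(i := off i)" "arr s' 0 = (arr (tick st) 0)(i := length (adj ! i) + 1)"
        "\<And>x. x < off i \<Longrightarrow> arr s' 2 x = arr (tick st) 2 x"
        "\<And>j. j < length (L i) \<Longrightarrow> arr s' 2 (off i + j) = L i ! j"
        "ticks s' = ticks (tick st) + 11 + 6 * length (adj ! i)"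
      have "rows_ok (Suc i) (arr s')"
        unfolding rows_ok_def
      proof (intro allI impI)
        fix u assume "u < Suc i"
        then consider "u < i" | "u = i" by linarith
        then show "arr s' 1 u = off u \<and> arr s' 0 u = length (L u) \<and>
          (\<forall>j<length (L u). arr s' 2 (off u + j) = L u ! j)"
        proof cases
          case 1
          then show ?thesis using dn *(7-9) off_add[of u i] by (auto simp: rows_ok_def)
        next
          case 2
          then show ?thesis using *(7,8,10) L(1)[OF i(1)] by simp
        qed
      qed
      moreover have "off (Suc i) = off i + length (adj ! i) + 1"
        using L(1)[of i] i by (simp add: off_def)
      ultimately show "I (m - 1) s'"
        using * I m i by (simp add: I_def i_def[symmetric])
    qed (use I i L(1)[of i] in \<open>auto simp: I_def i_def\<close>)
    then show ?thesis using m by simp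
  qed
  have last: "m > 0 \<and> wp N B (PUT 2 2 1 ;; IMM 0 1 ;; ADD 1 1 0 ;; ADD 2 2 0 ;; SUB 3 3 0) (J (m - 1)) (tick st)"
    if J: "J m st" and "reg st 3 > 0" for m st
  proof -
    have m: "0 < m" "m \<le> n" using that by (auto simp: J_def)
    define i where "i = n - m"
    have i: "i < n" "n - (m - 1) = Suc i" using m by (auto simp: i_def)
    have o: "off n + i < N" "off n + i + 1 \<le> B" using N on i BN by auto
    have dn: "rows_ok n ((arr st)(2 := (arr st 2)(off n + i := i)))"
      using J off_add[of _ n] unfolding rows_ok_def J_def by fastforce
    show ?thesis
      using J m i o N BN dn
      by (auto simp: wp_simps J_def i_def[symmetric] less_Suc_eq)
  qed
  have fin: "ginv (\<lambda>_. []) (arr st)" if J: "J 0 st" for st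
  proof -
    have "seg (arr st) u = L u \<and> arr st 1 u = off u \<and> arr st 0 u = length (L u)" if u: "u \<le> n" for u
    proof (cases "u = n")
      case True
      then show ?thesis using J L(2) by (auto simp: J_def seg_def intro!: nth_equalityI)
    next
      case False
      then show ?thesis using J u by (auto simp: J_def rows_ok_def seg_def intro!: nth_equalityI)
    qed
    then show ?thesis using distinct_L by (simp add: ginv_def)
  qed
  show ?thesis
    unfolding READER_def
    using N BN s L(3)
    apply (simp add: wp_simps input_tape_def)
    apply (rule wp_while_inv[where I = I and m = n])
    subgoal by (simp add: I_def rest_def rows_ok_def off_def)
    subgoal for m st using rows[of m st] by simp
    subgoal for m st
      apply (simp add: wp_simps I_def)
      apply (rule wp_while_inv[where I = J and m = n])
      subgoal by (auto simp: J_def rows_ok_def)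
      subgoal for m' st' using last[of m' st'] by simp
      subgoal for m' st'
        using fin[of st']
        apply (simp add: wp_simps)
        apply (rule Q)
        by (auto simp: J_def)
      done
    done
qed

end

subsection \<open>The amortized bound\<close>

definition MAIN :: com where
  "MAIN = READER ;; LOOP"

lemma wf_MAIN: "wf_com MAIN"
  by (simp add: MAIN_def READER_def ROW_def ENTRIES_def LOOP_def STEP_def PICK_def EMIT_def UP_def TOP_def
      UNDO_def NBRS_def DEL_def REMOVE_def SEARCH_def)

text \<open>Ordered pairs of numbers are grouped by the edge that they span; distinctness of
  \<open>vs\<close> allows at most two per edge.\<close>

lemma handshake:
  assumes adj: "adjacency_lists G vs adj" and G: "finite_simple_graph G"
  shows "(\<Sum>i<length vs. length (adj ! i)) \<le> 2 * card (edges G)"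
proof -
  let ?n = "length vs"
  let ?P = "{(i, j). i < ?n \<and> j < ?n \<and> {vs ! i, vs ! j} \<in> edges G}"
  have fin: "finite (edges G)"
    using G finite_subset[of "edges G" "Pow (verts G)"]
    by (auto simp: finite_simple_graph_def simple_graph_def)
  have dvs: "distinct vs" using adj by (simp add: adjacency_lists_def)
  have "(\<Sum>i<?n. length (adj ! i)) = (\<Sum>i<?n. card {j. j < ?n \<and> {vs ! i, vs ! j} \<in> edges G})"
    using adj by (intro sum.cong) (auto simp: adjacency_lists_def simp flip: distinct_card)
  also have "\<dots> = card (SIGMA i:{..<?n}. {j. j < ?n \<and> {vs ! i, vs ! j} \<in> edges G})"
    by (subst card_SigmaI) auto
  also have "(SIGMA i:{..<?n}. {j. j < ?n \<and> {vs ! i, vs ! j} \<in> edges G}) = ?P" by auto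
  also have "?P = (\<Union>e\<in>edges G. {(i, j). i < ?n \<and> j < ?n \<and> {vs ! i, vs ! j} = e})" by auto
  also have "card \<dots> \<le> (\<Sum>e\<in>edges G. card {(i, j). i < ?n \<and> j < ?n \<and> {vs ! i, vs ! j} = e})"
    by (rule card_UN_le[OF fin])
  also have "\<dots> \<le> (\<Sum>e\<in>edges G. 2)"
  proof (rule sum_mono)
    fix e assume e: "e \<in> edges G"
    have "e \<subseteq> verts G \<and> card e = 2"
      using G e by (auto simp: finite_simple_graph_def simple_graph_def)
    then obtain x y where xy: "e = {x, y}" "x \<in> set vs" "y \<in> set vs"
      using adj by (auto simp: card_2_iff adjacency_lists_def)
    obtain a b where ab: "a < ?n" "vs ! a = x" "b < ?n" "vs ! b = y"
      using xy by (auto simp: in_set_conv_nth)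
    have "{(i, j). i < ?n \<and> j < ?n \<and> {vs ! i, vs ! j} = e} \<subseteq> {(a, b), (b, a)}"
      using ab xy(1) nth_eq_iff_index_eq[OF dvs] by (auto simp: doubleton_eq_iff)
    then have "card {(i, j). i < ?n \<and> j < ?n \<and> {vs ! i, vs ! j} = e} \<le> card {(a, b), (b, a)}"
      by (rule card_mono[rotated]) simp
    also have "\<dots> \<le> 2" using card_insert_le_m1[of 2 "{(b, a)}" "(a, b)"] by simp
    finally show "card {(i, j). i < ?n \<and> j < ?n \<and> {vs ! i, vs ! j} = e} \<le> 2" .
  qed
  finally show ?thesis by simp
qed

text \<open>As \<open>v\<close> has minimum degree, each vertex of \<open>X\<close> is nonadjacent
  to at most \<open>r\<close> vertices of \<open>X\<close>, itself included, where \<open>r\<close>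
  is this number for \<open>v\<close>. A failure of the bound would let the greedy argument build a
  clique with as many vertices as \<open>H\<close>.\<close>

lemma clique_free_size:
  assumes G: "finite_simple_graph G" and vs: "distinct vs" "set vs = verts G" "length vs = n"
    and H: "simple_graph H" "finite (verts H)" "\<not> has_subgraph G H"
    and L: "\<And>u. u < n \<Longrightarrow> set (L u) = insert n {j. j < n \<and> {vs ! u, vs ! j} \<in> edges G}"
    and X: "X \<subseteq> {..<n}" and v: "v \<in> X"
    and le: "\<And>u. u \<in> X \<Longrightarrow> card (set (L v) \<inter> X) \<le> card (set (L u) \<inter> X)"
  shows "card X \<le> card (verts H) * (card (X - insert v (set (L v))) + 1)"
proof (rule ccontr)
  assume contra: "\<not> ?thesis"
  \<comment> \<open>Without the extra vertex, and with both numbers restricted: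
    \<open>greedy_clique\<close> asks for symmetry and irreflexivity on all numbers.\<close>
  define nb where "nb u = {j. u < n \<and> j < n \<and> {vs ! u, vs ! j} \<in> edges G}" for u
  define r where "r = card (X - set (L v))"
  have sG: "simple_graph G" using G by (simp add: finite_simple_graph_def)
  have fX: "finite X" using X finite_subset by blast
  have XL: "X - nb u = X - set (L u)" if "u \<in> X" for u
  proof -
    have "u < n" using that X by auto
    then show ?thesis using L[of u] X by (auto simp: nb_def)
  qed
  have irr: "u \<notin> nb u" for u
    using edge_neq[OF sG, of "vs ! u" "vs ! u"] by (auto simp: nb_def)
  have "v \<notin> set (L v)" using irr[of v] L[of v] X v by (auto simp: nb_def)
  then have "X - set (L v) = insert v (X - insert v (set (L v)))" using v by auto
  then have r: "r = card (X - insert v (set (L v))) + 1"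
    unfolding r_def by (metis DiffE Suc_eq_plus1 card_insert_disjoint fX finite_Diff insertI1)
  have card: "card (X - set (L u)) = card X - card (set (L u) \<inter> X)" for u
    using fX card_Diff_subset_Int[of X "set (L u)"] by (simp add: Int_commute)
  have "\<exists>Q\<subseteq>X. card Q = card (verts H) \<and> (\<forall>x\<in>Q. \<forall>y\<in>Q. x \<noteq> y \<longrightarrow> x \<in> nb y)"
  proof (rule greedy_clique[OF fX])
    fix u assume u: "u \<in> X"
    then show "card (X - nb u) \<le> r" unfolding XL[OF u] r_def card using le[OF u] by simp
  next
    show "x \<in> nb y \<Longrightarrow> y \<in> nb x" for x y by (auto simp: nb_def insert_commute)
    show "card (verts H) * r < card X + r" using contra r by simp
  qed (use irr in auto)
  then obtain Q where Q: "Q \<subseteq> X" "card Q = card (verts H)"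
    "\<And>x y. x \<in> Q \<Longrightarrow> y \<in> Q \<Longrightarrow> x \<noteq> y \<Longrightarrow> x \<in> nb y" by blast
  have inj: "inj_on ((!) vs) Q"
    using vs(1,3) Q(1) X by (intro inj_on_nth) auto
  have "has_subgraph G H"
  proof (rule clique_has_subgraph[OF H(1,2), of "(!) vs ` Q"])
    show "(!) vs ` Q \<subseteq> verts G"
    proof -
      have "vs ! i \<in> set vs" if "i \<in> Q" for i using that Q(1) X vs(3) by auto
      then show ?thesis using vs(2) by auto
    qed
    show "finite ((!) vs ` Q)" using Q(1) fX finite_subset by blast
    show "card ((!) vs ` Q) = card (verts H)" using card_image[OF inj] Q(2) by simp
    fix x y assume "x \<in> (!) vs ` Q" "y \<in> (!) vs ` Q" "x \<noteq> y"
    then obtain i j where "x = vs ! i" "y = vs ! j" "i \<in> Q" "j \<in> Q" "i \<noteq> j" by auto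
    then show "{x, y} \<in> edges G" using Q(3)[of j i] by (auto simp: nb_def)
  qed
  then show False using H(3) by simp
qed

lemma space_bounded_mono:
  assumes "space_bounded P x t k" "k \<le> l"
  shows "space_bounded P x t l"
  unfolding space_bounded_def
proof (intro allI impI)
  fix i assume "i < t"
  then have "accessed (P ! pc (config_at P x i)) (mem (config_at P x i)) \<subseteq> {..<k}"
    using assms(1) by (simp add: space_bounded_def)
  also have "\<dots> \<subseteq> {..<l}" using assms(2) by simp
  finally show "accessed (P ! pc (config_at P x i)) (mem (config_at P x i)) \<subseteq> {..<l}" .
qed

lemma MAIN_correct:
  fixes G :: "'a graph" and H :: "'b graph"
  assumes rec: "\<And>a b. a \<le> card (verts H) * (b + 1) \<Longrightarrow>
      200 * (a + 3) ^ 3 + (a + 1) ^ 4 \<le> C + b ^ 4 + a ^ 4"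
    and G: "finite_simple_graph G" and H: "simple_graph H" "finite (verts H)" "\<not> has_subgraph G H"
    and adj: "adjacency_lists G vs adj"
  shows "\<exists>t. halts_at (compile 0 MAIN) (input_tape adj) t \<and>
    prints_differences vs {} (EIS (least_pick vs) G) (printed (config_at (compile 0 MAIN) (input_tape adj) t)) \<and>
    t \<le> 6 * (5000 + C) * card (independent_sets G) \<and>
    space_bounded (compile 0 MAIN) (input_tape adj) t (60 * (card (verts G) + card (edges G) + 1)) \<and>
    words_bounded (compile 0 MAIN) (input_tape adj) t ((card (verts G) + card (edges G) + 2) ^ 7)"
proof -
  define n where "n = length vs"
  define m where "m = card (edges G)"
  define M where "M = card (independent_sets G)"
  define L where "L u = (if u < n then n # adj ! u else [0..<n])" for u
  define off where "off = (\<lambda>u. \<Sum>i<u. length (L i))"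
  define N where "N = off (Suc n) + 1"
  have vs: "distinct vs" "set vs = verts G" and ladj: "length adj = n"
    and adj': "\<And>i. i < n \<Longrightarrow> distinct (adj ! i)"
      "\<And>i. i < n \<Longrightarrow> set (adj ! i) = {j. j < n \<and> {vs ! i, vs ! j} \<in> edges G}"
    using adj by (auto simp: adjacency_lists_def n_def)
  have nV: "card (verts G) = n" using vs by (metis distinct_card n_def)
  have sG: "simple_graph G" using G by (simp add: finite_simple_graph_def)
  have L_edges: "set (L u) = insert n {j. j < n \<and> {vs ! u, vs ! j} \<in> edges G}" if "u < n" for u
    using that adj'(2) by (simp add: L_def)
  have off_n: "off n = n + (\<Sum>i<n. length (adj ! i))"
    unfolding off_def by (simp add: L_def sum_Suc)
  have off_Sn: "off (Suc n) = off n + n" by (simp add: off_def L_def)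
  have "(\<Sum>i<n. length (adj ! i)) \<le> 2 * m" using handshake[OF adj G] by (simp add: n_def m_def)
  \<comment> \<open>Linear space: at most \<open>2 * m\<close> entries for the edges, one for the
    extra vertex in each of \<open>n\<close> lists, and \<open>n\<close> in its own list.\<close>
  then have Nm: "N \<le> 2 * n + 2 * m + 1" using off_n off_Sn by (simp add: N_def)
  \<comment> \<open>The time for reading is linear in \<open>off n\<close>; bounding it by a
    polynomial in \<open>n\<close> alone lets the unspent \<open>n ^ 4\<close> absorb it.\<close>
  have off_sq: "off n \<le> n + n * n"
  proof -
    have "length (adj ! i) \<le> n" if "i < n" for i
    proof -
      have "card (set (adj ! i)) \<le> card {..<n}" using adj'(2)[OF that] by (intro card_mono) auto
      then show ?thesis using adj'(1)[OF that] by (simp add: distinct_card)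
    qed
    then have "(\<Sum>i<n. length (adj ! i)) \<le> (\<Sum>i<n. n)" by (intro sum_mono) auto
    then show ?thesis using off_n by simp
  qed
  interpret eis_layout n L N "2 * N" off G vs
  proof
    show "distinct (L u)" if "u \<le> n" for u
      using that adj' by (auto simp: L_def)
    show "set (L u) \<subseteq> {..n}" if "u \<le> n" for u
      using that adj' by (auto simp: L_def)
    show "w \<in> set (L u) \<longleftrightarrow> u \<in> set (L w)" if "u \<le> n" "w \<le> n" for u w
      using that adj'(2) by (auto simp: L_def insert_commute)
    show "u \<notin> set (L u)" if "u \<le> n" for u
      using that adj'(2)[of u] edge_neq[OF sG, of "vs ! u" "vs ! u"] by (auto simp: L_def)
    show "set (L n) = {..<n}" by (auto simp: L_def)
    show "off = (\<lambda>u. \<Sum>i<u. length (L i))" by (rule off_def)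
    show "off (Suc n) < N" "n < N" using off_Sn by (auto simp: N_def)
    show "2 * N \<le> 2 * N" by simp
    show "finite_simple_graph G" by (rule G)
    show "distinct vs" "set vs = verts G" "length vs = n" using vs by (auto simp: n_def)
    show "set (L u) = insert n {j. j < n \<and> {vs ! u, vs ! j} \<in> edges G}" if "u < n" for u
      using L_edges that by simp
  qed
  have EIS: "EIS (least_pick vs) G = {} # sols [] []"
    using ind_full by (simp add: EIS_def rec_eis.simps sols_def)
  have Mlen: "M = Suc (length (sols [] []))"
    using EIS_correct(3)[OF min_degree_rule_least_pick G, of vs] by (simp add: EIS M_def)
  let ?s0 = "\<lparr>reg = \<lambda>_. 0, arr = \<lambda>_ _. 0, inp = input_tape adj, outp = [], ticks = 0\<rparr>"
  let ?Q = "\<lambda>s. prints_differences vs {} (EIS (least_pick vs) G) (outp s) \<and>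
    ticks s \<le> (5000 + C) * M"
  have run: "wp N (2 * N) MAIN ?Q ?s0"
    unfolding MAIN_def wp_simps
  proof (rule wp_READER[where adj = adj])
    fix s1 :: state
    assume s1: "ginv (\<lambda>_. []) (arr s1)" "reg s1 14 = n" "reg s1 15 = 0" "reg s1 16 = 0"
      "reg s1 17 = 1" "outp s1 = [0]" and t1: "ticks s1 \<le> 20 + 18 * n + 6 * off n"
    have dl0: "dl [] = (\<lambda>_. [])" by auto
    show "wp N (2 * N) LOOP ?Q s1"
    proof (rule wp_LOOP[where k = "card (verts H)" and C = C and D = "[]" and T = "[]"])
      show "minv [] [] s1" using s1 by (simp add: minv_def dl0)
      show "200 * (a + 3) ^ 3 + (a + 1) ^ 4 \<le> C + b ^ 4 + a ^ 4"
        if "a \<le> card (verts H) * (b + 1)" for a b using rec that .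
      show "card X \<le> card (verts H) * (card (X - insert v (set (L v))) + 1)"
        if "X \<subseteq> {..<n}" "v \<in> X" "\<And>u. u \<in> X \<Longrightarrow> card (set (L v) \<inter> X) \<le> card (set (L u) \<inter> X)" for X v
        using clique_free_size[OF G vs(1,2) _ H L_edges that] by (simp add: n_def)
      fix s' :: state and E out
      assume m: "minv (E @ []) [] s'" and full: "length (E @ []) = n"
        and out: "outp s' = outp s1 @ out" "prints_differences vs (prev s1) (sols [] []) out"
        and t: "ticks s' + 11 * reg s' 16 + (n - length []) ^ 4
          \<le> ticks s1 + 11 * reg s1 16 + C * length (sols [] [])"
      have pr: "prints_differences vs {} (EIS (least_pick vs) G) (outp s')"
      proof -
        have "prev s1 = {}" using s1 by (simp add: prev_def)
        then have "prints_differences vs {} ({} # sols [] []) (map Suc [] @ 0 # out)"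
          using out(2) by (intro prints_differences_Cons) auto
        then show ?thesis using out(1) s1 by (simp add: EIS)
      qed
      have "ticks s' + n ^ 4 \<le> 20 + 24 * n + 6 * (n * n) + C * length (sols [] [])"
        using t t1 off_sq s1 by simp
      \<comment> \<open>The surplus of the outermost loop pays for reading if
        \<open>n \<ge> 8\<close>; smaller graphs are covered by a constant.\<close>
      moreover have "20 + 24 * n + 6 * (n * n) \<le> 4000 + n ^ 4"
      proof (cases "n \<le> 7")
        case True
        then have "n * n \<le> 7 * 7" by (intro mult_mono) auto
        then show ?thesis using True by simp
      next
        case False
        then have "8 * n \<le> n * n" "64 * (n * n) \<le> n * n * (n * n)"
          by (auto intro!: mult_right_mono mult_mono[of 8 n 8 n, simplified])
        moreover have "n ^ 4 = n * n * (n * n)" by (simp add: power_numeral_reduce)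
        ultimately show ?thesis by linarith
      qed
      ultimately have tk: "ticks s' + 10 \<le> (5000 + C) * M"
        using Mlen by (simp add: algebra_simps)
      have "reg s' 15 = 0" "reg s' 17 = 1" "arr s' 0 n = 0" "reg s' 14 = n"
        using m full minv_n[OF m] by (auto simp: minv_def)
      \<comment> \<open>One more round finds neither vertices nor a solution to pop and clears the
        flag; its ticks fit into the 10 reserved in \<open>tk\<close>.\<close>
      then show "wp N (2 * N) LOOP ?Q s'"
        unfolding LOOP_def using N pr tk
        by (subst wp_WHILE, simp add: STEP_def wp_simps, subst wp_WHILE, simp)
    qed
  qed (use ladj in \<open>auto simp: L_def\<close>)
  \<comment> \<open>The base is at least 2, so six of the seven factors supply a constant 64 that
    dominates the linear coefficients.\<close>
  have W: "40 + 8 * N \<le> (n + m + 2) ^ 7" "2 * N \<le> (n + m + 2) ^ 7"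
  proof -
    have pw: "x ^ 6 * x = x ^ 7" for x :: nat by (simp add: power_numeral_reduce mult_ac)
    have "2 ^ 6 * (n + m + 2) \<le> (n + m + 2) ^ 6 * (n + m + 2)"
      by (intro mult_right_mono power_mono) auto
    also have "\<dots> = (n + m + 2) ^ 7" by (rule pw)
    finally show "40 + 8 * N \<le> (n + m + 2) ^ 7" "2 * N \<le> (n + m + 2) ^ 7" using Nm by simp_all
  qed
  obtain t and s :: state where t: "?Q s" "halts_at (compile 0 MAIN) (input_tape adj) t"
    "printed (config_at (compile 0 MAIN) (input_tape adj) t) = outp s" "t \<le> 6 * ticks s"
    "space_bounded (compile 0 MAIN) (input_tape adj) t (32 + 8 * N)"
    "words_bounded (compile 0 MAIN) (input_tape adj) t ((n + m + 2) ^ 7)"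
    using wp_run[OF run wf_MAIN W] by blast
  have sp: "space_bounded (compile 0 MAIN) (input_tape adj) t (60 * (n + m + 1))"
    by (rule space_bounded_mono[OF t(5)]) (use Nm in simp)
  have "6 * ticks s \<le> 6 * ((5000 + C) * M)" using t(1) by simp
  then have le: "t \<le> 6 * (5000 + C) * M" using t(4) unfolding mult.assoc by linarith
  show ?thesis
    unfolding nV m_def[symmetric] M_def[symmetric]
    by (intro exI[of _ t] conjI) (use t(1,2,3,6) sp le in auto)
qed

theorem corollary17:
  shows "\<exists>(P :: program) (pick :: 'a list \<Rightarrow> 'a graph \<Rightarrow> 'a) (c :: nat \<Rightarrow> nat) (d :: nat) (w :: nat).
    (\<forall>vs. min_degree_rule (pick vs)) \<and>
    (\<forall>(R :: 'b graph set) (C :: 'a graph set) (H :: 'b graph).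
       (\<forall>F\<in>R. simple_graph F) \<and>
       (\<forall>G\<in>C. finite_simple_graph G) \<and>
       (\<forall>G\<in>C. \<forall>F\<in>R. \<not> has_subgraph G F) \<and>
       H \<in> R \<and> finite (verts H) \<longrightarrow>
       (\<forall>G\<in>C. \<forall>vs adj. adjacency_lists G vs adj \<longrightarrow>
          (let n = card (verts G); m = card (edges G); M = card (independent_sets G);
               x = input_tape adj; sols = EIS (pick vs) G
           in distinct sols \<and> set sols = independent_sets G \<and>
              (\<exists>t. halts_at P x t \<and>
                   prints_differences vs {} sols (printed (config_at P x t)) \<and>
                   t \<le> c (card (verts H)) * M \<and>
                   space_bounded P x t (d * (n + m + 1)) \<and>
                   words_bounded P x t ((n + m + 2) ^ w)))))"
proof -
  have "\<forall>k :: nat. \<exists>C. \<forall>a b. a \<le> k * (b + 1) \<longrightarrow>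
      200 * (a + 3) ^ 3 + (a + 1) ^ 4 \<le> C + b ^ 4 + a ^ 4"
    using polynomial_recurrence_bound by blast
  \<comment> \<open>Only the time constant depends on \<open>H\<close>, and only through its number
    of vertices; choosing it for every \<open>k\<close> at once allows one program for all
    classes.\<close>
  from choice[OF this] obtain C where C: "\<And>(k :: nat) a b. a \<le> k * (b + 1) \<Longrightarrow>
      200 * (a + 3) ^ 3 + (a + 1) ^ 4 \<le> C k + b ^ 4 + a ^ 4"
    by blast
  show ?thesis
  proof (rule exI[of _ "compile 0 MAIN"], rule exI[of _ least_pick],
      rule exI[of _ "\<lambda>k. 6 * (5000 + C k)"], rule exI[of _ 60], rule exI[of _ 7],
      intro conjI allI impI ballI, goal_cases)
    case (1 vs)
    show ?case by (rule min_degree_rule_least_pick)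
  next
    case (2 R CC H G vs adj)
    then have G: "finite_simple_graph G" "simple_graph H" "finite (verts H)" "\<not> has_subgraph G H"
      by auto
    show ?case
      using EIS_correct[OF min_degree_rule_least_pick G(1), of vs] MAIN_correct[OF C[of _ "card (verts H)"] G 2(3)]
      by (simp add: Let_def)
  qed
qed

end
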